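(* Let $a\ge 1$ be an integer. The monotone $a$-orbifold Hurwitz numbers $\vec H^{[a]}_{g,n}(\mu_1,\dots,\mu_n)$ and their refinements $\vec H^{[a],\ell}_{g,n}(\mu_1\,|\,\mu_2,\dots,\mu_n)$, $\ell\in\{1,\dots,a\}$ (both defined in the context), satisfy the following, where $g\ge 0$, $n\ge 1$, $\mu_1,\dots,\mu_n\ge 1$ are integers, $S=\{1,\dots,n\}$ and $|\boldsymbol\mu|=\mu_1+\cdots+\mu_n$. (i) $\displaystyle \vec H^{[a]}_{g,n}(\mu_1,\dots,\mu_n)=\sum_{i=1}^n\sum_{\ell=1}^a \vec H^{[a],\ell}_{g,n}(\mu_i\,|\,\boldsymbol\mu_{S\setminus\{i\}})$. (ii) (Base case) $\vec H^{[a],\ell}_{0,1}(a\,|\,)=\frac1a\,\delta_{\ell,1}$ for $1\le \ell\le a$. (iii) (Cut-and-join recursion) For all $(g,n,\boldsymbol\mu)$ other than the base case $(g,n,\mu_1)=(0,1,a)$ and all $1\le\ell\le a$, $$ \begin{aligned} \vec H^{[a],\ell}_{g,n}(\mu_1\,|\,\boldsymbol\mu_{S\setminus\{1\}}) ={}& \Theta(\mu_1+\ell-a-1)\sum_{p=1}^{\ell}\sum_{i=2}^n \vec H^{[a],p}_{g,n-1}(\mu_1+\mu_i\,|\,\boldsymbol\mu_{S\setminus\{1,i\}})\\ &+\sum_{\alpha+\beta=\mu_1}\sum_{p=1}^{\ell}\beta\,\vec H^{[a],p}_{g-1,n+1}(\alpha\,|\,\boldsymbol\mu_{S\setminus\{1\}},\beta)\\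 &+\sum_{\alpha+\beta=\mu_1}\ \sum_{\substack{g_1+g_2=g\\ I\sqcup J=S\setminus\{1\}}}\ \sum_{p=1}^{\ell}\frac{|\boldsymbol\mu_J|+\alpha}{|\boldsymbol\mu|}\,\beta\,\vec H^{[a]}_{g_1,|I|+1}(\boldsymbol\mu_I,\beta)\,\vec H^{[a],p}_{g_2,|J|+1}(\alpha\,|\,\boldsymbol\mu_J). \end{aligned} $$ Moreover, all the numbers $\vec H^{[a]}_{g,n}$ (and $\vec H^{[a],\ell}_{g,n}$) are completely determined by (i), (ii) and (iii).
   Context: Products of permutations are composed left to right, i.e. in $\sigma_0\sigma_1\cdots\sigma_m$ the permutation $\sigma_0$ is applied first. A sequence of transpositions $\sigma_1,\dots,\sigma_m$, written $\sigma_i=(r_i\ s_i)$ with $r_i<s_i$, is monotone if $s_1\le s_2\le\cdots\le s_m$. For integers $g\ge0$, $n\ge1$ and a tuple of positive integers $\boldsymbol\mu=(\mu_1,\dots,\mu_n)$, a monotone $a$-orbifold Hurwitz factorisation of type $(g,\boldsymbol\mu)$ is a tuple $(\sigma_0,\sigma_1,\dots,\sigma_m)$ of permutations in $S_{|\boldsymbol\mu|}$ such that: $m=2g-2+n+\frac{|\boldsymbol\mu|}{a}$; $\sigma_0$ has cycle type $(a,a,\dots,a)$; $\sigma_1,\dots,\sigma_m$ is a monotone sequence of transpositions; the cycles of $\sigma_0\sigma_1\cdots\sigma_m$ (fixed points included) are labelled $1,\dots,n$ so that cycle $i$ has length $\mu_i$ (the labelling is part of the data); and $\sigma_0,\dots,\sigma_m$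 generate a transitive subgroup of $S_{|\boldsymbol\mu|}$. The monotone $a$-orbifold Hurwitz number $\vec H^{[a]}_{g,n}(\mu_1,\dots,\mu_n)$ is $\frac{1}{|\boldsymbol\mu|!}$ times the number of monotone $a$-orbifold Hurwitz factorisations of type $(g,\boldsymbol\mu)$ (so it is $0$ if $a\nmid|\boldsymbol\mu|$). Refined numbers: let $|\boldsymbol\mu|=ak$ and fix $$\sigma_0=(1,2,\dots,a)(a+1,\dots,2a)\cdots(ak-a+1,\dots,ak).$$ For $\ell\in\{1,\dots,a\}$, let $N^\ell_g(\mu_1\,|\,\mu_2,\dots,\mu_n)$ be the number of monotone $a$-orbifold Hurwitz factorisations of type $(g,\boldsymbol\mu)$ with this fixed $\sigma_0$ such that $\sigma_m$ has the form $(r_m,\ ak-a+\ell)$ with $r_m<ak-a+\ell$, and all of the numbers $ak-a+\ell,\dots,ak$ lie in the cycle of $\sigma_0\sigma_1\cdots\sigma_m$ labelled $1$ (which has length $\mu_1$). In the only case with $m=0$, namely $g=0$, $n=1$, $\mu_1=a$, the convention is $N^\ell_0(a\,|\,)=\delta_{\ell,1}$. Then $$\vec H^{[a],\ell}_{g,n}(\mu_1\,|\,\mu_2,\dots,\mu_n)=\frac{1}{a^k\,k!}\,N^\ell_g(\mu_1\,|\,\mu_2,\dots,\mu_n),$$ and this is $0$ if $a\nmid|\boldsymbol\mu|$. Notation: for $I=\{i_1<\dots<i_r\}\subseteq S$, $\boldsymbol\mu_I=(\mu_{i_1},\dots,\mu_{i_r})$ and $|\boldsymbol\mu_I|=\sum_{i\in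 I}\mu_i$. Sums over $\alpha+\beta=\mu_1$ are over positive integers $\alpha,\beta$; sums over $g_1+g_2=g$ are over non-negative integers; sums over $I\sqcup J=S\setminus\{1\}$ are over ordered pairs of disjoint, possibly empty, subsets with the given union; terms with negative genus are zero. $\Theta$ is the Heaviside step function with $\Theta(t)=1$ for $t\ge0$ and $\Theta(t)=0$ for $t<0$. *)

theory Defs
  imports Complex_Main "HOL-Combinatorics.Orbits" "HOL-Algebra.Sym_Groups"
begin

text \<open>
  Permutations of \<open>{1..d}\<close> are functions \<open>nat \<Rightarrow> nat\<close> that permute \<open>{1..d}\<close>. Products of
  permutations are composed from left to right. A tuple \<open>(\<mu>\<^sub>1, \<dots>, \<mu>\<^sub>n)\<close> is a list \<open>\<mu>\<close> of
  length \<open>n\<close> and \<open>|\<mu>|\<close> is \<open>sum_list \<mu>\<close>; since list positions start at 0, label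
  \<open>i\<close> is position \<open>i - 1\<close>.
\<close>

definition perm_prod :: "(nat \<Rightarrow> nat) list \<Rightarrow> nat \<Rightarrow> nat" where
  "perm_prod \<sigma>s = foldl (\<lambda>p q. q \<circ> p) id \<sigma>s"

text \<open>The cycles, as sets of points; a fixed point \<open>x\<close> gives the cycle \<open>{x}\<close>.\<close>

definition cycles_of :: "nat \<Rightarrow> (nat \<Rightarrow> nat) \<Rightarrow> nat set set" where
  "cycles_of d p = orbit p ` {1..d}"

definition cycle_type :: "nat \<Rightarrow> (nat \<Rightarrow> nat) \<Rightarrow> nat multiset" where
  "cycle_type d p = image_mset card (mset_set (cycles_of d p))"

definition monotone_transpositions :: "nat \<Rightarrow> (nat \<Rightarrow> nat) list \<Rightarrow> bool" where
  "monotone_transpositions d \<sigma>s \<longleftrightarrow>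
     (\<exists>rs :: (nat \<times> nat) list.
        \<sigma>s = map (\<lambda>(r, s). transpose r s) rs \<and>
        (\<forall>(r, s) \<in> set rs. 1 \<le> r \<and> r < s \<and> s \<le> d) \<and>
        sorted (map snd rs))"

definition transitive_on :: "nat \<Rightarrow> (nat \<Rightarrow> nat) set \<Rightarrow> bool" where
  "transitive_on d G \<longleftrightarrow> (\<forall>x\<in>{1..d}. \<forall>y\<in>{1..d}. \<exists>p\<in>G. p x = y)"

text \<open>
  A labelling of the cycles is the list \<open>cs\<close> enumerating them in the order of their labels.
  The equation for \<open>length \<sigma>s\<close> is over the reals, so it forces \<open>a\<close> to divide \<open>|\<mu>|\<close>.
\<close>

definition monotone_factorisation ::
  "nat \<Rightarrow> nat \<Rightarrow> nat list \<Rightarrow> (nat \<Rightarrow> nat) \<Rightarrow> (nat \<Rightarrow> nat) list \<Rightarrow> nat set list \<Rightarrow> bool" where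
  "monotone_factorisation a g \<mu> \<sigma>0 \<sigma>s cs \<longleftrightarrow>
     (let d = sum_list \<mu>; n = length \<mu> in
        real (length \<sigma>s) = 2 * real g - 2 + real n + real d / real a \<and>
        \<sigma>0 permutes {1..d} \<and>
        cycle_type d \<sigma>0 = replicate_mset (d div a) a \<and>
        monotone_transpositions d \<sigma>s \<and>
        distinct cs \<and> set cs = cycles_of d (perm_prod (\<sigma>0 # \<sigma>s)) \<and> map card cs = \<mu> \<and>
        transitive_on d (generate (sym_group d) (set (\<sigma>0 # \<sigma>s))))"

definition monotone_hurwitz :: "nat \<Rightarrow> nat \<Rightarrow> nat list \<Rightarrow> real" where
  "monotone_hurwitz a g \<mu> =
     real (card {(\<sigma>0, \<sigma>s, cs). monotone_factorisation a g \<mu> \<sigma>0 \<sigma>s cs}) / fact (sum_list \<mu>)"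

text \<open>The permutation \<open>(1, \<dots>, a)(a+1, \<dots>, 2a)\<cdots>(d-a+1, \<dots>, d)\<close>, for \<open>d\<close> a multiple of \<open>a\<close>.\<close>

definition standard_perm :: "nat \<Rightarrow> nat \<Rightarrow> nat \<Rightarrow> nat" where
  "standard_perm a d x =
     (if x \<in> {1..d} then (if a dvd x then x + 1 - a else x + 1) else x)"

text \<open>
  In \<open>refined_count a g l \<mu>1 \<nu>\<close> and \<open>refined_hurwitz a g l \<mu>1 \<nu>\<close> the list \<open>\<nu>\<close> is
  \<open>(\<mu>\<^sub>2, \<dots>, \<mu>\<^sub>n)\<close>. The first branch is the convention for the only case without
  transpositions.
\<close>

definition refined_count :: "nat \<Rightarrow> nat \<Rightarrow> nat \<Rightarrow> nat \<Rightarrow> nat list \<Rightarrow> nat" where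
  "refined_count a g l \<mu>1 \<nu> =
     (if g = 0 \<and> \<nu> = [] \<and> \<mu>1 = a then (if l = 1 then 1 else 0)
      else
        (let d = \<mu>1 + sum_list \<nu> in
         card {(\<sigma>s, cs).
           monotone_factorisation a g (\<mu>1 # \<nu>) (standard_perm a d) \<sigma>s cs \<and>
           \<sigma>s \<noteq> [] \<and>
           (\<exists>r. 1 \<le> r \<and> r < d - a + l \<and> last \<sigma>s = transpose r (d - a + l)) \<and>
           {d - a + l..d} \<subseteq> hd cs}))"

definition refined_hurwitz :: "nat \<Rightarrow> nat \<Rightarrow> nat \<Rightarrow> nat \<Rightarrow> nat list \<Rightarrow> real" where
  "refined_hurwitz a g l \<mu>1 \<nu> =
     (let d = \<mu>1 + sum_list \<nu>; k = d div a in
      if a dvd d then real (refined_count a g l \<mu>1 \<nu>) / (real a ^ k * fact k) else 0)"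

definition heaviside :: "int \<Rightarrow> real" where
  "heaviside t = (if t \<ge> 0 then 1 else 0)"

definition all_pos :: "nat list \<Rightarrow> bool" where
  "all_pos \<mu> \<longleftrightarrow> (\<forall>x\<in>set \<mu>. x \<ge> 1)"

text \<open>
  The three relations are stated for arbitrary families \<open>H g \<mu>\<close> and \<open>R g l \<mu>1 \<nu>\<close>, as the
  uniqueness claim quantifies over them. Subtuples \<open>\<mu>\<^sub>I\<close> are \<open>nths \<mu> I\<close>.
\<close>

definition sum_relation ::
  "nat \<Rightarrow> (nat \<Rightarrow> nat list \<Rightarrow> real) \<Rightarrow> (nat \<Rightarrow> nat \<Rightarrow> nat \<Rightarrow> nat list \<Rightarrow> real) \<Rightarrow> bool" where
  "sum_relation a H R \<longleftrightarrow>
     (\<forall>g \<mu>. \<mu> \<noteq> [] \<and> all_pos \<mu> \<longrightarrow>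
        H g \<mu> = (\<Sum>i<length \<mu>. \<Sum>l=1..a. R g l (\<mu> ! i) (nths \<mu> ({..<length \<mu>} - {i}))))"

definition base_case ::
  "nat \<Rightarrow> (nat \<Rightarrow> nat \<Rightarrow> nat \<Rightarrow> nat list \<Rightarrow> real) \<Rightarrow> bool" where
  "base_case a R \<longleftrightarrow> (\<forall>l\<in>{1..a}. R 0 l a [] = 1 / real a * (if l = 1 then 1 else 0))"

definition cut_and_join ::
  "nat \<Rightarrow> (nat \<Rightarrow> nat list \<Rightarrow> real) \<Rightarrow> (nat \<Rightarrow> nat \<Rightarrow> nat \<Rightarrow> nat list \<Rightarrow> real) \<Rightarrow> bool" where
  "cut_and_join a H R \<longleftrightarrow>
     (\<forall>g \<mu>1 \<nu>. \<forall>l\<in>{1..a}.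
        \<mu>1 \<ge> 1 \<and> all_pos \<nu> \<and> \<not> (g = 0 \<and> \<nu> = [] \<and> \<mu>1 = a) \<longrightarrow>
        R g l \<mu>1 \<nu> =
          heaviside (int \<mu>1 + int l - int a - 1) *
            (\<Sum>p=1..l. \<Sum>i<length \<nu>. R g p (\<mu>1 + \<nu> ! i) (nths \<nu> ({..<length \<nu>} - {i})))
        + (\<Sum>(\<alpha>, \<beta>) \<in> {(\<alpha>, \<beta>). 1 \<le> \<alpha> \<and> 1 \<le> \<beta> \<and> \<alpha> + \<beta> = \<mu>1}. \<Sum>p=1..l.
            real \<beta> * (if g = 0 then 0 else R (g - 1) p \<alpha> (\<nu> @ [\<beta>])))
        + (\<Sum>(\<alpha>, \<beta>) \<in> {(\<alpha>, \<beta>). 1 \<le> \<alpha> \<and> 1 \<le> \<beta> \<and> \<alpha> + \<beta> = \<mu>1}.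
           \<Sum>(g1, g2) \<in> {(g1, g2). g1 + g2 = g}.
           \<Sum>(I, J) \<in> {(I, J). I \<union> J = {..<length \<nu>} \<and> I \<inter> J = {}}.
           \<Sum>p=1..l.
             real (sum_list (nths \<nu> J) + \<alpha>) / real (\<mu>1 + sum_list \<nu>) * real \<beta> *
             H g1 (nths \<nu> I @ [\<beta>]) * R g2 p \<alpha> (nths \<nu> J)))"

end

theory Submission
  imports Defs "HOL-Library.Multiset" "HOL-Library.Infinite_Set"
begin

text \<open>
  Remove the last transposition \<open>(r s)\<close> of a monotone factorisation and compare the cycles and
  the orbits before and after. If \<open>r\<close> and \<open>s\<close> lie in the same cycle of the shorter product, that
  cycle is cut and \<open>r\<close> is determined by the length of the piece that contains \<open>s\<close>. If they lie
  in different cycles, the cycles are joined and \<open>r\<close> is an arbitrary point of a cycle of length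
  \<open>\<beta>\<close>; the remaining factorisation is then either transitive or has exactly two orbits. In the
  latter case a monotone sequence is the unique monotone interleaving of its restrictions to the
  two orbits, which are unions of cycles of \<open>\<sigma>\<^sub>0\<close>; counting these unions gives the factor
  \<open>(|\<mu>\<^sub>J| + \<alpha>) / |\<mu>|\<close>.

  The numbers with \<open>\<sigma>\<^sub>0\<close> fixed determine those with \<open>\<sigma>\<^sub>0\<close> arbitrary, since the number of transitive
  monotone factorisations depends only on the cycle type of \<open>\<sigma>\<^sub>0\<close>: monotone sequences are complete
  homogeneous symmetric polynomials in the Jucys-Murphy elements, here acting on functions of pairs
  of a permutation and an equivalence relation that records the orbits.
\<close>

section \<open>Orbits and transpositions\<close>

text \<open>The recursion closes because of the place of the base point
  \<open>b = a * k - a + l\<close> in the last block: there \<open>\<sigma>\<^sub>0\<close> sends x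
  to x + 1, and transpositions with larger point at most b do not disturb this. So the cycle of b
  contains all of b, ..., a k. A point r outside it is smaller than b, so a join puts no condition
  on r, while in a cut the condition r < b becomes the step function. The prefix left after the
  removal is only bounded by b, but transitivity forces the larger point of its own last
  transposition, if any, into the last block; this gives the sum over p \<le> l. In the disconnected
  case the last block lies on the side of b, so the k1 blocks of the other side are chosen among k -
  1, and binom(k-1, k1) / binom(k, k1) = (k - k1) / k is the factor in the recursion. The two sides
  need not be intervals; hence orbits, labellings and sequences live on finite sets
  \<open>V\<close>, and increasing relabellings lead back. Counts are indexed by the number of
  transpositions. Genera enter at the end, through a Riemann-Hurwitz equation for nonzero
  counts.\<close>

definition cyc :: "nat set \<Rightarrow> (nat \<Rightarrow> nat) \<Rightarrow> nat set set" where
  "cyc V p = orbit p ` V"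

definition lab :: "nat set \<Rightarrow> (nat \<Rightarrow> nat) \<Rightarrow> nat list \<Rightarrow> nat set list set" where
  "lab V p \<mu> = {cs. distinct cs \<and> set cs = cyc V p \<and> map card cs = \<mu>}"

lemma self_in_orbit:
  assumes "finite V" "p permutes V" shows "x \<in> orbit p x"
  using assms by (meson permutation_permutes permutation_self_in_orbit)

lemma orbit_eq_iff:
  assumes "finite V" "p permutes V" shows "orbit p x = orbit p y \<longleftrightarrow> x \<in> orbit p y"
  using self_in_orbit[OF assms] orbit_cyclic_eq3[OF cyclic_on_orbit[OF assms(2,1)]] by blast

lemma orbit_eq_if_mem:
  assumes "finite V" "p permutes V" "y \<in> orbit p x" shows "orbit p y = orbit p x"
  using assms(3) orbit_eq_iff[OF assms(1,2)] by blast

lemma cyc_eq_orbit: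
  assumes "finite V" "p permutes V" "A \<in> cyc V p" "x \<in> A" shows "A = orbit p x"
  using assms(3,4) orbit_eq_if_mem[OF assms(1,2)] by (auto simp: cyc_def)

lemma cyc_eqI:
  assumes "finite V" "p permutes V" "A \<in> cyc V p" "B \<in> cyc V p" "x \<in> A" "x \<in> B" shows "A = B"
  using cyc_eq_orbit[OF assms(1,2)] assms(3-) by blast

lemma cyc_subset: "p permutes V \<Longrightarrow> A \<in> cyc V p \<Longrightarrow> A \<subseteq> V"
  by (auto simp: cyc_def dest: permutes_orbit_subset)

lemma Union_cyc: "finite V \<Longrightarrow> p permutes V \<Longrightarrow> \<Union>(cyc V p) = V"
  using permutes_orbit_subset self_in_orbit by (fastforce simp: cyc_def)

lemma finite_cyc [simp]: "finite V \<Longrightarrow> finite (cyc V p)"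
  by (simp add: cyc_def)

lemma cyc_nonempty: "A \<in> cyc V p \<Longrightarrow> A \<noteq> {}"
  by (auto simp: cyc_def orbit_nonempty)

lemma sum_card_cyc:
  assumes "finite V" "p permutes V" shows "(\<Sum>A\<in>cyc V p. card A) = card V"
proof -
  have "card (\<Union>(cyc V p)) = (\<Sum>A\<in>cyc V p. card A)"
  proof (rule card_Union_disjoint)
    show "pairwise disjnt (cyc V p)"
      using cyc_eqI[OF assms] by (auto simp: pairwise_def disjnt_def)
    show "finite A" if "A \<in> cyc V p" for A
      using cyc_subset[OF assms(2) that] assms(1) by (rule finite_subset)
  qed
  then show ?thesis using Union_cyc[OF assms] by simp
qed

lemma sum_list_lab:
  assumes "finite V" "p permutes V" "cs \<in> lab V p \<mu>" shows "sum_list \<mu> = card V"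
proof -
  have "sum_list \<mu> = sum card (set cs)"
    using assms(3) by (auto simp: lab_def sum_list_distinct_conv_sum_set)
  then show ?thesis using assms sum_card_cyc by (simp add: lab_def)
qed

lemma finite_lab: "finite V \<Longrightarrow> finite (lab V p \<mu>)"
  by (rule finite_subset[OF _ finite_lists_length_eq[of "cyc V p" "length \<mu>"]])
     (auto simp: lab_def)

section \<open>Effect of a transposition on single orbits\<close>

lemma transpose_comp_permutes:
  "p permutes V \<Longrightarrow> r \<in> V \<Longrightarrow> s \<in> V \<Longrightarrow> transpose r s \<circ> p permutes V"
  by (simp add: permutes_compose permutes_swap_id)

text \<open>While the trajectory of x avoids r and s, the transposition applied after p does
  nothing. Index 0 is exempt because the transposition acts on images and not on the starting point,
  so x itself may be r or s.\<close>

lemma funpow_transpose_comp: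
  fixes p :: "'a \<Rightarrow> 'a"
  assumes "\<And>i. 0 < i \<Longrightarrow> i < n \<Longrightarrow> (p ^^ i) x \<noteq> r \<and> (p ^^ i) x \<noteq> s" "i < n"
  shows "((transpose r s \<circ> p) ^^ i) x = (p ^^ i) x"
  using assms(2)
proof (induction i)
  case (Suc i)
  have "(transpose r s \<circ> p) ((p ^^ i) x) = p ((p ^^ i) x)"
    using assms(1)[of "Suc i"] Suc.prems by (simp add: transpose_apply_other)
  then show ?case using Suc by simp
qed simp

text \<open>The first return time \<open>funpow_dist1 p x x\<close> equals the size of the orbit, so
  all statements about return times can be made with \<open>card\<close>.\<close>

lemma funpow_card_orbit:
  assumes "finite V" "p permutes V"
  shows "(p ^^ card (orbit p x)) x = x" "inj_on (\<lambda>i. (p ^^ i) x) {..<card (orbit p x)}"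
    "orbit p x = (\<lambda>i. (p ^^ i) x) ` {..<card (orbit p x)}"
proof -
  have x: "x \<in> orbit p x" using self_in_orbit[OF assms] .
  let ?n = "funpow_dist1 p x x"
  have n: "(p ^^ ?n) x = x" "0 < ?n" using x funpow_dist1_prop[of x p x] by (simp_all del: funpow.simps)
  have inj: "inj_on (\<lambda>i. (p ^^ i) x) {0..<?n}" using x by (rule inj_on_funpow_dist1)
  have o: "orbit p x = (\<lambda>i. (p ^^ i) x) ` {0..<?n}"
    using orbit_altdef_bounded[OF n] by (auto simp: image_def)
  then have c: "card (orbit p x) = ?n" using inj by (simp add: card_image)
  show "(p ^^ card (orbit p x)) x = x" "inj_on (\<lambda>i. (p ^^ i) x) {..<card (orbit p x)}"
    "orbit p x = (\<lambda>i. (p ^^ i) x) ` {..<card (orbit p x)}"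
    using n inj o unfolding c by (simp_all add: lessThan_atLeast0)
qed

text \<open>The trajectory of s is unchanged until the step that would reach r, which is redirected
  to s. So the new cycle of s closes after exactly n points and leaves r out.\<close>

lemma orbit_split:
  assumes V: "finite V" "p permutes V" and "r \<noteq> s"
    and n: "0 < n" "n < card (orbit p s)" and r: "r = (p ^^ n) s"
  defines "q \<equiv> transpose r s \<circ> p"
  shows "orbit q s = (\<lambda>i. (p ^^ i) s) ` {..<n}" "card (orbit q s) = n" "r \<notin> orbit q s"
proof -
  have inj: "inj_on (\<lambda>i. (p ^^ i) s) {..<card (orbit p s)}" by (rule funpow_card_orbit[OF V])
  have ne: "(p ^^ i) s \<noteq> r \<and> (p ^^ i) s \<noteq> s" if "0 < i" "i < n" for i
    using inj_onD[OF inj, of i n] inj_onD[OF inj, of i 0] that n r by auto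
  have q: "(q ^^ i) s = (p ^^ i) s" if "i < n" for i
    using funpow_transpose_comp[of n p s r s, OF ne that] by (simp add: q_def)
  obtain k where k: "n = Suc k" using n by (cases n) auto
  have "(q ^^ n) s = q ((p ^^ k) s)" using q[of k] k by simp
  also have "\<dots> = s" using r k by (simp add: q_def)
  finally have "orbit q s = {(q ^^ m) s |m. m < n}" using n by (intro orbit_altdef_bounded)
  then show o: "orbit q s = (\<lambda>i. (p ^^ i) s) ` {..<n}" using q by force
  have "inj_on (\<lambda>i. (p ^^ i) s) {..<n}" by (rule inj_on_subset[OF inj]) (use n in auto)
  then show "card (orbit q s) = n" unfolding o by (simp add: card_image)
  show "r \<notin> orbit q s" unfolding o
  proof
    assume "r \<in> (\<lambda>i. (p ^^ i) s) ` {..<n}"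
    then obtain i where "i < n" "r = (p ^^ i) s" by auto
    then show False using ne[of i] \<open>r \<noteq> s\<close> by (cases "i = 0") auto
  qed
qed

lemma orbit_other:
  assumes V: "finite V" "p permutes V" and "r \<notin> orbit p x" "s \<notin> orbit p x"
  shows "orbit (transpose r s \<circ> p) x = orbit p x"
proof (rule orbit_cong[OF self_in_orbit[OF V]])
  fix y assume "y \<in> orbit p x"
  then have "p y \<in> orbit p x" by (rule orbit.step)
  then show "(transpose r s \<circ> p) y = p y" using assms(3,4) by (metis comp_apply transpose_apply_other)
qed

text \<open>The step of p that would close the cycle of s is redirected to r. The new orbit
  therefore runs through the old orbit of s and then continues at r.\<close>

lemma orbit_merge_aux:
  assumes V: "finite V" "p permutes V" and V': "r \<in> V" "s \<in> V" and r: "r \<notin> orbit p s"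
  defines "q \<equiv> transpose r s \<circ> p"
  shows "orbit p s \<subseteq> orbit q s" "r \<in> orbit q s"
proof -
  have q: "q permutes V" unfolding q_def using V V' by (simp add: transpose_comp_permutes)
  let ?n = "card (orbit p s)"
  note f = funpow_card_orbit[OF V, of s]
  have s: "s \<in> orbit p s" using self_in_orbit[OF V] .
  then have n: "0 < ?n" using V finite_orbit[OF s] by (auto simp: card_gt_0_iff)
  have ne: "(p ^^ i) s \<noteq> r \<and> (p ^^ i) s \<noteq> s" if "0 < i" "i < ?n" for i
    using inj_onD[OF f(2), of i 0] that r funpow_in_orbit[OF s, of i] by auto
  have qi: "(q ^^ i) s = (p ^^ i) s" if "i < ?n" for i
    using funpow_transpose_comp[of ?n p s r s, OF ne that] by (simp add: q_def)
  have sq: "s \<in> orbit q s" using self_in_orbit[OF V(1) q] .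
  show "orbit p s \<subseteq> orbit q s"
    using f(3) qi funpow_in_orbit[OF sq] by (metis (no_types, lifting) image_subsetI lessThan_iff)
  obtain k where k: "?n = Suc k" using n by (cases ?n) auto
  have "(q ^^ ?n) s = q ((p ^^ k) s)" using qi[of k] k by simp
  also have "\<dots> = r" using f(1) k by (simp add: q_def)
  finally show "r \<in> orbit q s" using funpow_in_orbit[OF sq, of ?n] by simp
qed

text \<open>One inclusion is \<open>orbit_merge_aux\<close> applied twice, with r and s exchanged;
  the other holds because the union is closed under q.\<close>

lemma orbit_merge:
  assumes V: "finite V" "p permutes V" and V': "r \<in> V" "s \<in> V" and r: "r \<notin> orbit p s"
  defines "q \<equiv> transpose r s \<circ> p"
  shows "orbit q s = orbit p s \<union> orbit p r"
proof
  have q: "q permutes V" unfolding q_def using V V' by (simp add: transpose_comp_permutes)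
  have s: "s \<notin> orbit p r" using r orbit_swap self_in_orbit[OF V] by metis
  have a: "orbit p s \<subseteq> orbit q s" "r \<in> orbit q s"
    using orbit_merge_aux[OF V V' r] by (auto simp: q_def)
  have "orbit p r \<subseteq> orbit q r"
    using orbit_merge_aux[OF V V'(2,1) s] by (simp add: q_def transpose_commute)
  also have "orbit q r = orbit q s" using a(2) orbit_eq_if_mem[OF V(1) q] by simp
  finally show "orbit p s \<union> orbit p r \<subseteq> orbit q s" using a by simp
  have cl: "q y \<in> orbit p s \<union> orbit p r" if "y \<in> orbit p s \<union> orbit p r" for y
    using that self_in_orbit[OF V, of s] self_in_orbit[OF V, of r] orbit.step[of y p]
    by (auto simp: q_def transpose_def)
  show "orbit q s \<subseteq> orbit p s \<union> orbit p r"
  proof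
    fix y assume "y \<in> orbit q s" then show "y \<in> orbit p s \<union> orbit p r"
      by induct (use cl self_in_orbit[OF V, of s] in auto)
  qed
qed

text \<open>Lets a cut be read as a merge in reverse: after a cut, r and s lie in different cycles,
  and the same transposition undoes it.\<close>

lemma orbit_transpose_cases:
  assumes V: "finite V" "p permutes V" and V': "r \<in> V" "s \<in> V" "r \<noteq> s"
  defines "q \<equiv> transpose r s \<circ> p"
  shows "r \<in> orbit q s \<longleftrightarrow> r \<notin> orbit p s"
proof
  have q: "q permutes V" unfolding q_def using V V' by (simp add: transpose_comp_permutes)
  show "r \<in> orbit q s" if "r \<notin> orbit p s"
    using orbit_merge_aux[OF V V'(1,2) that] by (simp add: q_def)
  show "r \<notin> orbit p s" if rq: "r \<in> orbit q s"
  proof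
    assume "r \<in> orbit p s"
    then obtain n where n: "n < card (orbit p s)" "r = (p ^^ n) s"
      using funpow_card_orbit(3)[OF V, of s] by auto
    then have "0 < n" using V'(3) by (cases n) auto
    then show False using orbit_split(3)[OF V V'(3) _ n] rq by (simp add: q_def)
  qed
qed

lemma cyc_merge:
  assumes V: "finite V" "p permutes V" and V': "r \<in> V" "s \<in> V" and r: "r \<notin> orbit p s"
  defines "q \<equiv> transpose r s \<circ> p"
  shows "cyc V q = insert (orbit p s \<union> orbit p r) (cyc V p - {orbit p s, orbit p r})"
proof -
  have q: "q permutes V" unfolding q_def using V V' by (simp add: transpose_comp_permutes)
  have qs: "orbit q s = orbit p s \<union> orbit p r" unfolding q_def by (rule orbit_merge[OF V V' r])
  have A: "orbit q x = (if x \<in> orbit p s \<union> orbit p r then orbit p s \<union> orbit p r else orbit p x)" for x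
  proof (cases "x \<in> orbit p s \<union> orbit p r")
    case True
    then show ?thesis using qs orbit_eq_if_mem[OF V(1) q, of x s] by simp
  next
    case False
    then have "r \<notin> orbit p x" "s \<notin> orbit p x" using orbit_swap self_in_orbit[OF V] by (metis UnCI)+
    then show ?thesis using orbit_other[OF V] False by (simp add: q_def)
  qed
  show ?thesis
  proof (intro equalityI subsetI)
    fix B assume "B \<in> cyc V q"
    then obtain x where x: "x \<in> V" "B = orbit q x" by (auto simp: cyc_def)
    then show "B \<in> insert (orbit p s \<union> orbit p r) (cyc V p - {orbit p s, orbit p r})"
      using A[of x] self_in_orbit[OF V, of x] by (auto simp: cyc_def)
  next
    fix B assume "B \<in> insert (orbit p s \<union> orbit p r) (cyc V p - {orbit p s, orbit p r})"
    then consider "B = orbit p s \<union> orbit p r" | x where "x \<in> V" "B = orbit p x" "B \<noteq> orbit p s" "B \<noteq> orbit p r"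
      by (auto simp: cyc_def)
    then show "B \<in> cyc V q"
    proof cases
      case 1 then show ?thesis using qs V' by (auto simp: cyc_def)
    next
      case 2
      then have "x \<notin> orbit p s \<union> orbit p r" using orbit_eq_if_mem[OF V] by blast
      then show ?thesis using A[of x] 2 by (auto simp: cyc_def)
    qed
  qed
qed

section \<open>Labelled cycles under a transposition\<close>

definition drop_nth :: "nat \<Rightarrow> 'a list \<Rightarrow> 'a list" where
  "drop_nth i xs = take i xs @ drop (Suc i) xs"

definition insert_nth :: "nat \<Rightarrow> 'a \<Rightarrow> 'a list \<Rightarrow> 'a list" where
  "insert_nth i x xs = take i xs @ x # drop i xs"

text \<open>Translates the subtuples of the recursion into \<open>drop_nth\<close>, to which
  \<open>insert_nth\<close> is inverse.\<close>

lemma nths_remove_index: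
  assumes "i < length xs" shows "nths xs ({..<length xs} - {i}) = drop_nth i xs"
proof -
  have xs: "xs = take i xs @ xs ! i # drop (Suc i) xs" using assms by (simp add: id_take_nth_drop)
  have 1: "nths (take i xs) ({..<length xs} - {i}) = take i xs"
    using assms by (intro nths_all) auto
  have 2: "nths (drop (Suc i) xs) {j. Suc (j + i) \<in> {..<length xs} - {i}} = drop (Suc i) xs"
    using assms by (intro nths_all) auto
  have "nths xs ({..<length xs} - {i})
      = nths (take i xs @ xs ! i # drop (Suc i) xs) ({..<length xs} - {i})"
    using xs by simp
  also have "\<dots> = drop_nth i xs"
    using assms 1 2 by (simp add: nths_append nths_Cons drop_nth_def min_def)
  finally show ?thesis .
qed

lemma length_drop_nth: "i < length xs \<Longrightarrow> length (drop_nth i xs) = length xs - 1"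
  by (simp add: drop_nth_def)

lemma map_drop_nth: "map f (drop_nth i xs) = drop_nth i (map f xs)"
  by (simp add: drop_nth_def take_map drop_map)

lemma map_insert_nth: "map f (insert_nth i x xs) = insert_nth i (f x) (map f xs)"
  by (simp add: insert_nth_def take_map drop_map)

lemma insert_drop_nth: "i < length xs \<Longrightarrow> insert_nth i (xs ! i) (drop_nth i xs) = xs"
  by (simp add: drop_nth_def insert_nth_def id_take_nth_drop[symmetric] min_def)

lemma drop_insert_nth: "i \<le> length xs \<Longrightarrow> drop_nth i (insert_nth i x xs) = xs"
  by (simp add: drop_nth_def insert_nth_def min_def)

lemma nth_insert_nth: "i \<le> length xs \<Longrightarrow> insert_nth i x xs ! i = x"
  by (simp add: insert_nth_def nth_append)

lemma mset_insert_nth: "mset (insert_nth i x xs) = add_mset x (mset xs)"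
proof -
  have "mset (take i xs) + mset (drop i xs) = mset xs" by (metis append_take_drop_id mset_append)
  then show ?thesis by (simp add: insert_nth_def)
qed

lemma set_insert_nth: "set (insert_nth i x xs) = insert x (set xs)"
  by (metis mset_insert_nth set_mset_add_mset_insert set_mset_mset)

lemma distinct_insert_nth: "distinct (insert_nth i x xs) \<longleftrightarrow> x \<notin> set xs \<and> distinct xs"
  by (metis mset_insert_nth distinct.simps(2) mset.simps(2) mset_eq_imp_distinct_iff)

lemma length_insert_nth: "length (insert_nth i x xs) = Suc (length xs)"
  by (metis mset_insert_nth size_add_mset size_mset)

lemma drop_nth_distinct:
  assumes "i < length xs" "distinct xs"
  shows "set (drop_nth i xs) = set xs - {xs ! i}" "distinct (drop_nth i xs)"
proof -
  have e: "insert_nth i (xs ! i) (drop_nth i xs) = xs" by (rule insert_drop_nth[OF assms(1)])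
  have "set xs = insert (xs ! i) (set (drop_nth i xs))" by (metis e set_insert_nth)
  moreover have "xs ! i \<notin> set (drop_nth i xs) \<and> distinct (drop_nth i xs)"
    using assms(2) by (metis e distinct_insert_nth)
  ultimately show "set (drop_nth i xs) = set xs - {xs ! i}" "distinct (drop_nth i xs)" by auto
qed

text \<open>Common bookkeeping for joins and cuts: \<open>R\<close> collects the untouched cycles,
  so the sets of cycles before and after are \<open>R\<close> with one and with two elements added.
  For a cut, p and q change places.\<close>

lemma cyc_merge_disjoint:
  assumes V: "finite V" "p permutes V" and V': "r \<in> V" "s \<in> V" and r: "r \<notin> orbit p s"
  defines "q \<equiv> transpose r s \<circ> p"
  defines "R \<equiv> cyc V p - {orbit p s, orbit p r}"
  shows "cyc V q = insert (orbit q s) R" "cyc V p = insert (orbit p s) (insert (orbit p r) R)"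
    "orbit q s \<notin> R" "orbit p s \<noteq> orbit p r" "orbit p s \<inter> orbit p r = {}"
    "orbit q s = orbit p s \<union> orbit p r"
proof -
  show m: "orbit q s = orbit p s \<union> orbit p r" unfolding q_def by (rule orbit_merge[OF V V' r])
  show "cyc V q = insert (orbit q s) R"
    unfolding m using cyc_merge[OF V V' r] by (simp add: q_def R_def)
  have in_cyc: "orbit p s \<in> cyc V p" "orbit p r \<in> cyc V p" using V' by (auto simp: cyc_def)
  then show "cyc V p = insert (orbit p s) (insert (orbit p r) R)" by (auto simp: R_def)
  have self: "r \<in> orbit p r" "s \<in> orbit p s" using self_in_orbit[OF V] by auto
  show "orbit p s \<inter> orbit p r = {}"
    using cyc_eqI[OF V in_cyc] self r by blast
  then show ne: "orbit p s \<noteq> orbit p r" using self by auto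
  show "orbit q s \<notin> R"
    using cyc_eqI[OF V _ in_cyc(1), of "orbit q s" s] self unfolding m R_def by blast
qed

section \<open>Labellings whose first cycle contains a marked point\<close>

lemma hd_lab:
  assumes "finite V" "p permutes V" "cs \<in> lab V p (m # \<nu>)" "s \<in> hd cs"
  obtains cs' where "cs = orbit p s # cs'" "card (orbit p s) = m" "map card cs' = \<nu>"
    "distinct cs'" "set cs' = cyc V p - {orbit p s}"
proof -
  obtain c cs' where cs: "cs = c # cs'" using assms(3) by (cases cs) (auto simp: lab_def)
  then have "c \<in> cyc V p" "s \<in> c" using assms(3,4) by (auto simp: lab_def)
  then have "c = orbit p s" using cyc_eq_orbit[OF assms(1,2)] by blast
  then show ?thesis using cs assms(3) by (intro that[of cs']) (auto simp: lab_def)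
qed

text \<open>Label 1 is \<open>hd cs\<close>. For an empty \<open>\<mu>\<close> this would be the
  unspecified \<open>hd []\<close>, so statements about the marked cycle use the form
  \<open>m # \<nu>\<close>.\<close>

definition marked_lab :: "nat set \<Rightarrow> (nat \<Rightarrow> nat) \<Rightarrow> nat \<Rightarrow> nat list \<Rightarrow> nat set list set" where
  "marked_lab V p s \<mu> = {cs \<in> lab V p \<mu>. s \<in> hd cs}"

lemma finite_marked_lab: "finite V \<Longrightarrow> finite (marked_lab V p s \<mu>)"
  by (simp add: marked_lab_def finite_lab)

text \<open>The first cycle has to be the orbit of the marked point, so a marked labelling is
  nothing but a labelling of the remaining cycles. The bijections below only have to handle the
  tail.\<close>

lemma marked_lab_iff:
  assumes "finite V" "p permutes V"
  shows "cs \<in> marked_lab V p s (m # \<nu>) \<longleftrightarrow> s \<in> V \<and> cs \<noteq> [] \<and> hd cs = orbit p s \<and>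
    card (orbit p s) = m \<and> map card (tl cs) = \<nu> \<and> distinct (tl cs) \<and>
    set (tl cs) = cyc V p - {orbit p s}" (is "?L \<longleftrightarrow> ?R")
proof
  assume ?L
  then have L: "cs \<in> lab V p (m # \<nu>)" "s \<in> hd cs" by (auto simp: marked_lab_def)
  obtain cs' where c: "cs = orbit p s # cs'" "card (orbit p s) = m" "map card cs' = \<nu>"
    "distinct cs'" "set cs' = cyc V p - {orbit p s}" using hd_lab[OF assms L] .
  have "orbit p s \<in> cyc V p" using L(1) c by (auto simp: lab_def)
  then have "s \<in> V" using cyc_subset[OF assms(2)] self_in_orbit[OF assms, of s] by blast
  then show ?R using c by simp
next
  assume R: ?R
  then have "orbit p s \<in> cyc V p" by (auto simp: cyc_def)
  then show ?L using R self_in_orbit[OF assms, of s]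
    by (cases cs) (auto simp: marked_lab_def lab_def)
qed

text \<open>If r is the n-th iterate of s, then \<open>orbit_split\<close> gives the piece
  containing s exactly n points. As this length is prescribed to be m, there is no choice for
  r.\<close>

lemma cut_position:
  assumes V: "finite V" "p permutes V" and "r \<noteq> s" "r \<in> orbit p s" "r \<in> V" "s \<in> V"
    "cs \<in> marked_lab V (transpose r s \<circ> p) s (m # \<nu>)"
  shows "r = (p ^^ m) s" "m < card (orbit p s)" "0 < m"
proof -
  let ?q = "transpose r s \<circ> p"
  have q: "?q permutes V" using assms by (intro transpose_comp_permutes) auto
  obtain n where n: "n < card (orbit p s)" "r = (p ^^ n) s"
    using funpow_card_orbit(3)[OF V, of s] assms(4) by auto
  then have n0: "0 < n" using assms(3) by (cases n) auto
  have "card (orbit ?q s) = n" using orbit_split(2)[OF V assms(3) n0 n] by simp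
  moreover have "card (orbit ?q s) = m" using assms(7) marked_lab_iff[OF V(1) q] by blast
  ultimately show "r = (p ^^ m) s" "m < card (orbit p s)" "0 < m" using n n0 by auto
qed

text \<open>With r forced, the only freedom left is the label i of the piece \<open>D\<close>
  without s. Gluing the two pieces produces a marked cycle of length \<open>m + \<nu> ! i\<close>
  and removes label i; the map \<open>f\<close> undoes this.\<close>

lemma card_cut:
  assumes V: "finite V" "p permutes V" and s: "s \<in> V" and m: "1 \<le> m" and \<nu>: "\<forall>x\<in>set \<nu>. 1 \<le> x"
  shows "card {(r, cs). r \<in> V \<and> r \<noteq> s \<and> r \<in> orbit p s \<and>
      cs \<in> marked_lab V (transpose r s \<circ> p) s (m # \<nu>)} =
    (\<Sum>i<length \<nu>. card (marked_lab V p s ((m + \<nu> ! i) # drop_nth i \<nu>)))"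
    (is "card ?L = _")
proof -
  let ?R = "SIGMA i:{..<length \<nu>}. marked_lab V p s ((m + \<nu> ! i) # drop_nth i \<nu>)"
  define r where "r = (p ^^ m) s"
  define q where "q = transpose r s \<circ> p"
  \<comment> \<open>When m is smaller than the orbit of s, these are the two pieces,
    \<open>C\<close> being the one with the marked point.\<close>
  define C where "C = orbit q s"
  define D where "D = orbit q r"
  define f where "f = (\<lambda>(i :: nat, cs :: nat set list). (r, C # insert_nth i D (tl cs)))"
  have s_orb: "s \<in> orbit p s" using self_in_orbit[OF V] .
  have rV: "r \<in> V" using s V(2) funpow_in_orbit[OF s_orb] permutes_orbit_subset[OF V(2) s]
    by (auto simp: r_def)
  have q: "q permutes V" unfolding q_def using V rV s by (intro transpose_comp_permutes)
  have pq: "p = transpose r s \<circ> q" by (simp add: q_def fun_eq_iff)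
  \<comment> \<open>Everything about the two pieces, provided that the m-th iterate is reached
    before the cycle of s closes.\<close>
  have main: "C \<union> D = orbit p s" "C \<inter> D = {}" "card C = m" "card C + card D = card (orbit p s)"
     "C \<noteq> D"
     "C \<notin> cyc V p - {orbit p s}" "D \<notin> cyc V p - {orbit p s}" "r \<in> orbit p s"
     "cyc V q = insert C (insert D (cyc V p - {orbit p s}))" "r \<noteq> s"
    if lt: "m < card (orbit p s)"
  proof -
    have "inj_on (\<lambda>i. (p ^^ i) s) {..<card (orbit p s)}" using funpow_card_orbit[OF V] by blast
    from inj_onD[OF this, of m 0] show rs: "r \<noteq> s" using lt m by (auto simp: r_def)
    have sp: "card (orbit q s) = m" "r \<notin> orbit q s"
      using orbit_split(2,3)[OF V rs _ lt r_def] m by (simp_all add: q_def)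
    \<comment> \<open>Composing q with the transposition gives p back, so the merge lemma is applied
      to q.\<close>
    note M = cyc_merge_disjoint[OF V(1) q rV s sp(2), folded pq C_def D_def]
    show "C \<union> D = orbit p s" "C \<inter> D = {}" "card C = m" "C \<noteq> D" "r \<in> orbit p s"
      using M sp(1) self_in_orbit[OF V(1) q, of r] by (auto simp: C_def D_def)
    have "finite C" "finite D"
      using permutes_orbit_subset[OF q] finite_subset[OF _ V(1)] rV s by (auto simp: C_def D_def)
    then show "card C + card D = card (orbit p s)" using M by (simp add: card_Un_disjoint)
    have R: "cyc V q - {C, D} = cyc V p - {orbit p s}" using M(1,3) by auto
    show "cyc V q = insert C (insert D (cyc V p - {orbit p s}))"
      "C \<notin> cyc V p - {orbit p s}" "D \<notin> cyc V p - {orbit p s}"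
      using M(2) R by auto
  qed
  \<comment> \<open>Positivity of \<open>\<nu> ! i\<close> enters here: an empty second piece would
    make the m-th iterate equal to s.\<close>
  have R_lt: "m < card (orbit p s)" if "(i, cs) \<in> ?R" for i cs
  proof -
    have "card (orbit p s) = m + \<nu> ! i" using that marked_lab_iff[OF V] by auto
    moreover have "1 \<le> \<nu> ! i" using that \<nu> by auto
    ultimately show ?thesis by simp
  qed
  have tl_len: "length (tl cs) = length \<nu> - 1" if "(i, cs) \<in> ?R" for i cs
  proof -
    have "map card (tl cs) = drop_nth i \<nu>" "i < length \<nu>" using that marked_lab_iff[OF V] by auto
    then show ?thesis by (metis length_map length_drop_nth)
  qed
  have "bij_betw f ?R ?L"
    unfolding bij_betw_def
  proof
    show "inj_on f ?R"
    proof (rule inj_onI)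
      fix x y assume x: "x \<in> ?R" and y: "y \<in> ?R" and eq: "f x = f y"
      obtain i cs where xe: "x = (i, cs)" by force
      obtain j ds where ye: "y = (j, ds)" by force
      note lt = R_lt[OF x[unfolded xe]]
      have cs: "hd cs = orbit p s" "cs \<noteq> []" "distinct (tl cs)" "set (tl cs) = cyc V p - {orbit p s}"
        "i < length \<nu>"
        using x marked_lab_iff[OF V] by (auto simp: xe)
      have ds: "hd ds = orbit p s" "ds \<noteq> []" "distinct (tl ds)" "set (tl ds) = cyc V p - {orbit p s}"
        "j < length \<nu>"
        using y marked_lab_iff[OF V] by (auto simp: ye)
      let ?I = "insert_nth i D (tl cs)" and ?J = "insert_nth j D (tl ds)"
      have IJ: "?I = ?J" using eq by (simp add: f_def xe ye)
      have l: "i \<le> length (tl cs)" "j \<le> length (tl ds)"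
        using tl_len[OF x[unfolded xe]] tl_len[OF y[unfolded ye]] cs(5) ds(5) by auto
      \<comment> \<open>\<open>D\<close> occurs only once in the list, so its position recovers
        i.\<close>
      have dist: "distinct ?I" using cs main(7)[OF lt] by (simp add: distinct_insert_nth)
      have "?I ! i = D" "?J ! j = D" using l by (simp_all add: nth_insert_nth)
      then have "?I ! i = ?I ! j" using IJ by simp
      moreover have "i < length ?I" "j < length ?I" using l arg_cong[OF IJ, of length]
        by (simp_all add: length_insert_nth)
      ultimately have ij: "i = j" using dist nth_eq_iff_index_eq by blast
      have "tl cs = tl ds" using IJ ij l drop_insert_nth by metis
      then show "x = y" using cs(1,2) ds(1,2) ij by (simp add: xe ye) (metis list.collapse)
    qed
    show "f ` ?R = ?L"
    proof (intro equalityI subsetI)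
      fix y assume "y \<in> f ` ?R"
      then obtain i cs where x: "(i, cs) \<in> ?R" and y: "y = f (i, cs)" by force
      note lt = R_lt[OF x]
      note M = main[OF lt]
      have cs: "hd cs = orbit p s" "cs \<noteq> []" "distinct (tl cs)" "set (tl cs) = cyc V p - {orbit p s}"
        "map card (tl cs) = drop_nth i \<nu>" "card (orbit p s) = m + \<nu> ! i" "i < length \<nu>"
        using x marked_lab_iff[OF V] by auto
      have "map card (insert_nth i D (tl cs)) = \<nu>"
        using cs M(3,4) insert_drop_nth[OF cs(7)] by (simp add: map_insert_nth)
      then have "C # insert_nth i D (tl cs) \<in> marked_lab V q s (m # \<nu>)"
        unfolding marked_lab_iff[OF V(1) q] using s M cs
        by (auto simp: C_def[symmetric] set_insert_nth distinct_insert_nth)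
      then show "y \<in> ?L" unfolding y f_def using rV M by (simp add: q_def)
    next
      fix y assume "y \<in> ?L"
      then obtain r' cs where y: "y = (r', cs)" and L: "r' \<in> V" "r' \<noteq> s" "r' \<in> orbit p s"
        "cs \<in> marked_lab V (transpose r' s \<circ> p) s (m # \<nu>)" by auto
      have lt: "m < card (orbit p s)" and r': "r' = r"
        using cut_position[OF V L(2,3,1) s L(4)] by (auto simp: r_def)
      note M = main[OF lt]
      have cs: "hd cs = C" "cs \<noteq> []" "map card (tl cs) = \<nu>" "distinct (tl cs)"
        "set (tl cs) = cyc V q - {C}"
        using L(4) marked_lab_iff[OF V(1) q] unfolding r' q_def[symmetric] C_def by auto
      have "D \<in> set (tl cs)" using cs(5) M(9,5) by auto
      then obtain i where i: "i < length (tl cs)" "tl cs ! i = D" by (metis in_set_conv_nth)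
      have i': "i < length \<nu>" using i cs(3) by (metis length_map)
      have "\<nu> ! i = card D" using i cs(3) nth_map by metis
      then have "(C \<union> D) # drop_nth i (tl cs) \<in> marked_lab V p s ((m + \<nu> ! i) # drop_nth i \<nu>)"
        unfolding marked_lab_iff[OF V] using s M cs drop_nth_distinct[OF i(1) cs(4)] i(2)
        by (auto simp: map_drop_nth)
      moreover have "f (i, (C \<union> D) # drop_nth i (tl cs)) = y"
        using i cs insert_drop_nth[OF i(1)] by (simp add: f_def y r') (metis list.collapse)
      ultimately show "y \<in> f ` ?R" using i' by (metis (no_types, lifting) SigmaI imageI lessThan_iff)
    qed
  qed
  then have "card ?L = card ?R" by (simp add: bij_betw_same_card)
  also have "\<dots> = (\<Sum>i<length \<nu>. card (marked_lab V p s ((m + \<nu> ! i) # drop_nth i \<nu>)))"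
    using V by (simp add: finite_marked_lab)
  finally show ?thesis .
qed

section \<open>Joining two cycles\<close>

definition splits :: "nat \<Rightarrow> (nat \<times> nat) set" where
  "splits m = {(\<alpha>, \<beta>). 1 \<le> \<alpha> \<and> 1 \<le> \<beta> \<and> \<alpha> + \<beta> = m}"

lemma finite_splits [simp]: "finite (splits m)"
  by (rule finite_subset[of _ "{..m} \<times> {..m}"]) (auto simp: splits_def)

text \<open>The cycle of r is detached from the marked cycle and stored under an additional last
  label, which is where \<open>\<nu> @ [\<beta>]\<close> comes from. The sum over all pairs is
  harmless: p determines the lengths of both cycles, so only one summand can be nonzero.\<close>

lemma card_join:
  assumes V: "finite V" "p permutes V" and rs: "r \<in> V" "s \<in> V" "r \<notin> orbit p s"
  shows "card (marked_lab V (transpose r s \<circ> p) s (m # \<nu>)) =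
    (\<Sum>(\<alpha>, \<beta>)\<in>splits m. card {cs \<in> marked_lab V p s (\<alpha> # \<nu> @ [\<beta>]). r \<in> last cs})"
proof -
  define q where "q = transpose r s \<circ> p"
  let ?R = "SIGMA (\<alpha>, \<beta>):splits m. {cs \<in> marked_lab V p s (\<alpha> # \<nu> @ [\<beta>]). r \<in> last cs}"
  let ?L = "marked_lab V q s (m # \<nu>)"
  have q: "q permutes V" unfolding q_def using V rs by (intro transpose_comp_permutes)
  define C where "C = orbit p s"
  define D where "D = orbit p r"
  note M = cyc_merge_disjoint[OF V rs, folded q_def C_def D_def]
  have fin: "finite C" "finite D"
    using permutes_orbit_subset[OF V(2)] finite_subset[OF _ V(1)] rs by (auto simp: C_def D_def)
  have self: "s \<in> C" "r \<in> D" using self_in_orbit[OF V] by (auto simp: C_def D_def)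
  have pos: "1 \<le> card C" "1 \<le> card D" using fin self by (auto simp: Suc_le_eq card_gt_0_iff)
  have cqs: "card (orbit q s) = card C + card D" using M(5,6) fin by (simp add: card_Un_disjoint)
  have DV: "D \<in> cyc V p" using rs by (auto simp: D_def cyc_def)
  let ?f = "\<lambda>cs. ((card C, card D), C # tl cs @ [D])"
  have "bij_betw ?f ?L ?R"
    unfolding bij_betw_def
  proof
    show "inj_on ?f ?L"
    proof (rule inj_onI)
      fix cs ds assume "cs \<in> ?L" "ds \<in> ?L" "?f cs = ?f ds"
      then show "cs = ds" using marked_lab_iff[OF V(1) q] by (metis append1_eq_conv list.collapse list.sel(3) prod.inject)
    qed
    show "?f ` ?L = ?R"
    proof (intro equalityI subsetI)
      fix y assume "y \<in> ?f ` ?L"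
      then obtain cs where cs: "cs \<in> ?L" and y: "y = ?f cs" by blast
      have a: "hd cs = orbit q s" "cs \<noteq> []" "map card (tl cs) = \<nu>" "distinct (tl cs)"
        "set (tl cs) = cyc V q - {orbit q s}" "card (orbit q s) = m"
        using cs marked_lab_iff[OF V(1) q] by auto
      have R: "set (tl cs) = cyc V p - {C, D}" using a(5) M(1,3) by auto
      have "C # tl cs @ [D] \<in> marked_lab V p s (card C # \<nu> @ [card D])"
        unfolding marked_lab_iff[OF V] using rs a R M DV by (auto simp: C_def)
      then show "y \<in> ?R" using pos self cqs a(6) by (auto simp: y splits_def)
    next
      fix y assume "y \<in> ?R"
      then obtain \<alpha> \<beta> cs where y: "y = ((\<alpha>, \<beta>), cs)" and ab: "(\<alpha>, \<beta>) \<in> splits m"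
        and cs: "cs \<in> marked_lab V p s (\<alpha> # \<nu> @ [\<beta>])" and r: "r \<in> last cs" by auto
      have a: "hd cs = C" "cs \<noteq> []" "map card (tl cs) = \<nu> @ [\<beta>]" "distinct (tl cs)"
        "set (tl cs) = cyc V p - {C}" "card C = \<alpha>"
        using cs marked_lab_iff[OF V] by (auto simp: C_def)
      obtain es e where e: "tl cs = es @ [e]" using a(3) by (cases "tl cs" rule: rev_cases) auto
      have "last cs = e" using a(2) e by (cases cs) auto
      moreover have "e \<in> cyc V p" using a(5) e by auto
      ultimately have eD: "e = D" using r cyc_eq_orbit[OF V] by (auto simp: D_def)
      have es: "map card es = \<nu>" "card D = \<beta>" "distinct es" "set es = cyc V p - {C, D}"
        using a(3,4,5) e eD by auto
      have "orbit q s # es \<in> ?L"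
        unfolding marked_lab_iff[OF V(1) q] using es rs cqs ab a M by (auto simp: splits_def)
      moreover have "?f (orbit q s # es) = y" using a e eD es by (simp add: y) (metis list.collapse)
      ultimately show "y \<in> ?f ` ?L" by (rule rev_image_eqI[OF _ sym])
    qed
  qed
  then have "card ?L = card ?R" by (simp add: bij_betw_same_card)
  also have "\<dots> = (\<Sum>x\<in>splits m. card (case x of (\<alpha>, \<beta>) \<Rightarrow> {cs \<in> marked_lab V p s (\<alpha> # \<nu> @ [\<beta>]). r \<in> last cs}))"
    using V by (intro card_SigmaI) (auto simp: finite_marked_lab)
  also have "\<dots> = (\<Sum>(\<alpha>, \<beta>)\<in>splits m. card {cs \<in> marked_lab V p s (\<alpha> # \<nu> @ [\<beta>]). r \<in> last cs})"
    by (intro sum.cong) auto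
  finally show ?thesis by (simp add: q_def)
qed

lemma last_marked_lab:
  assumes V: "finite V" "p permutes V" and cs: "cs \<in> marked_lab V p s (\<alpha> # \<nu> @ [\<beta>])"
  shows "last cs \<in> cyc V p" "card (last cs) = \<beta>" "last cs \<inter> orbit p s = {}"
proof -
  have a: "cs \<noteq> []" "map card (tl cs) = \<nu> @ [\<beta>]" "set (tl cs) = cyc V p - {orbit p s}" "s \<in> V"
    using cs marked_lab_iff[OF V] by auto
  obtain es e where e: "tl cs = es @ [e]" using a(2) by (cases "tl cs" rule: rev_cases) auto
  have l: "last cs = e" using a(1) e by (cases cs) auto
  have "e \<in> cyc V p" "e \<noteq> orbit p s" using a(3) e by auto
  moreover have "orbit p s \<in> cyc V p" using a by (auto simp: cyc_def)
  ultimately show "last cs \<in> cyc V p" "card (last cs) = \<beta>" "last cs \<inter> orbit p s = {}"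
    using cyc_eqI[OF V, of e "orbit p s"] a(2) e unfolding l by auto
qed

section \<open>Connectedness\<close>

text \<open>Reflexive on the whole type; connectedness is therefore always asked of the points of a
  given set.\<close>

definition eqcl :: "('a \<times> 'a) set \<Rightarrow> ('a \<times> 'a) set" where
  "eqcl X = (X \<union> X\<inverse>)\<^sup>*"

lemma eqcl_refl [simp]: "(x, x) \<in> eqcl X"
  by (simp add: eqcl_def)

lemma eqcl_trans: "(x, y) \<in> eqcl X \<Longrightarrow> (y, z) \<in> eqcl X \<Longrightarrow> (x, z) \<in> eqcl X"
  by (simp add: eqcl_def)

lemma eqcl_sym: "(x, y) \<in> eqcl X \<Longrightarrow> (y, x) \<in> eqcl X"
  unfolding eqcl_def by (rule symD[OF sym_rtrancl[OF sym_Un_converse]])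

lemma eqcl_base: "e \<in> X \<Longrightarrow> e \<in> eqcl X"
  by (auto simp: eqcl_def)

lemma eqcl_induct [consumes 1, case_names refl step]:
  assumes "(x, y) \<in> eqcl X" "P x"
    "\<And>y z. (x, y) \<in> eqcl X \<Longrightarrow> (y, z) \<in> X \<or> (z, y) \<in> X \<Longrightarrow> P y \<Longrightarrow> P z"
  shows "P y"
  using assms(1) unfolding eqcl_def
proof (induction rule: rtrancl_induct)
  case (step y z)
  then show ?case using assms(3)[of y z] by (auto simp: eqcl_def)
qed (rule assms(2))

text \<open>\<open>eqcl\<close> is a closure operator, so inclusions need checking on generators
  only.\<close>

lemma eqcl_subsetI: "X \<subseteq> eqcl Y \<Longrightarrow> eqcl X \<subseteq> eqcl Y"
proof clarify
  fix x y assume X: "X \<subseteq> eqcl Y" and "(x, y) \<in> eqcl X"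
  from this(2) show "(x, y) \<in> eqcl Y"
  proof (induction rule: eqcl_induct)
    case (step y z)
    have "(y, z) \<in> eqcl Y" using step(2) subsetD[OF X] eqcl_sym[of z y Y] by auto
    then show ?case by (rule eqcl_trans[OF step(3)])
  qed simp
qed

lemma eqcl_mono: "X \<subseteq> Y \<Longrightarrow> eqcl X \<subseteq> eqcl Y"
  by (rule eqcl_subsetI) (auto intro: eqcl_base)

text \<open>Used to separate points: a property constant along edges is constant on classes.\<close>

lemma eqcl_invariant:
  assumes "(x, y) \<in> eqcl X" "\<And>u v. (u, v) \<in> X \<Longrightarrow> P u \<longleftrightarrow> P v" "P x" shows "P y"
  using assms(1)
proof (induction rule: eqcl_induct)
  case (step y z) then show ?case using assms(2) by blast
qed (rule assms(3))

text \<open>A path that starts in a set which no edge leaves or enters stays there, so it uses inner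
  edges only.\<close>

lemma eqcl_restrict:
  assumes "(x, y) \<in> eqcl X" "\<And>u v. (u, v) \<in> X \<Longrightarrow> u \<in> U \<longleftrightarrow> v \<in> U" "x \<in> U"
  shows "(x, y) \<in> eqcl (X \<inter> U \<times> U)"
proof -
  have "(x, y) \<in> eqcl (X \<inter> U \<times> U) \<and> y \<in> U"
    using assms(1)
  proof (induction rule: eqcl_induct)
    case (step y z)
    then have "z \<in> U" using assms(2) by blast
    then have "(y, z) \<in> X \<inter> U \<times> U \<or> (z, y) \<in> X \<inter> U \<times> U" using step by blast
    then have "(y, z) \<in> eqcl (X \<inter> U \<times> U)"
      using eqcl_base[of _ "X \<inter> U \<times> U"] eqcl_sym[of z y "X \<inter> U \<times> U"] by blast
    then show ?case using step(3) eqcl_trans[of x y _ z] \<open>z \<in> U\<close> by blast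
  qed (use assms(3) in simp)
  then show ?thesis by simp
qed

section \<open>Connectedness of factorisations and monotone sequences\<close>

definition edges :: "nat set \<Rightarrow> (nat \<Rightarrow> nat) \<Rightarrow> (nat \<times> nat) set" where
  "edges V \<sigma> = (\<lambda>x. (x, \<sigma> x)) ` V"

text \<open>Transitivity of the group generated by \<open>\<sigma>\<close> and the transpositions,
  expressed by a graph; \<open>transitive_iff_conn\<close> makes the link.\<close>

definition conn :: "nat set \<Rightarrow> (nat \<Rightarrow> nat) \<Rightarrow> (nat \<times> nat) list \<Rightarrow> bool" where
  "conn V \<sigma> ts \<longleftrightarrow> (\<forall>x\<in>V. \<forall>y\<in>V. (x, y) \<in> eqcl (edges V \<sigma> \<union> set ts))"

definition tp_prod :: "(nat \<Rightarrow> nat) \<Rightarrow> (nat \<times> nat) list \<Rightarrow> nat \<Rightarrow> nat" where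
  "tp_prod \<sigma> ts = foldl (\<lambda>p (r, s). transpose r s \<circ> p) \<sigma> ts"

text \<open>Pairs are used instead of permutations because a function \<open>transpose r s\<close>
  does not show which of its two points is the larger one.\<close>

definition mono_seqs :: "nat set \<Rightarrow> nat \<Rightarrow> (nat \<times> nat) list set" where
  "mono_seqs V m = {ts. length ts = m \<and> (\<forall>(r, s)\<in>set ts. r \<in> V \<and> s \<in> V \<and> r < s) \<and>
     sorted (map snd ts)}"

text \<open>The prefixes that may be followed by a transposition with larger point b.\<close>

definition mono_seqs_le :: "nat set \<Rightarrow> nat \<Rightarrow> nat \<Rightarrow> (nat \<times> nat) list set" where
  "mono_seqs_le V m b = {ts \<in> mono_seqs V m. \<forall>(r, s)\<in>set ts. s \<le> b}"

lemma tp_prod_Nil [simp]: "tp_prod \<sigma> [] = \<sigma>"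
  by (simp add: tp_prod_def)

lemma tp_prod_snoc [simp]: "tp_prod \<sigma> (ts @ [(r, s)]) = transpose r s \<circ> tp_prod \<sigma> ts"
  by (simp add: tp_prod_def)

lemma finite_mono_seqs: "finite V \<Longrightarrow> finite (mono_seqs V m)"
  by (rule finite_subset[OF _ finite_lists_length_eq[of "V \<times> V" m]]) (auto simp: mono_seqs_def)

lemma finite_mono_seqs_le: "finite V \<Longrightarrow> finite (mono_seqs_le V m b)"
  by (simp add: mono_seqs_le_def finite_mono_seqs)

lemma tp_prod_permutes:
  assumes "\<sigma> permutes V" "set ts \<subseteq> V \<times> V" shows "tp_prod \<sigma> ts permutes V"
  using assms(2)
proof (induction ts rule: rev_induct)
  case (snoc t ts)
  obtain r s where t: "t = (r, s)" by force
  have "transpose r s \<circ> tp_prod \<sigma> ts permutes V"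
    using snoc t by (intro transpose_comp_permutes) auto
  then show ?case unfolding t tp_prod_snoc .
qed (simp add: assms(1))

lemma mono_seqs_subset: "ts \<in> mono_seqs V m \<Longrightarrow> set ts \<subseteq> V \<times> V"
  by (auto simp: mono_seqs_def)

lemma tp_prod_eqcl:
  assumes "x \<in> V" shows "(x, tp_prod \<sigma> ts x) \<in> eqcl (edges V \<sigma> \<union> set ts)"
proof (induction ts rule: rev_induct)
  case Nil
  show ?case using assms by (auto simp: edges_def intro: eqcl_base)
next
  case (snoc t ts)
  obtain r s where t: "t = (r, s)" by force
  let ?E = "edges V \<sigma> \<union> set (ts @ [t])"
  have "(x, tp_prod \<sigma> ts x) \<in> eqcl ?E" using snoc eqcl_mono[of "edges V \<sigma> \<union> set ts" ?E] by auto
  moreover have "(y, transpose r s y) \<in> eqcl ?E" for y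
    using eqcl_base[of "(r, s)" ?E] eqcl_sym[of r s ?E] t by (auto simp: transpose_def)
  ultimately show ?case using eqcl_trans[of x "tp_prod \<sigma> ts x" ?E] by (simp add: t)
qed

lemma orbit_eqcl:
  assumes "\<sigma> permutes V" "set ts \<subseteq> V \<times> V" "x \<in> V" "y \<in> orbit (tp_prod \<sigma> ts) x"
  shows "(x, y) \<in> eqcl (edges V \<sigma> \<union> set ts)"
  using assms(4)
proof induction
  case base
  show ?case by (rule tp_prod_eqcl[OF assms(3)])
next
  case (step y)
  then have "y \<in> V" using permutes_orbit_subset[OF tp_prod_permutes[OF assms(1,2)] assms(3)] by blast
  then show ?case using eqcl_trans[OF step(2) tp_prod_eqcl] by simp
qed

text \<open>Covers the cut case: r and s are already linked through their common cycle, so removing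
  the transposition preserves transitivity.\<close>

lemma conn_snoc_if_eqcl:
  assumes "(r, s) \<in> eqcl (edges V \<sigma> \<union> set ts)"
  shows "conn V \<sigma> (ts @ [(r, s)]) \<longleftrightarrow> conn V \<sigma> ts"
proof -
  have "eqcl (edges V \<sigma> \<union> set (ts @ [(r, s)])) = eqcl (edges V \<sigma> \<union> set ts)"
    using assms by (intro equalityI eqcl_subsetI eqcl_mono) (auto intro: eqcl_base)
  then show ?thesis by (simp add: conn_def)
qed

section \<open>Factorisations with two components\<close>

text \<open>For a connected system \<open>U = {}\<close> and \<open>U = V\<close> satisfy this too.
  Where it matters, a point on each side is supplied separately.\<close>

definition two_comp :: "nat set \<Rightarrow> (nat \<Rightarrow> nat) \<Rightarrow> (nat \<times> nat) list \<Rightarrow> nat set \<Rightarrow> bool" where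
  "two_comp V \<sigma> ts U \<longleftrightarrow> U \<subseteq> V \<and> (\<forall>x\<in>V. \<sigma> x \<in> U \<longleftrightarrow> x \<in> U) \<and> (\<forall>(r, s)\<in>set ts. r \<in> U \<longleftrightarrow> s \<in> U) \<and>
     conn U \<sigma> (filter (\<lambda>t. fst t \<in> U) ts) \<and> conn (V - U) \<sigma> (filter (\<lambda>t. fst t \<notin> U) ts)"

text \<open>No edge leaves \<open>U\<close> and \<open>U\<close> is connected in itself, so it is a
  full class.\<close>

lemma two_comp_eqcl_iff:
  assumes "two_comp V \<sigma> ts U" "x \<in> U" "y \<in> V"
  shows "(x, y) \<in> eqcl (edges V \<sigma> \<union> set ts) \<longleftrightarrow> y \<in> U"
proof
  assume "(x, y) \<in> eqcl (edges V \<sigma> \<union> set ts)"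
  then show "y \<in> U"
    by (rule eqcl_invariant) (use assms in \<open>auto simp: two_comp_def edges_def\<close>)
next
  assume "y \<in> U"
  then have "(x, y) \<in> eqcl (edges U \<sigma> \<union> set (filter (\<lambda>t. fst t \<in> U) ts))"
    using assms by (simp add: two_comp_def conn_def)
  then show "(x, y) \<in> eqcl (edges V \<sigma> \<union> set ts)"
    by (rule subsetD[OF eqcl_mono, rotated]) (use assms in \<open>auto simp: two_comp_def edges_def\<close>)
qed

text \<open>This is why the sum over all \<open>U\<close> in \<open>card_conn_snoc\<close> has at
  most one nonzero term.\<close>

lemma two_comp_unique:
  assumes "two_comp V \<sigma> ts U" "two_comp V \<sigma> ts U'" "r \<in> U" "r \<in> U'"
  shows "U = U'"
proof -
  have "U \<subseteq> V" "U' \<subseteq> V" using assms by (auto simp: two_comp_def)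
  then show ?thesis using two_comp_eqcl_iff[OF assms(1,3)] two_comp_eqcl_iff[OF assms(2,4)] by blast
qed

lemma two_comp_not_conn:
  assumes "two_comp V \<sigma> ts U" "r \<in> U" "s \<in> V - U" shows "\<not> conn V \<sigma> ts"
proof -
  have "r \<in> V" using assms by (auto simp: two_comp_def)
  then show ?thesis using two_comp_eqcl_iff[OF assms(1,2), of s] assms(3) by (auto simp: conn_def)
qed

lemma conn_snoc_if_two_comp:
  assumes U: "two_comp V \<sigma> ts U" and r: "r \<in> U" and s: "s \<in> V - U"
  shows "conn V \<sigma> (ts @ [(r, s)])"
proof -
  let ?E = "edges V \<sigma> \<union> set (ts @ [(r, s)])"
  have "(r, x) \<in> eqcl ?E" if "x \<in> V" for x
  proof (cases "x \<in> U")
    case True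
    then have "(r, x) \<in> eqcl (edges U \<sigma> \<union> set (filter (\<lambda>t. fst t \<in> U) ts))"
      using U r by (simp add: two_comp_def conn_def)
    then show ?thesis
      by (rule subsetD[OF eqcl_mono, rotated]) (use U in \<open>auto simp: two_comp_def edges_def\<close>)
  next
    case False
    then have "(s, x) \<in> eqcl (edges (V - U) \<sigma> \<union> set (filter (\<lambda>t. fst t \<notin> U) ts))"
      using U s that by (simp add: two_comp_def conn_def)
    then have "(s, x) \<in> eqcl ?E"
      by (rule subsetD[OF eqcl_mono, rotated]) (auto simp: edges_def)
    moreover have "(r, s) \<in> eqcl ?E" by (rule eqcl_base) simp
    ultimately show ?thesis using eqcl_trans[of r s ?E x] by blast
  qed
  then show ?thesis unfolding conn_def using eqcl_trans[of _ r ?E] eqcl_sym[of r _ ?E] by blast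
qed

text \<open>A single edge merges at most two classes. If it makes everything connected, then the
  class of r and the class of s were all there was.\<close>

lemma two_comp_if_conn_snoc:
  assumes \<sigma>: "\<sigma> permutes V" and ts: "set ts \<subseteq> V \<times> V" and rs: "r \<in> V" "s \<in> V"
    and c: "conn V \<sigma> (ts @ [(r, s)])" and nc: "\<not> conn V \<sigma> ts"
  shows "\<exists>U. two_comp V \<sigma> ts U \<and> r \<in> U \<and> s \<in> V - U"
proof -
  let ?E = "edges V \<sigma> \<union> set ts"
  define U where "U = {x\<in>V. (r, x) \<in> eqcl ?E}"
  have EV: "?E \<subseteq> V \<times> V" using \<sigma> ts by (auto simp: edges_def permutes_in_image)
  have inv: "u \<in> U \<longleftrightarrow> v \<in> U" if "(u, v) \<in> ?E" for u v
  proof -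
    have "(u, v) \<in> eqcl ?E" "(v, u) \<in> eqcl ?E" using eqcl_base[OF that] eqcl_sym[OF eqcl_base[OF that]] .
    then have "(r, u) \<in> eqcl ?E \<longleftrightarrow> (r, v) \<in> eqcl ?E"
      using eqcl_trans[of r u ?E v] eqcl_trans[of r v ?E u] by blast
    moreover have "u \<in> V" "v \<in> V" using that EV by auto
    ultimately show ?thesis by (simp add: U_def)
  qed
  have sU: "s \<notin> U"
  proof
    assume "s \<in> U"
    then have "(r, s) \<in> eqcl ?E" by (simp add: U_def)
    then show False using conn_snoc_if_eqcl[of r s] c nc by blast
  qed
  \<comment> \<open>Being reachable from r or from s by old edges is preserved along every edge, the
    new one included. So a point outside the class of r belongs to that of s.\<close>
  have cover: "(s, x) \<in> eqcl ?E" if "x \<in> V - U" for x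
  proof -
    have "(r, x) \<in> eqcl (edges V \<sigma> \<union> set (ts @ [(r, s)]))" using c rs that by (auto simp: conn_def)
    then have "(r, x) \<in> eqcl ?E \<or> (s, x) \<in> eqcl ?E"
    proof (rule eqcl_invariant)
      fix u v assume "(u, v) \<in> edges V \<sigma> \<union> set (ts @ [(r, s)])"
      then consider "(u, v) \<in> ?E" | "u = r" "v = s" by auto
      then show "((r, u) \<in> eqcl ?E \<or> (s, u) \<in> eqcl ?E) \<longleftrightarrow> ((r, v) \<in> eqcl ?E \<or> (s, v) \<in> eqcl ?E)"
      proof cases
        case 1
        then have "(u, v) \<in> eqcl ?E" "(v, u) \<in> eqcl ?E"
          using eqcl_base[OF 1] eqcl_sym[OF eqcl_base[OF 1]] by auto
        then show ?thesis
          using eqcl_trans[of _ u ?E v] eqcl_trans[of _ v ?E u] by blast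
      qed simp
    qed simp
    then show ?thesis using that by (auto simp: U_def)
  qed
  have "conn U \<sigma> (filter (\<lambda>t. fst t \<in> U) ts)"
    unfolding conn_def
  proof (intro ballI)
    fix x y assume xy: "x \<in> U" "y \<in> U"
    then have rxy: "(r, x) \<in> eqcl ?E" "(r, y) \<in> eqcl ?E" by (auto simp: U_def)
    have "(x, y) \<in> eqcl ?E" by (rule eqcl_trans[OF eqcl_sym[OF rxy(1)] rxy(2)])
    then have "(x, y) \<in> eqcl (?E \<inter> U \<times> U)" by (rule eqcl_restrict[OF _ inv xy(1)])
    then show "(x, y) \<in> eqcl (edges U \<sigma> \<union> set (filter (\<lambda>t. fst t \<in> U) ts))"
      by (rule subsetD[OF eqcl_mono, rotated]) (auto simp: edges_def)
  qed
  moreover have "conn (V - U) \<sigma> (filter (\<lambda>t. fst t \<notin> U) ts)"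
    unfolding conn_def
  proof (intro ballI)
    fix x y assume xy: "x \<in> V - U" "y \<in> V - U"
    then have "(x, y) \<in> eqcl ?E" using eqcl_trans[OF eqcl_sym[OF cover] cover] by blast
    then have "(x, y) \<in> eqcl (?E \<inter> (V - U) \<times> (V - U))"
    proof (rule eqcl_restrict)
      fix u v assume uv: "(u, v) \<in> ?E"
      then have "u \<in> V" "v \<in> V" using EV by auto
      then show "u \<in> V - U \<longleftrightarrow> v \<in> V - U" using inv[OF uv] by blast
    qed (use xy in simp)
    then show "(x, y) \<in> eqcl (edges (V - U) \<sigma> \<union> set (filter (\<lambda>t. fst t \<notin> U) ts))"
      by (rule subsetD[OF eqcl_mono, rotated]) (auto simp: edges_def)
  qed
  moreover have "\<forall>x\<in>V. \<sigma> x \<in> U \<longleftrightarrow> x \<in> U" using inv by (auto simp: edges_def)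
  moreover have "\<forall>(u, v)\<in>set ts. u \<in> U \<longleftrightarrow> v \<in> U" using inv by auto
  ultimately have "two_comp V \<sigma> ts U" by (auto simp: two_comp_def U_def)
  then show ?thesis using sU rs by (auto simp: U_def)
qed

section \<open>One cut-and-join step for a fixed first permutation\<close>

definition conn_facs :: "nat set \<Rightarrow> (nat \<Rightarrow> nat) \<Rightarrow> nat \<Rightarrow> nat list \<Rightarrow> ((nat \<times> nat) list \<times> nat set list) set" where
  "conn_facs V \<sigma> m \<mu> = {(ts, cs). ts \<in> mono_seqs V m \<and> conn V \<sigma> ts \<and> cs \<in> lab V (tp_prod \<sigma> ts) \<mu>}"

text \<open>What can remain after the last transposition is removed: the larger points are at most
  b, and b itself is marked even if no transposition of the prefix moves it.\<close>

definition bounded_facs :: "nat set \<Rightarrow> (nat \<Rightarrow> nat) \<Rightarrow> nat \<Rightarrow> nat \<Rightarrow> nat list \<Rightarrow> ((nat \<times> nat) list \<times> nat set list) set" where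
  "bounded_facs V \<sigma> m b \<mu> =
     {(ts, cs). ts \<in> mono_seqs_le V m b \<and> conn V \<sigma> ts \<and> cs \<in> marked_lab V (tp_prod \<sigma> ts) b \<mu>}"

text \<open>Only the point b is marked. That the whole tail up to the largest point lies in the same
  cycle is shown in \<open>last_count_alt\<close>.\<close>

definition last_facs :: "nat set \<Rightarrow> (nat \<Rightarrow> nat) \<Rightarrow> nat \<Rightarrow> nat \<Rightarrow> nat list \<Rightarrow> ((nat \<times> nat) list \<times> nat set list) set" where
  "last_facs V \<sigma> m b \<mu> =
     {(ts, cs). ts \<in> mono_seqs V m \<and> conn V \<sigma> ts \<and> cs \<in> marked_lab V (tp_prod \<sigma> ts) b \<mu> \<and>
       ts \<noteq> [] \<and> snd (last ts) = b}"

text \<open>\<open>U\<close> is the component opposite to b, and the last label, which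
  \<open>card_join\<close> gives to the cycle of r, lies inside it.\<close>

definition split_facs :: "nat set \<Rightarrow> (nat \<Rightarrow> nat) \<Rightarrow> nat \<Rightarrow> nat \<Rightarrow> nat list \<Rightarrow> nat set \<Rightarrow> ((nat \<times> nat) list \<times> nat set list) set" where
  "split_facs V \<sigma> m b \<mu> U =
     {(ts, cs). ts \<in> mono_seqs_le V m b \<and> two_comp V \<sigma> ts U \<and> b \<notin> U \<and>
       cs \<in> marked_lab V (tp_prod \<sigma> ts) b \<mu> \<and> last cs \<subseteq> U}"

lemma card_bounded_facs:
  assumes "finite V"
  shows "card (bounded_facs V \<sigma> m b \<mu>) =
    (\<Sum>ts\<in>mono_seqs_le V m b. if conn V \<sigma> ts then card (marked_lab V (tp_prod \<sigma> ts) b \<mu>) else 0)"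
proof -
  have "bounded_facs V \<sigma> m b \<mu> =
      (SIGMA ts:mono_seqs_le V m b. {cs. conn V \<sigma> ts \<and> cs \<in> marked_lab V (tp_prod \<sigma> ts) b \<mu>})"
    by (auto simp: bounded_facs_def)
  then have "card (bounded_facs V \<sigma> m b \<mu>) =
      (\<Sum>ts\<in>mono_seqs_le V m b. card {cs. conn V \<sigma> ts \<and> cs \<in> marked_lab V (tp_prod \<sigma> ts) b \<mu>})"
    using assms by (simp add: finite_mono_seqs_le finite_marked_lab)
  also have "\<dots> = (\<Sum>ts\<in>mono_seqs_le V m b. if conn V \<sigma> ts then card (marked_lab V (tp_prod \<sigma> ts) b \<mu>) else 0)"
    by (intro sum.cong refl) simp
  finally show ?thesis .
qed

lemma card_split_facs:
  assumes "finite V"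
  shows "card (split_facs V \<sigma> m b \<mu> U) =
    (\<Sum>ts\<in>mono_seqs_le V m b. \<Sum>cs\<in>marked_lab V (tp_prod \<sigma> ts) b \<mu>.
       of_bool (two_comp V \<sigma> ts U \<and> b \<notin> U \<and> last cs \<subseteq> U))"
proof -
  have "split_facs V \<sigma> m b \<mu> U =
      (SIGMA ts:mono_seqs_le V m b. {cs \<in> marked_lab V (tp_prod \<sigma> ts) b \<mu>. two_comp V \<sigma> ts U \<and> b \<notin> U \<and> last cs \<subseteq> U})"
    by (auto simp: split_facs_def)
  then have "card (split_facs V \<sigma> m b \<mu> U) =
      (\<Sum>ts\<in>mono_seqs_le V m b. card {cs \<in> marked_lab V (tp_prod \<sigma> ts) b \<mu>. two_comp V \<sigma> ts U \<and> b \<notin> U \<and> last cs \<subseteq> U})"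
    using assms by (simp add: finite_mono_seqs_le finite_marked_lab)
  also have "\<dots> = (\<Sum>ts\<in>mono_seqs_le V m b. \<Sum>cs\<in>marked_lab V (tp_prod \<sigma> ts) b \<mu>.
       of_bool (two_comp V \<sigma> ts U \<and> b \<notin> U \<and> last cs \<subseteq> U))"
    using assms by (intro sum.cong refl) (simp add: finite_marked_lab Int_def flip: sum.inter_filter)
  finally show ?thesis .
qed

text \<open>For x \<ge> b the image x + 1 exceeds every point that the transpositions move.\<close>

lemma tp_prod_above:
  assumes "\<And>x. b \<le> x \<Longrightarrow> x < d \<Longrightarrow> \<sigma> x = Suc x" "\<forall>(r, s)\<in>set ts. r < s \<and> s \<le> b" "b \<le> x" "x < d"
  shows "tp_prod \<sigma> ts x = Suc x"
  using assms(2)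
proof (induction ts rule: rev_induct)
  case (snoc t ts)
  obtain r s where t: "t = (r, s)" by force
  have "tp_prod \<sigma> ts x = Suc x" using snoc by auto
  then show ?case using snoc.prems assms(3) t by (auto simp: transpose_def)
qed (use assms in simp)

lemma funpow_above:
  assumes "\<And>x. b \<le> x \<Longrightarrow> x < d \<Longrightarrow> p x = Suc x" "i \<le> d - b"
  shows "(p ^^ i) b = b + i"
  using assms(2) by (induction i) (use assms(1) in auto)

lemma snoc_mono_seqs_iff:
  "ts @ [(r, s)] \<in> mono_seqs V (Suc m) \<longleftrightarrow> ts \<in> mono_seqs_le V m s \<and> r \<in> V \<and> s \<in> V \<and> r < s"
  by (fastforce simp: mono_seqs_def mono_seqs_le_def sorted_append)

lemma card_last_facs_eq_sum:
  assumes "finite V" "b \<in> V"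
  shows "card (last_facs V \<sigma> (Suc m) b \<mu>) = (\<Sum>ts\<in>mono_seqs_le V m b.
    card {(r, cs). r \<in> V \<and> r < b \<and> conn V \<sigma> (ts @ [(r, b)]) \<and>
      cs \<in> marked_lab V (transpose r b \<circ> tp_prod \<sigma> ts) b \<mu>})" (is "_ = (\<Sum>ts\<in>_. card (?A ts))")
proof -
  have fin: "finite (?A ts)" for ts
    by (rule finite_subset[of _ "V \<times> (\<Union>r\<in>V. marked_lab V (transpose r b \<circ> tp_prod \<sigma> ts) b \<mu>)"])
       (use assms in \<open>auto simp: finite_marked_lab\<close>)
  let ?S = "SIGMA ts:mono_seqs_le V m b. ?A ts"
  let ?f = "\<lambda>(ts, r, cs). (ts @ [(r, b)], cs)"
  have "bij_betw ?f ?S (last_facs V \<sigma> (Suc m) b \<mu>)"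
    unfolding bij_betw_def
  proof
    show "inj_on ?f ?S" by (auto simp: inj_on_def)
    show "?f ` ?S = last_facs V \<sigma> (Suc m) b \<mu>"
    proof (intro equalityI subsetI)
      fix y assume "y \<in> ?f ` ?S"
      then show "y \<in> last_facs V \<sigma> (Suc m) b \<mu>"
        using assms(2) by (auto simp: last_facs_def snoc_mono_seqs_iff)
    next
      fix y assume "y \<in> last_facs V \<sigma> (Suc m) b \<mu>"
      then obtain us cs where y: "y = (us, cs)" and us: "us \<in> mono_seqs V (Suc m)" "conn V \<sigma> us"
        "cs \<in> marked_lab V (tp_prod \<sigma> us) b \<mu>" "us \<noteq> []" "snd (last us) = b"
        by (auto simp: last_facs_def)
      obtain ts r where e: "us = ts @ [(r, b)]" using us(4,5)
        by (metis append_butlast_last_id prod.collapse)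
      have "(ts, r, cs) \<in> ?S" using us(1,2,3) unfolding e snoc_mono_seqs_iff by auto
      then show "y \<in> ?f ` ?S" by (rule rev_image_eqI) (simp add: y e)
    qed
  qed
  then have "card (last_facs V \<sigma> (Suc m) b \<mu>) = card ?S" by (simp add: bij_betw_same_card)
  also have "\<dots> = (\<Sum>ts\<in>mono_seqs_le V m b. card (?A ts))"
    using assms fin by (intro card_SigmaI ballI) (auto simp: finite_mono_seqs_le)
  finally show ?thesis .
qed

text \<open>The cycle \<open>A\<close> lies in one component, so whether the appended pair (r, b)
  connects the system does not depend on the choice of r in \<open>A\<close>. The count is thus 0 or
  \<open>card A\<close>, which is the origin of the factor \<beta>. The bracket is 1 if the prefix
  is connected already or if a suitable \<open>U\<close> exists, and both cannot happen.\<close>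

lemma card_conn_snoc:
  assumes V: "finite V" and \<sigma>: "\<sigma> permutes V" and ts: "set ts \<subseteq> V \<times> V" and b: "b \<in> V"
    and A: "A \<in> cyc V (tp_prod \<sigma> ts)"
  shows "card {r \<in> A. conn V \<sigma> (ts @ [(r, b)])} =
    card A * (of_bool (conn V \<sigma> ts) + (\<Sum>U\<in>Pow V. of_bool (two_comp V \<sigma> ts U \<and> b \<notin> U \<and> A \<subseteq> U)))"
proof -
  let ?p = "tp_prod \<sigma> ts"
  let ?E = "edges V \<sigma> \<union> set ts"
  have p: "?p permutes V" by (rule tp_prod_permutes[OF \<sigma> ts])
  have AV: "A \<subseteq> V" using cyc_subset[OF p A] .
  obtain r0 where r0: "r0 \<in> A" using cyc_nonempty[OF A] by blast
  have A_eqcl: "(r, r') \<in> eqcl ?E" if "r \<in> A" "r' \<in> A" for r r'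
    using that orbit_eqcl[OF \<sigma> ts, of r r'] cyc_eq_orbit[OF V p A] AV by blast
  have A_sub: "A \<subseteq> U" if "two_comp V \<sigma> ts U" "r \<in> A" "r \<in> U" for r U
    using two_comp_eqcl_iff[OF that(1,3)] A_eqcl[OF that(2)] AV by blast
  show ?thesis
  proof (cases "conn V \<sigma> ts")
    case True
    then have "conn V \<sigma> (ts @ [(r, b)])" if "r \<in> A" for r
      using conn_snoc_if_eqcl[of r b V \<sigma> ts] that b AV by (auto simp: conn_def)
    then have "{r \<in> A. conn V \<sigma> (ts @ [(r, b)])} = A" by blast
    moreover have "(\<Sum>U\<in>Pow V. of_bool (two_comp V \<sigma> ts U \<and> b \<notin> U \<and> A \<subseteq> U)) = (0 :: nat)"
    proof (rule sum.neutral, rule ballI)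
      fix U assume "U \<in> Pow V"
      then show "of_bool (two_comp V \<sigma> ts U \<and> b \<notin> U \<and> A \<subseteq> U) = (0 :: nat)"
        using two_comp_not_conn[of V \<sigma> ts U r0 b] True b r0 by auto
    qed
    ultimately show ?thesis using True by simp
  next
    case False
    have iff: "conn V \<sigma> (ts @ [(r, b)]) \<longleftrightarrow> (\<exists>U. two_comp V \<sigma> ts U \<and> b \<notin> U \<and> A \<subseteq> U)"
      if r: "r \<in> A" for r
    proof
      assume "conn V \<sigma> (ts @ [(r, b)])"
      then obtain U where "two_comp V \<sigma> ts U" "r \<in> U" "b \<in> V - U"
        using two_comp_if_conn_snoc[OF \<sigma> ts _ b _ False] r AV by blast
      then show "\<exists>U. two_comp V \<sigma> ts U \<and> b \<notin> U \<and> A \<subseteq> U" using A_sub r by blast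
    next
      assume "\<exists>U. two_comp V \<sigma> ts U \<and> b \<notin> U \<and> A \<subseteq> U"
      then show "conn V \<sigma> (ts @ [(r, b)])" using conn_snoc_if_two_comp r b by blast
    qed
    show ?thesis
    proof (cases "\<exists>U. two_comp V \<sigma> ts U \<and> b \<notin> U \<and> A \<subseteq> U")
      case True
      then obtain U where U: "two_comp V \<sigma> ts U" "b \<notin> U" "A \<subseteq> U" by blast
      have "two_comp V \<sigma> ts U' \<and> b \<notin> U' \<and> A \<subseteq> U' \<longleftrightarrow> U' = U" for U'
        using U two_comp_unique[OF U(1), of U' r0] r0 by blast
      moreover have "U \<in> Pow V" using U by (auto simp: two_comp_def)
      ultimately have "(\<Sum>U\<in>Pow V. of_bool (two_comp V \<sigma> ts U \<and> b \<notin> U \<and> A \<subseteq> U)) = (1 :: nat)"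
        using V by simp
      moreover have "{r \<in> A. conn V \<sigma> (ts @ [(r, b)])} = A" using iff True by blast
      ultimately show ?thesis using False by simp
    next
      case F: False
      then have "(\<Sum>U\<in>Pow V. of_bool (two_comp V \<sigma> ts U \<and> b \<notin> U \<and> A \<subseteq> U)) = (0 :: nat)"
        by (intro sum.neutral) auto
      moreover have e: "{r \<in> A. conn V \<sigma> (ts @ [(r, b)])} = {}" using iff F by blast
      ultimately show ?thesis unfolding e using False by simp
    qed
  qed
qed

text \<open>For a fixed prefix, the last transposition is classified by whether r lies in the cycle
  of b. The three summands are the cuts, the joins with connected prefix and the joins with
  two-component prefix. The hypothesis on \<sigma> above b decides when r < b.\<close>

theorem card_last_facs_step:
  fixes \<nu> :: "nat list"
  assumes \<sigma>: "\<sigma> permutes {1..d}" and b: "1 \<le> b" "b \<le> d"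
    and above: "\<And>x. b \<le> x \<Longrightarrow> x < d \<Longrightarrow> \<sigma> x = Suc x"
    and \<mu>1: "1 \<le> \<mu>1" and \<nu>: "\<forall>x\<in>set \<nu>. 1 \<le> x"
  shows "card (last_facs {1..d} \<sigma> (Suc m) b (\<mu>1 # \<nu>)) =
     (if d - b < \<mu>1 then
        \<Sum>i<length \<nu>. card (bounded_facs {1..d} \<sigma> m b ((\<mu>1 + \<nu> ! i) # drop_nth i \<nu>)) else 0)
     + (\<Sum>(\<alpha>, \<beta>)\<in>splits \<mu>1. \<beta> * card (bounded_facs {1..d} \<sigma> m b (\<alpha> # \<nu> @ [\<beta>])))
     + (\<Sum>(\<alpha>, \<beta>)\<in>splits \<mu>1. \<beta> * (\<Sum>U\<in>Pow {1..d}. card (split_facs {1..d} \<sigma> m b (\<alpha> # \<nu> @ [\<beta>]) U)))"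
proof -
  define V where "V = {1..d}"
  have V: "finite V" and bV: "b \<in> V" and \<sigma>V: "\<sigma> permutes V" using \<sigma> b by (auto simp: V_def)
  let ?M = "mono_seqs_le V m b"
  let ?q = "\<lambda>ts r. transpose r b \<circ> tp_prod \<sigma> ts"
  let ?L = "\<lambda>ts \<mu>. marked_lab V (tp_prod \<sigma> ts) b \<mu>"
  define cut where "cut ts = {(r, cs). r \<in> V \<and> r < b \<and> conn V \<sigma> (ts @ [(r, b)]) \<and>
      cs \<in> marked_lab V (?q ts r) b (\<mu>1 # \<nu>) \<and> r \<in> orbit (tp_prod \<sigma> ts) b}" for ts
  define join where "join ts = {(r, cs). r \<in> V \<and> r < b \<and> conn V \<sigma> (ts @ [(r, b)]) \<and>
      cs \<in> marked_lab V (?q ts r) b (\<mu>1 # \<nu>) \<and> r \<notin> orbit (tp_prod \<sigma> ts) b}" for ts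
  have ts_props: "set ts \<subseteq> V \<times> V" "tp_prod \<sigma> ts permutes V"
    "\<And>x. b \<le> x \<Longrightarrow> x < d \<Longrightarrow> tp_prod \<sigma> ts x = Suc x" if "ts \<in> ?M" for ts
  proof -
    show ts: "set ts \<subseteq> V \<times> V" using that by (auto simp: mono_seqs_le_def mono_seqs_def)
    then show "tp_prod \<sigma> ts permutes V" using \<sigma>V by (rule tp_prod_permutes[rotated])
    show "tp_prod \<sigma> ts x = Suc x" if "b \<le> x" "x < d" for x
      using above that \<open>ts \<in> ?M\<close> by (intro tp_prod_above[of b d]) (auto simp: mono_seqs_le_def mono_seqs_def)
  qed
  have fin: "finite (cut ts)" "finite (join ts)" for ts
    by (rule finite_subset[of _ "V \<times> (\<Union>r\<in>V. marked_lab V (?q ts r) b (\<mu>1 # \<nu>))"];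
        use V in \<open>auto simp: cut_def join_def finite_marked_lab\<close>)+
  have cut: "card (cut ts) = (if d - b < \<mu>1 then
      \<Sum>i<length \<nu>. if conn V \<sigma> ts then card (?L ts ((\<mu>1 + \<nu> ! i) # drop_nth i \<nu>)) else 0 else 0)"
    if ts: "ts \<in> ?M" for ts
  proof -
    let ?p = "tp_prod \<sigma> ts"
    note p = ts_props(2)[OF ts]
    have eq: "(r, b) \<in> eqcl (edges V \<sigma> \<union> set ts)" if "r \<in> orbit ?p b" for r
      using orbit_eqcl[OF \<sigma>V ts_props(1)[OF ts] bV that] by (rule eqcl_sym)
    \<comment> \<open>The iterates of b with index 0, ..., d - b are b, ..., d, and r is the iterate
      of index \<mu>1. As iterates within one period differ, r falls below b exactly if \<mu>1 > d -
      b.\<close>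
    have lt: "r < b \<longleftrightarrow> d - b < \<mu>1" if "r \<in> V" "r \<noteq> b" "r \<in> orbit ?p b"
      "cs \<in> marked_lab V (?q ts r) b (\<mu>1 # \<nu>)" for r cs
    proof -
      note c = cut_position[OF V p that(2,3,1) bV that(4)]
      have pw: "(?p ^^ i) b = b + i" if "i \<le> d - b" for i
        using funpow_above[of b d ?p, OF ts_props(3)[OF ts] that] by blast
      show ?thesis
      proof
        assume "r < b"
        then show "d - b < \<mu>1" using pw[of \<mu>1] c by (metis not_add_less1 not_le_imp_less)
      next
        assume d: "d - b < \<mu>1"
        show "r < b"
        proof (rule ccontr)
          assume "\<not> r < b"
          then have "(?p ^^ (r - b)) b = r" using pw[of "r - b"] that(1) by (auto simp: V_def)
          moreover have "r - b < \<mu>1" using d that(1) by (auto simp: V_def)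
          moreover have "inj_on (\<lambda>i. (?p ^^ i) b) {..<card (orbit ?p b)}"
            using funpow_card_orbit[OF V p] by blast
          ultimately show False using c inj_onD[of _ _ "r - b" \<mu>1] by fastforce
        qed
      qed
    qed
    show ?thesis
    proof (cases "conn V \<sigma> ts \<and> d - b < \<mu>1")
      case True
      then have "cut ts = {(r, cs). r \<in> V \<and> r \<noteq> b \<and> r \<in> orbit ?p b \<and>
          cs \<in> marked_lab V (?q ts r) b (\<mu>1 # \<nu>)}"
        using lt conn_snoc_if_eqcl[OF eq] by (auto simp: cut_def)
      then show ?thesis using card_cut[OF V p bV \<mu>1 \<nu>] True by simp
    next
      case False
      then have "cut ts = {}" using lt conn_snoc_if_eqcl[OF eq] by (auto simp: cut_def)
      then show ?thesis using False by auto
    qed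
  qed
  have join: "card (join ts) = (\<Sum>(\<alpha>, \<beta>)\<in>splits \<mu>1.
      \<beta> * (if conn V \<sigma> ts then card (?L ts (\<alpha> # \<nu> @ [\<beta>])) else 0)
      + \<beta> * (\<Sum>U\<in>Pow V. \<Sum>cs\<in>?L ts (\<alpha> # \<nu> @ [\<beta>]). of_bool (two_comp V \<sigma> ts U \<and> b \<notin> U \<and> last cs \<subseteq> U)))"
    if ts: "ts \<in> ?M" for ts
  proof -
    let ?p = "tp_prod \<sigma> ts"
    note p = ts_props(2)[OF ts]
    define W where "W = {r \<in> V. r \<notin> orbit ?p b \<and> conn V \<sigma> (ts @ [(r, b)])}"
    \<comment> \<open>The points from b upwards are all in the cycle of b, so any point outside that
      cycle is smaller than b.\<close>
    have lt: "r < b" if "r \<in> V" "r \<notin> orbit ?p b" for r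
    proof (rule ccontr)
      assume "\<not> r < b"
      then have "(?p ^^ (r - b)) b = r"
        using funpow_above[of b d ?p "r - b", OF ts_props(3)[OF ts]] that(1) by (auto simp: V_def)
      then show False using that(2) funpow_in_orbit[OF self_in_orbit[OF V p]] by metis
    qed
    have "join ts = (SIGMA r:W. marked_lab V (?q ts r) b (\<mu>1 # \<nu>))"
      using lt by (auto simp: join_def W_def)
    then have "card (join ts) = (\<Sum>r\<in>W. card (marked_lab V (?q ts r) b (\<mu>1 # \<nu>)))"
      using V by (simp add: W_def finite_marked_lab)
    also have "\<dots> = (\<Sum>r\<in>W. \<Sum>(\<alpha>, \<beta>)\<in>splits \<mu>1. card {cs \<in> ?L ts (\<alpha> # \<nu> @ [\<beta>]). r \<in> last cs})"
      using card_join[OF V p _ bV] by (intro sum.cong refl) (auto simp: W_def)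
    also have "\<dots> = (\<Sum>x\<in>splits \<mu>1. \<Sum>r\<in>W. card {cs \<in> ?L ts (fst x # \<nu> @ [snd x]). r \<in> last cs})"
      by (subst sum.swap) (simp add: case_prod_beta)
    \<comment> \<open>Double counting: instead of labellings for each r, count for each labelling
      the admissible r in its last cycle.\<close>
    also have "\<dots> = (\<Sum>x\<in>splits \<mu>1. \<Sum>cs\<in>?L ts (fst x # \<nu> @ [snd x]). card {r \<in> last cs. conn V \<sigma> (ts @ [(r, b)])})"
    proof (rule sum.cong[OF refl])
      fix x assume "x \<in> splits \<mu>1"
      let ?A = "?L ts (fst x # \<nu> @ [snd x])"
      have "(\<Sum>r\<in>W. card {cs \<in> ?A. r \<in> last cs}) = (\<Sum>cs\<in>?A. card {r \<in> W. r \<in> last cs})"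
        using V by (intro sum_multicount_gen) (auto simp: W_def finite_marked_lab)
      also have "\<dots> = (\<Sum>cs\<in>?A. card {r \<in> last cs. conn V \<sigma> (ts @ [(r, b)])})"
      proof (rule sum.cong[OF refl])
        fix cs assume cs: "cs \<in> ?A"
        have "last cs \<subseteq> V" "last cs \<inter> orbit ?p b = {}"
          using last_marked_lab[OF V p cs] cyc_subset[OF p] by auto
        then have "{r \<in> W. r \<in> last cs} = {r \<in> last cs. conn V \<sigma> (ts @ [(r, b)])}"
          by (auto simp: W_def)
        then show "card {r \<in> W. r \<in> last cs} = card {r \<in> last cs. conn V \<sigma> (ts @ [(r, b)])}" by simp
      qed
      finally show "(\<Sum>r\<in>W. card {cs \<in> ?A. r \<in> last cs}) =
        (\<Sum>cs\<in>?A. card {r \<in> last cs. conn V \<sigma> (ts @ [(r, b)])})" .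
    qed
    also have "\<dots> = (\<Sum>(\<alpha>, \<beta>)\<in>splits \<mu>1.
      \<beta> * (if conn V \<sigma> ts then card (?L ts (\<alpha> # \<nu> @ [\<beta>])) else 0)
      + \<beta> * (\<Sum>U\<in>Pow V. \<Sum>cs\<in>?L ts (\<alpha> # \<nu> @ [\<beta>]). of_bool (two_comp V \<sigma> ts U \<and> b \<notin> U \<and> last cs \<subseteq> U)))"
    proof (rule sum.cong[OF refl])
      fix x assume "x \<in> splits \<mu>1"
      obtain \<alpha> \<beta> where x: "x = (\<alpha>, \<beta>)" by force
      let ?A = "?L ts (\<alpha> # \<nu> @ [\<beta>])"
      have "(\<Sum>cs\<in>?A. card {r \<in> last cs. conn V \<sigma> (ts @ [(r, b)])}) =
        (\<Sum>cs\<in>?A. \<beta> * (of_bool (conn V \<sigma> ts) + (\<Sum>U\<in>Pow V. of_bool (two_comp V \<sigma> ts U \<and> b \<notin> U \<and> last cs \<subseteq> U))))"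
        using last_marked_lab[OF V p] card_conn_snoc[OF V \<sigma>V ts_props(1)[OF ts] bV]
        by (intro sum.cong refl) simp
      also have "\<dots> = \<beta> * (if conn V \<sigma> ts then card ?A else 0) +
         \<beta> * (\<Sum>U\<in>Pow V. \<Sum>cs\<in>?A. of_bool (two_comp V \<sigma> ts U \<and> b \<notin> U \<and> last cs \<subseteq> U))"
        unfolding sum.swap[of _ "Pow V" ?A] sum_distrib_left[symmetric] sum.distrib
        by (simp add: algebra_simps)
      finally show "(\<Sum>cs\<in>?L ts (fst x # \<nu> @ [snd x]). card {r \<in> last cs. conn V \<sigma> (ts @ [(r, b)])}) =
        (case x of (\<alpha>, \<beta>) \<Rightarrow> \<beta> * (if conn V \<sigma> ts then card (?L ts (\<alpha> # \<nu> @ [\<beta>])) else 0)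
      + \<beta> * (\<Sum>U\<in>Pow V. \<Sum>cs\<in>?L ts (\<alpha> # \<nu> @ [\<beta>]). of_bool (two_comp V \<sigma> ts U \<and> b \<notin> U \<and> last cs \<subseteq> U)))"
        by (simp add: x)
    qed
    finally show ?thesis .
  qed
  have "card (last_facs V \<sigma> (Suc m) b (\<mu>1 # \<nu>)) = (\<Sum>ts\<in>?M. card (cut ts \<union> join ts))"
    unfolding card_last_facs_eq_sum[OF V bV]
    by (intro sum.cong refl arg_cong[where f = card]) (auto simp: cut_def join_def)
  also have "\<dots> = (\<Sum>ts\<in>?M. card (cut ts)) + (\<Sum>ts\<in>?M. card (join ts))"
    unfolding sum.distrib[symmetric]
    by (intro sum.cong refl card_Un_disjoint fin) (auto simp: cut_def join_def)
  also have "(\<Sum>ts\<in>?M. card (cut ts)) = (if d - b < \<mu>1 then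
      \<Sum>i<length \<nu>. card (bounded_facs V \<sigma> m b ((\<mu>1 + \<nu> ! i) # drop_nth i \<nu>)) else 0)"
    unfolding card_bounded_facs[OF V]
    by (subst sum.swap) (simp add: cut)
  also have "(\<Sum>ts\<in>?M. card (join ts)) =
    (\<Sum>x\<in>splits \<mu>1. snd x * (\<Sum>ts\<in>?M. if conn V \<sigma> ts then card (?L ts (fst x # \<nu> @ [snd x])) else 0)
      + snd x * (\<Sum>U\<in>Pow V. \<Sum>ts\<in>?M. \<Sum>cs\<in>?L ts (fst x # \<nu> @ [snd x]). of_bool (two_comp V \<sigma> ts U \<and> b \<notin> U \<and> last cs \<subseteq> U)))"
  proof -
    have "(\<Sum>ts\<in>?M. card (join ts)) = (\<Sum>ts\<in>?M. \<Sum>x\<in>splits \<mu>1.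
        snd x * (if conn V \<sigma> ts then card (?L ts (fst x # \<nu> @ [snd x])) else 0)
        + snd x * (\<Sum>U\<in>Pow V. \<Sum>cs\<in>?L ts (fst x # \<nu> @ [snd x]). of_bool (two_comp V \<sigma> ts U \<and> b \<notin> U \<and> last cs \<subseteq> U)))"
      by (intro sum.cong refl) (simp add: join case_prod_beta)
    also have "\<dots> = (\<Sum>x\<in>splits \<mu>1. \<Sum>ts\<in>?M.
        snd x * (if conn V \<sigma> ts then card (?L ts (fst x # \<nu> @ [snd x])) else 0)
        + snd x * (\<Sum>U\<in>Pow V. \<Sum>cs\<in>?L ts (fst x # \<nu> @ [snd x]). of_bool (two_comp V \<sigma> ts U \<and> b \<notin> U \<and> last cs \<subseteq> U)))"
      by (rule sum.swap)
    also have "\<dots> = (\<Sum>x\<in>splits \<mu>1. snd x * (\<Sum>ts\<in>?M. if conn V \<sigma> ts then card (?L ts (fst x # \<nu> @ [snd x])) else 0)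
        + snd x * (\<Sum>ts\<in>?M. \<Sum>U\<in>Pow V. \<Sum>cs\<in>?L ts (fst x # \<nu> @ [snd x]). of_bool (two_comp V \<sigma> ts U \<and> b \<notin> U \<and> last cs \<subseteq> U)))"
      by (simp only: sum.distrib sum_distrib_left)
    finally show ?thesis
      by (simp only: sum.swap[of _ "Pow V" ?M])
  qed
  finally show ?thesis
    unfolding V_def[symmetric] card_bounded_facs[OF V] card_split_facs[OF V]
    by (simp add: case_prod_beta sum.distrib)
qed

section \<open>Splitting a labelling\<close>

definition index_splits :: "nat \<Rightarrow> (nat set \<times> nat set) set" where
  "index_splits n = {(I, J). I \<union> J = {..<n} \<and> I \<inter> J = {}}"

lemma finite_index_splits [simp]: "finite (index_splits n)"
  by (rule finite_subset[of _ "Pow {..<n} \<times> Pow {..<n}"]) (auto simp: index_splits_def)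

lemma nths_snoc: "nths (xs @ [x]) I = nths xs I @ (if length xs \<in> I then [x] else [])"
  by (simp add: nths_append)

lemma nths_cover_unique:
  assumes "length xs = length ys" "{..<length xs} \<subseteq> I \<union> J" "nths xs I = nths ys I" "nths xs J = nths ys J"
  shows "xs = ys"
  using assms
proof (induction xs arbitrary: ys rule: rev_induct)
  case (snoc x xs)
  obtain ys' y where ys: "ys = ys' @ [y]" using snoc.prems(1) by (cases ys rule: rev_cases) auto
  have l: "length xs = length ys'" using snoc.prems(1) ys by simp
  have I: "nths xs I = nths ys' I" and J: "nths xs J = nths ys' J"
    using snoc.prems(3,4) l by (auto simp: ys nths_snoc split: if_splits)
  have "length xs \<in> I \<or> length xs \<in> J" using snoc.prems(2) by auto
  then have "x = y" using snoc.prems(3,4) l by (auto simp: ys nths_snoc split: if_splits)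
  moreover have "{..<length xs} \<subseteq> I \<union> J" using snoc.prems(2) by (simp add: lessThan_Suc)
  then have "xs = ys'" using snoc.IH[OF l _ I J] by blast
  ultimately show ?case by (simp add: ys)
qed simp

text \<open>Built from the end: the last position belongs to exactly one of \<open>I\<close> and
  \<open>J\<close> and takes the last entry of the corresponding list.\<close>

lemma nths_merge_exists:
  fixes xs ys :: "'a list"
  assumes "I \<inter> J = {}" "{..<n} \<subseteq> I \<union> J" "length xs = card (I \<inter> {..<n})" "length ys = card (J \<inter> {..<n})"
  shows "\<exists>zs. length zs = n \<and> nths zs I = xs \<and> nths zs J = ys"
  using assms(2-)
proof (induction n arbitrary: xs ys)
  case (Suc n)
  \<comment> \<open>Stated for a pair of sets in order to serve once for \<open>I\<close>,
    \<open>J\<close> and once with their roles exchanged.\<close>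
  have aux: "\<exists>zs. length zs = Suc n \<and> nths zs A = us \<and> nths zs B = vs"
    if n: "n \<in> A" "n \<notin> B" and us: "length us = card (A \<inter> {..<Suc n})" and vs: "length vs = card (B \<inter> {..<Suc n})"
      and IH: "\<And>(us :: 'a list) (vs :: 'a list). length us = card (A \<inter> {..<n}) \<Longrightarrow> length vs = card (B \<inter> {..<n}) \<Longrightarrow>
        \<exists>zs. length zs = n \<and> nths zs A = us \<and> nths zs B = vs"
    for A B and us vs :: "'a list"
  proof -
    have "A \<inter> {..<Suc n} = insert n (A \<inter> {..<n})" "B \<inter> {..<Suc n} = B \<inter> {..<n}"
      using n by (auto simp: less_Suc_eq)
    then have l: "length us = Suc (card (A \<inter> {..<n}))" "length vs = card (B \<inter> {..<n})"
      using us vs by auto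
    obtain us' u where u: "us = us' @ [u]" using l(1) by (cases us rule: rev_cases) auto
    obtain zs where "length zs = n" "nths zs A = us'" "nths zs B = vs"
      using IH[of us' vs] l u by auto
    then show ?thesis using n u by (intro exI[of _ "zs @ [u]"]) (simp add: nths_snoc)
  qed
  have cover: "{..<n} \<subseteq> I \<union> J" "n \<in> I \<or> n \<in> J"
    using Suc.prems(1) by (auto simp: lessThan_Suc)
  show ?case
  proof (cases "n \<in> I")
    case True
    then have "n \<notin> J" using assms(1) by auto
    then show ?thesis using aux[OF True _ Suc.prems(2,3)] Suc.IH[OF cover(1)] by blast
  next
    case False
    then have "n \<in> J" using cover by auto
    then show ?thesis using aux[OF _ False Suc.prems(3,2)] Suc.IH[OF cover(1)] by blast
  qed
qed simp

text \<open>Each cycle lies on one side, so a labelling amounts to the set \<open>I\<close> of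
  labels used on \<open>U\<close> together with a labelling of either side. The marked cycle stays
  first on the side of b, and the extra last cycle stays last on \<open>U\<close>.\<close>

lemma card_split_labellings:
  assumes V: "finite V" and p: "p permutes V" and U: "U \<subseteq> V"
    and p1: "p1 permutes U" "\<And>x. x \<in> U \<Longrightarrow> p x = p1 x"
    and p2: "p2 permutes V - U" "\<And>x. x \<in> V - U \<Longrightarrow> p x = p2 x" and b: "b \<in> V - U"
  shows "card {cs \<in> marked_lab V p b (\<alpha> # \<nu> @ [\<beta>]). last cs \<subseteq> U} =
    (\<Sum>(I, J)\<in>index_splits (length \<nu>).
      card (lab U p1 (nths \<nu> I @ [\<beta>])) * card (marked_lab (V - U) p2 b (\<alpha> # nths \<nu> J)))"
proof -
  let ?n = "length \<nu>"
  have fin: "finite U" "finite (V - U)" using V U finite_subset by auto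
  have o1: "orbit p x = orbit p1 x" if "x \<in> U" for x
    by (rule orbit_cong0[of x U]) (use that p1 permutes_in_image[OF p1(1)] in auto)
  have o2: "orbit p x = orbit p2 x" if "x \<in> V - U" for x
  proof (rule orbit_cong0[OF that])
    show "p \<in> V - U \<rightarrow> V - U" using p2(2) permutes_in_image[OF p2(1)] by simp
  qed (rule p2(2))
  have cyc: "cyc V p = cyc U p1 \<union> cyc (V - U) p2"
  proof -
    have "cyc V p = orbit p ` U \<union> orbit p ` (V - U)" using U by (auto simp: cyc_def)
    also have "orbit p ` U = orbit p1 ` U" by (rule image_cong[OF refl o1])
    also have "orbit p ` (V - U) = orbit p2 ` (V - U)" by (rule image_cong[OF refl o2])
    finally show ?thesis by (simp add: cyc_def)
  qed
  have sub1: "A \<subseteq> U" if "A \<in> cyc U p1" for A using cyc_subset[OF p1(1) that] .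
  have sub2: "A \<subseteq> V - U" "\<not> A \<subseteq> U" if "A \<in> cyc (V - U) p2" for A
    using cyc_subset[OF p2(1) that] cyc_nonempty[OF that] by auto
  have in1: "cyc U p1 = {A \<in> cyc V p. A \<subseteq> U}" using cyc sub1 sub2(2) by auto
  have in2: "cyc (V - U) p2 = {A \<in> cyc V p. \<not> A \<subseteq> U}" using cyc sub1 sub2(2) by auto
  have ob: "orbit p b = orbit p2 b" using o2 b by simp
  have obc: "orbit p b \<in> cyc (V - U) p2" using b by (auto simp: cyc_def ob)
  let ?L = "{cs \<in> marked_lab V p b (\<alpha> # \<nu> @ [\<beta>]). last cs \<subseteq> U}"
  let ?R = "SIGMA (I, J):index_splits ?n. lab U p1 (nths \<nu> I @ [\<beta>]) \<times> marked_lab (V - U) p2 b (\<alpha> # nths \<nu> J)"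
  \<comment> \<open>The cycles labelled by \<nu>, without the marked first and the extra last
    one.\<close>
  define mid :: "nat set list \<Rightarrow> nat set list" where "mid cs = butlast (tl cs)" for cs
  define f where "f cs = (({i. i < ?n \<and> mid cs ! i \<subseteq> U}, {i. i < ?n \<and> \<not> mid cs ! i \<subseteq> U}),
    (nths (mid cs) {i. i < ?n \<and> mid cs ! i \<subseteq> U} @ [last cs],
     hd cs # nths (mid cs) {i. i < ?n \<and> \<not> mid cs ! i \<subseteq> U}))" for cs
  have L: "cs = orbit p b # mid cs @ [last cs]" "map card (mid cs) = \<nu>" "card (last cs) = \<beta>"
    "card (orbit p b) = \<alpha>" "length (mid cs) = ?n" "distinct (mid cs)" "last cs \<notin> set (mid cs)"
    "insert (last cs) (set (mid cs)) = cyc V p - {orbit p b}"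
    if cs: "cs \<in> ?L" for cs
  proof -
    have a: "cs \<noteq> []" "hd cs = orbit p b" "card (orbit p b) = \<alpha>" "map card (tl cs) = \<nu> @ [\<beta>]"
      "distinct (tl cs)" "set (tl cs) = cyc V p - {orbit p b}"
      using cs marked_lab_iff[OF V p] by auto
    obtain es e where e: "tl cs = es @ [e]" using a(4) by (cases "tl cs" rule: rev_cases) auto
    have m: "mid cs = es" by (simp add: mid_def e)
    have l: "last cs = e" using a(1) e by (cases cs) auto
    show "cs = orbit p b # mid cs @ [last cs]" unfolding m l
      using a(1,2) e by (metis list.collapse)
    show "map card (mid cs) = \<nu>" "card (last cs) = \<beta>" "card (orbit p b) = \<alpha>"
      "distinct (mid cs)" "last cs \<notin> set (mid cs)"
      "insert (last cs) (set (mid cs)) = cyc V p - {orbit p b}"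
      using a e unfolding m l by auto
    then show "length (mid cs) = ?n" by (metis length_map)
  qed
  have "bij_betw f ?L ?R"
    unfolding bij_betw_def
  proof
    show "inj_on f ?L"
    proof (rule inj_onI)
      fix cs ds assume cs: "cs \<in> ?L" and ds: "ds \<in> ?L" and eq: "f cs = f ds"
      let ?I = "{i. i < ?n \<and> mid cs ! i \<subseteq> U}" and ?J = "{i. i < ?n \<and> \<not> mid cs ! i \<subseteq> U}"
      have IJ: "?I = {i. i < ?n \<and> mid ds ! i \<subseteq> U}" "?J = {i. i < ?n \<and> \<not> mid ds ! i \<subseteq> U}"
        and n: "nths (mid cs) ?I @ [last cs] = nths (mid ds) {i. i < ?n \<and> mid ds ! i \<subseteq> U} @ [last ds]"
          "nths (mid cs) ?J = nths (mid ds) {i. i < ?n \<and> \<not> mid ds ! i \<subseteq> U}"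
        using eq unfolding f_def by auto
      have n': "nths (mid cs) ?I = nths (mid ds) ?I" "last cs = last ds" "nths (mid cs) ?J = nths (mid ds) ?J"
        using n unfolding IJ[symmetric] by auto
      have "mid cs = mid ds"
        by (rule nths_cover_unique[OF _ _ n'(1,3)]) (use L(5)[OF cs] L(5)[OF ds] in auto)
      then show "cs = ds" using L(1)[OF cs] L(1)[OF ds] n'(2) by metis
    qed
    show "f ` ?L = ?R"
    proof (intro equalityI subsetI)
      fix y assume "y \<in> f ` ?L"
      then obtain cs where cs: "cs \<in> ?L" and y: "y = f cs" by blast
      note M = L[OF cs]
      let ?I = "{i. i < ?n \<and> mid cs ! i \<subseteq> U}" and ?J = "{i. i < ?n \<and> \<not> mid cs ! i \<subseteq> U}"
      have lU: "last cs \<subseteq> U" using cs by simp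
      have mid_cyc: "set (mid cs) \<subseteq> cyc V p" "last cs \<in> cyc V p" using M(8) by auto
      have s1: "set (nths (mid cs) ?I) = {A \<in> set (mid cs). A \<subseteq> U}"
        using M(5) by (auto simp: set_nths in_set_conv_nth)
      have s2: "set (nths (mid cs) ?J) = {A \<in> set (mid cs). \<not> A \<subseteq> U}"
        using M(5) by (auto simp: set_nths in_set_conv_nth)
      have bU: "\<not> orbit p b \<subseteq> U" using sub2(2)[OF obc] .
      have "orbit p b \<in> cyc V p" using obc cyc by blast
      then have ins: "cyc V p = insert (orbit p b) (insert (last cs) (set (mid cs)))"
        using M(8) by auto
      have nmem: "orbit p b \<notin> set (mid cs)" using M(8) by auto
      have c1: "cyc U p1 = insert (last cs) {A \<in> set (mid cs). A \<subseteq> U}"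
        unfolding in1 ins using lU bU by auto
      have c2: "cyc (V - U) p2 - {orbit p b} = {A \<in> set (mid cs). \<not> A \<subseteq> U}"
        unfolding in2 ins using lU nmem by auto
      have "nths (mid cs) ?I @ [last cs] \<in> lab U p1 (nths \<nu> ?I @ [\<beta>])"
        using M(2,3,6,7) s1 c1 by (auto simp: lab_def distinct_nthsI nths_map[symmetric])
      moreover have "hd cs # nths (mid cs) ?J \<in> marked_lab (V - U) p2 b (\<alpha> # nths \<nu> ?J)"
        unfolding marked_lab_iff[OF fin(2) p2(1)]
        using M(1,2,4,6) s2 c2 ob b by (auto simp: distinct_nthsI nths_map[symmetric] dest: arg_cong[of _ _ hd])
      moreover have "(?I, ?J) \<in> index_splits ?n" by (auto simp: index_splits_def)
      ultimately show "y \<in> ?R" by (auto simp: y f_def)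
    next
      fix y assume "y \<in> ?R"
      then obtain I J cs ds where y: "y = ((I, J), (cs, ds))" and IJ: "(I, J) \<in> index_splits ?n"
        and cs: "cs \<in> lab U p1 (nths \<nu> I @ [\<beta>])" and ds: "ds \<in> marked_lab (V - U) p2 b (\<alpha> # nths \<nu> J)"
        by auto
      have IJ': "I \<union> J = {..<?n}" "I \<inter> J = {}" using IJ by (auto simp: index_splits_def)
      obtain es e where e: "cs = es @ [e]" using cs by (cases cs rule: rev_cases) (auto simp: lab_def)
      have es: "distinct es" "e \<notin> set es" "insert e (set es) = cyc U p1" "map card es = nths \<nu> I" "card e = \<beta>"
        using cs e by (auto simp: lab_def)
      have d: "ds \<noteq> []" "hd ds = orbit p b" "card (orbit p b) = \<alpha>" "map card (tl ds) = nths \<nu> J"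
        "distinct (tl ds)" "set (tl ds) = cyc (V - U) p2 - {orbit p b}"
        using ds marked_lab_iff[OF fin(2) p2(1)] ob by auto
      have len: "length es = card I" "length (tl ds) = card J"
        using arg_cong[OF es(4), of length] arg_cong[OF d(4), of length] IJ'(1)
        by (auto simp: length_nths intro!: arg_cong[of _ _ card])
      have int: "I \<inter> {..<?n} = I" "J \<inter> {..<?n} = J" using IJ'(1) by auto
      obtain zs where zs: "length zs = ?n" "nths zs I = es" "nths zs J = tl ds"
        using nths_merge_exists[OF IJ'(2), of ?n es "tl ds"] IJ'(1) len int by auto
      have setI: "zs ! i \<in> set es" if "i \<in> I" for i
        using that IJ'(1) zs(1) by (auto simp: zs(2)[symmetric] set_nths)
      have setJ: "zs ! i \<in> set (tl ds)" if "i \<in> J" for i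
        using that IJ'(1) zs(1) by (auto simp: zs(3)[symmetric] set_nths)
      have set_zs: "set zs = set es \<union> set (tl ds)"
      proof (intro equalityI subsetI)
        fix A assume "A \<in> set zs"
        then obtain i where "i < ?n" "A = zs ! i" using zs(1) by (auto simp: in_set_conv_nth)
        then show "A \<in> set es \<union> set (tl ds)" using setI setJ IJ'(1) by blast
      qed (auto simp: zs(2,3)[symmetric] dest: in_set_nthsD)
      have disj: "cyc U p1 \<inter> cyc (V - U) p2 = {}" using sub1 sub2 by blast
      have subs: "set es \<subseteq> cyc U p1" "set (tl ds) \<subseteq> cyc (V - U) p2"
        using es(3) d(6) by auto
      then have "set es \<inter> set (tl ds) = {}" using disj by auto
      \<comment> \<open>Distinctness follows by counting: the merged list has as many values as
        entries.\<close>
      then have "card (set zs) = card (set es) + card (set (tl ds))"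
        unfolding set_zs by (intro card_Un_disjoint) simp_all
      also have "\<dots> = length zs"
      proof -
        have "finite I" "finite J" using IJ'(1) by (metis finite_Un finite_lessThan)+
        then have "card I + card J = ?n" using card_Un_disjoint[of I J] IJ' by simp
        then show ?thesis using es(1) d(5) len zs(1) by (simp add: distinct_card)
      qed
      finally have dist: "distinct zs" by (rule card_distinct)
      have map: "map card zs = \<nu>"
        by (rule nths_cover_unique[of _ _ I J]) (use zs IJ' es(4) d(4) in \<open>auto simp: nths_map\<close>)
      let ?cs = "orbit p b # zs @ [e]"
      have ecyc: "e \<in> cyc U p1" using es(3) by blast
      have eV: "e \<noteq> orbit p b" "e \<notin> set (tl ds)" using ecyc obc disj d(6) by auto
      have "orbit p b \<notin> cyc U p1" using obc disj by blast
      then have "?cs \<in> marked_lab V p b (\<alpha> # \<nu> @ [\<beta>])"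
        unfolding marked_lab_iff[OF V p]
        using b d(3) map es dist set_zs eV cyc d(6) by auto
      then have csL: "?cs \<in> ?L" using sub1[OF ecyc] by simp
      have mid: "mid ?cs = zs" by (simp add: mid_def)
      have UI: "zs ! i \<subseteq> U" if "i \<in> I" for i
        using sub1 subsetD[OF subs(1) setI[OF that]] .
      have UJ: "\<not> zs ! i \<subseteq> U" if "i \<in> J" for i
        using sub2(2) subsetD[OF subs(2) setJ[OF that]] .
      have lt: "i < ?n \<longleftrightarrow> i \<in> I \<or> i \<in> J" for i using IJ'(1) by auto
      have eqs: "{i. i < ?n \<and> zs ! i \<subseteq> U} = I" "{i. i < ?n \<and> \<not> zs ! i \<subseteq> U} = J"
        unfolding lt using UI UJ by auto
      have dseq: "orbit p b # tl ds = ds" using d(1,2) by (metis list.collapse)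
      have "f ?cs = y"
        using zs(2,3) e dseq unfolding f_def mid y eqs by simp
      then show "y \<in> f ` ?L" using csL by blast
    qed
  qed
  then have "card ?L = card ?R" by (simp add: bij_betw_same_card)
  also have "\<dots> = (\<Sum>x\<in>index_splits ?n. card (case x of (I, J) \<Rightarrow> lab U p1 (nths \<nu> I @ [\<beta>]) \<times> marked_lab (V - U) p2 b (\<alpha> # nths \<nu> J)))"
    using fin by (intro card_SigmaI) (auto simp: finite_marked_lab finite_lab)
  also have "\<dots> = (\<Sum>(I, J)\<in>index_splits ?n.
      card (lab U p1 (nths \<nu> I @ [\<beta>])) * card (marked_lab (V - U) p2 b (\<alpha> # nths \<nu> J)))"
    by (intro sum.cong) (auto simp: card_cartesian_product)
  finally show ?thesis .
qed

section \<open>Disconnected factorisations and the genus\<close>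

lemma perm_restrict_permutes:
  assumes "\<sigma> permutes V" "W \<subseteq> V" "\<forall>x\<in>V. \<sigma> x \<in> W \<longleftrightarrow> x \<in> W"
  shows "perm_restrict \<sigma> W permutes W"
proof (rule bij_imp_permutes)
  have "\<sigma> ` W = W"
  proof (intro equalityI subsetI)
    fix y assume y: "y \<in> W"
    then obtain x where x: "x \<in> V" "y = \<sigma> x"
      using permutes_image[OF assms(1)] assms(2) by blast
    then show "y \<in> \<sigma> ` W" using assms(3) y by blast
  qed (use assms in auto)
  then show "bij_betw (perm_restrict \<sigma> W) W W"
    using permutes_inj_on[OF assms(1), of W]
    by (simp add: bij_betw_def perm_restrict_def inj_on_def cong: image_cong)
qed (simp add: perm_restrict_def)

lemma conn_perm_restrict: "conn W (perm_restrict \<sigma> W) ts \<longleftrightarrow> conn W \<sigma> ts"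
  by (simp add: conn_def edges_def perm_restrict_def cong: image_cong)

text \<open>A transposition with both points outside \<open>W\<close> fixes \<open>W\<close>
  pointwise, so only the pairs inside \<open>W\<close> act there.\<close>

lemma tp_prod_restrict:
  assumes "\<forall>x\<in>W. \<sigma> x \<in> W" "\<forall>(r, s)\<in>set ts. r \<in> W \<longleftrightarrow> s \<in> W" "x \<in> W"
  shows "tp_prod \<sigma> ts x = tp_prod (perm_restrict \<sigma> W) (filter (\<lambda>t. fst t \<in> W) ts) x \<and> tp_prod \<sigma> ts x \<in> W"
  using assms(2)
proof (induction ts rule: rev_induct)
  case Nil
  then show ?case using assms by (simp add: perm_restrict_def)
next
  case (snoc t ts)
  obtain r s where t: "t = (r, s)" by force
  have IH: "tp_prod \<sigma> ts x = tp_prod (perm_restrict \<sigma> W) (filter (\<lambda>t. fst t \<in> W) ts) x" "tp_prod \<sigma> ts x \<in> W"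
    using snoc by auto
  have "r \<in> W \<longleftrightarrow> s \<in> W" using snoc.prems t by auto
  then show ?case
    using IH(2) by (cases "r \<in> W") (auto simp: t IH(1)[symmetric] transpose_def)
qed

lemma cyc_union:
  assumes V: "finite V" "U \<subseteq> V" and p1: "p1 permutes U" "\<And>x. x \<in> U \<Longrightarrow> p x = p1 x"
    and p2: "p2 permutes V - U" "\<And>x. x \<in> V - U \<Longrightarrow> p x = p2 x"
  shows "card (cyc V p) = card (cyc U p1) + card (cyc (V - U) p2)"
proof -
  have o1: "orbit p x = orbit p1 x" if "x \<in> U" for x
    by (rule orbit_cong0[of x U]) (use that p1 permutes_in_image[OF p1(1)] in auto)
  have o2: "orbit p x = orbit p2 x" if "x \<in> V - U" for x
  proof (rule orbit_cong0[OF that])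
    show "p \<in> V - U \<rightarrow> V - U" using p2(2) permutes_in_image[OF p2(1)] by simp
  qed (rule p2(2))
  have "cyc V p = orbit p ` U \<union> orbit p ` (V - U)" using V by (auto simp: cyc_def)
  also have "orbit p ` U = cyc U p1" unfolding cyc_def by (rule image_cong[OF refl o1])
  also have "orbit p ` (V - U) = cyc (V - U) p2" unfolding cyc_def by (rule image_cong[OF refl o2])
  finally have c: "cyc V p = cyc U p1 \<union> cyc (V - U) p2" .
  have "cyc U p1 \<inter> cyc (V - U) p2 = {}"
    using cyc_subset[OF p1(1)] cyc_subset[OF p2(1)] cyc_nonempty[of _ U p1] by blast
  then show ?thesis using V finite_subset[OF V(2)] unfolding c by (simp add: card_Un_disjoint)
qed

lemma two_comp_parts:
  assumes \<sigma>: "\<sigma> permutes V" and ts: "set ts \<subseteq> V \<times> V" and U: "U \<subseteq> V" "\<forall>x\<in>V. \<sigma> x \<in> U \<longleftrightarrow> x \<in> U"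
    and sep: "\<forall>(r, s)\<in>set ts. r \<in> U \<longleftrightarrow> s \<in> U"
  defines "ts1 \<equiv> filter (\<lambda>t. fst t \<in> U) ts" and "ts2 \<equiv> filter (\<lambda>t. fst t \<notin> U) ts"
  defines "\<sigma>1 \<equiv> perm_restrict \<sigma> U" and "\<sigma>2 \<equiv> perm_restrict \<sigma> (V - U)"
  shows "\<sigma>1 permutes U" "\<sigma>2 permutes V - U" "set ts1 \<subseteq> U \<times> U" "set ts2 \<subseteq> (V - U) \<times> (V - U)"
    "\<And>x. x \<in> U \<Longrightarrow> tp_prod \<sigma> ts x = tp_prod \<sigma>1 ts1 x"
    "\<And>x. x \<in> V - U \<Longrightarrow> tp_prod \<sigma> ts x = tp_prod \<sigma>2 ts2 x"
proof -
  show "\<sigma>1 permutes U" "\<sigma>2 permutes V - U"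
    unfolding \<sigma>1_def \<sigma>2_def using \<sigma> U by (auto intro!: perm_restrict_permutes simp: permutes_in_image)
  show "set ts1 \<subseteq> U \<times> U" "set ts2 \<subseteq> (V - U) \<times> (V - U)"
    using ts sep by (auto simp: ts1_def ts2_def)
  show "tp_prod \<sigma> ts x = tp_prod \<sigma>1 ts1 x" if "x \<in> U" for x
    unfolding \<sigma>1_def ts1_def using tp_prod_restrict[of U \<sigma> ts x] that U sep by auto
  have f: "filter (\<lambda>t. fst t \<in> V - U) ts = ts2"
    unfolding ts2_def using ts by (intro filter_cong) auto
  show "tp_prod \<sigma> ts x = tp_prod \<sigma>2 ts2 x" if "x \<in> V - U" for x
  proof -
    have "\<forall>(r, s)\<in>set ts. r \<in> V - U \<longleftrightarrow> s \<in> V - U" using ts sep by auto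
    moreover have "\<forall>x\<in>V - U. \<sigma> x \<in> V - U" using U \<sigma> by (simp add: permutes_in_image)
    ultimately show ?thesis
      using tp_prod_restrict[of "V - U" \<sigma> ts x] that unfolding f \<sigma>2_def by blast
  qed
qed

section \<open>The Riemann-Hurwitz equation\<close>

lemma card_cyc_merge:
  assumes "finite V" "p permutes V" "r \<in> V" "s \<in> V" "r \<notin> orbit p s"
  shows "card (cyc V p) = Suc (card (cyc V (transpose r s \<circ> p)))"
proof -
  define R where "R = cyc V p - {orbit p s, orbit p r}"
  note M = cyc_merge_disjoint[OF assms, folded R_def]
  have R: "finite R" "orbit p s \<notin> R" "orbit p r \<notin> R" using assms(1) by (auto simp: R_def)
  have "card (cyc V (transpose r s \<circ> p)) = Suc (card R)" using R M(1,3) by simp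
  moreover have "card (cyc V p) = Suc (Suc (card R))" using R M(2,4) by simp
  ultimately show ?thesis by simp
qed

lemma cyc_singleton_if_conn:
  assumes V: "finite V" "\<sigma> permutes V" "x \<in> V" and "conn V \<sigma> []"
  shows "cyc V \<sigma> = {V}"
proof -
  have "orbit \<sigma> y = V" if y: "y \<in> V" for y
  proof
    show "orbit \<sigma> y \<subseteq> V" using permutes_orbit_subset[OF V(2) y] .
    show "V \<subseteq> orbit \<sigma> y"
    proof
      fix z assume "z \<in> V"
      then have "(y, z) \<in> eqcl (edges V \<sigma>)" using assms(4) y by (simp add: conn_def)
      then show "z \<in> orbit \<sigma> y"
      proof (rule eqcl_invariant)
        fix u v assume "(u, v) \<in> edges V \<sigma>"
        then have "v = \<sigma> u" by (auto simp: edges_def)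
        then have "orbit \<sigma> v = orbit \<sigma> u"
          using self_in_orbit_step[OF self_in_orbit[OF V(1,2)]] by simp
        then show "u \<in> orbit \<sigma> y \<longleftrightarrow> v \<in> orbit \<sigma> y" using orbit_eq_iff[OF V(1,2)] by metis
      qed (rule self_in_orbit[OF V(1,2)])
    qed
  qed
  then show ?thesis using V(3) by (auto simp: cyc_def)
qed

text \<open>Induction on the number of transpositions. A cut adds a cycle and keeps g; a join with
  connected prefix loses a cycle and raises g by one; a join of two components loses a cycle and
  adds their genera. The last case descends to two subsets, which is why \<open>V\<close> varies in
  the induction. The outcome excludes negative genus and wrong parity.\<close>

lemma genus_exists:
  assumes "finite V" "V \<noteq> {}" "\<sigma> permutes V" "\<forall>(r, s)\<in>set ts. r \<in> V \<and> s \<in> V \<and> r \<noteq> s" "conn V \<sigma> ts"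
  shows "\<exists>g. length ts + 2 = 2 * g + card (cyc V (tp_prod \<sigma> ts)) + card (cyc V \<sigma>)"
  using assms
proof (induction "length ts" arbitrary: V \<sigma> ts rule: less_induct)
  case less
  note V = less.prems(1) and \<sigma> = less.prems(3)
  show ?case
  proof (cases ts rule: rev_cases)
    case Nil
    then have "cyc V \<sigma> = {V}" using cyc_singleton_if_conn[OF V \<sigma>] less.prems by blast
    then show ?thesis using Nil by (intro exI[of _ 0]) simp
  next
    case (snoc us t)
    obtain r s where t: "t = (r, s)" by force
    have rs: "r \<in> V" "s \<in> V" "r \<noteq> s" using less.prems(4) snoc t by auto
    have us: "\<forall>(r, s)\<in>set us. r \<in> V \<and> s \<in> V \<and> r \<noteq> s" using less.prems(4) snoc by auto
    then have us': "set us \<subseteq> V \<times> V" by auto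
    let ?p = "tp_prod \<sigma> us" and ?q = "transpose r s \<circ> tp_prod \<sigma> us"
    have p: "?p permutes V" by (rule tp_prod_permutes[OF \<sigma> us'])
    have q: "?q permutes V" using p rs by (intro transpose_comp_permutes) auto
    have pq: "transpose r s \<circ> ?q = ?p" by (simp add: fun_eq_iff)
    have c: "conn V \<sigma> (us @ [(r, s)])" using less.prems(5) snoc t by simp
    have len: "length us < length ts" using snoc by simp
    have tq: "tp_prod \<sigma> ts = ?q" using snoc t by simp
    show ?thesis
    proof (cases "r \<in> orbit ?p s")
      case True
      have "(r, s) \<in> eqcl (edges V \<sigma> \<union> set us)"
        using orbit_eqcl[OF \<sigma> us' rs(2) True] by (rule eqcl_sym)
      then have "conn V \<sigma> us" using c conn_snoc_if_eqcl by blast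
      then obtain g where g: "length us + 2 = 2 * g + card (cyc V ?p) + card (cyc V \<sigma>)"
        using less.hyps[OF len V less.prems(2) \<sigma> us] by blast
      have "r \<notin> orbit ?q s" using orbit_transpose_cases[OF V p rs] True by simp
      then have "card (cyc V ?q) = Suc (card (cyc V ?p))"
        using card_cyc_merge[OF V q rs(1,2)] unfolding pq by simp
      then show ?thesis unfolding tq using g snoc by (intro exI[of _ g]) simp
    next
      case False
      have cq: "card (cyc V ?p) = Suc (card (cyc V ?q))"
        using card_cyc_merge[OF V p rs(1,2) False] .
      show ?thesis
      proof (cases "conn V \<sigma> us")
        case True
        then obtain g where g: "length us + 2 = 2 * g + card (cyc V ?p) + card (cyc V \<sigma>)"
          using less.hyps[OF len V less.prems(2) \<sigma> us] by blast
        then show ?thesis unfolding tq using cq snoc by (intro exI[of _ "Suc g"]) simp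
      next
        case nc: False
        obtain U where U: "two_comp V \<sigma> us U" "r \<in> U" "s \<in> V - U"
          using two_comp_if_conn_snoc[OF \<sigma> us' rs(1,2) c nc] by blast
        let ?us1 = "filter (\<lambda>t. fst t \<in> U) us" and ?us2 = "filter (\<lambda>t. fst t \<notin> U) us"
        let ?\<sigma>1 = "perm_restrict \<sigma> U" and ?\<sigma>2 = "perm_restrict \<sigma> (V - U)"
        have U': "U \<subseteq> V" "\<forall>x\<in>V. \<sigma> x \<in> U \<longleftrightarrow> x \<in> U" "\<forall>(r, s)\<in>set us. r \<in> U \<longleftrightarrow> s \<in> U"
          "conn U \<sigma> ?us1" "conn (V - U) \<sigma> ?us2" using U(1) by (auto simp: two_comp_def)
        note P = two_comp_parts[OF \<sigma> us' U'(1-3)]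
        have fin: "finite U" "finite (V - U)" using V U'(1) finite_subset by auto
        have l: "length ?us1 < length ts" "length ?us2 < length ts"
          using length_filter_le[of _ us] len by (meson le_less_trans)+
        have "\<forall>(r, s)\<in>set ?us1. r \<in> U \<and> s \<in> U \<and> r \<noteq> s" using us P(3) by auto
        then obtain g1 where g1: "length ?us1 + 2 = 2 * g1 + card (cyc U (tp_prod ?\<sigma>1 ?us1)) + card (cyc U ?\<sigma>1)"
          using less.hyps[OF l(1) fin(1) _ P(1)] U(2) U'(4) conn_perm_restrict by blast
        have "\<forall>(r, s)\<in>set ?us2. r \<in> V - U \<and> s \<in> V - U \<and> r \<noteq> s" using us P(4) by auto
        then obtain g2 where g2: "length ?us2 + 2 = 2 * g2 + card (cyc (V - U) (tp_prod ?\<sigma>2 ?us2)) + card (cyc (V - U) ?\<sigma>2)"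
          using less.hyps[OF l(2) fin(2) _ P(2)] U(3) U'(5) conn_perm_restrict by blast
        have "card (cyc V ?p) = card (cyc U (tp_prod ?\<sigma>1 ?us1)) + card (cyc (V - U) (tp_prod ?\<sigma>2 ?us2))"
          by (rule cyc_union[OF V U'(1) tp_prod_permutes[OF P(1,3)] P(5) tp_prod_permutes[OF P(2,4)] P(6)])
        moreover have "card (cyc V \<sigma>) = card (cyc U ?\<sigma>1) + card (cyc (V - U) ?\<sigma>2)"
          by (rule cyc_union[OF V U'(1) P(1) _ P(2)]) (simp_all add: perm_restrict_def)
        moreover have "length us = length ?us1 + length ?us2"
          using sum_length_filter_compl[of "\<lambda>t. fst t \<in> U" us] by simp
        ultimately show ?thesis unfolding tq using g1 g2 cq snoc
          by (intro exI[of _ "g1 + g2"]) simp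
      qed
    qed
  qed
qed

lemma card_lab_length: "cs \<in> lab V p \<mu> \<Longrightarrow> card (cyc V p) = length \<mu>"
  using distinct_card[of cs] by (auto simp: lab_def)

lemma conn_facs_genus:
  assumes "finite V" "V \<noteq> {}" "\<sigma> permutes V" "x \<in> conn_facs V \<sigma> m \<mu>"
  shows "\<exists>g. m + 2 = 2 * g + length \<mu> + card (cyc V \<sigma>)"
proof -
  obtain ts cs where x: "ts \<in> mono_seqs V m" "conn V \<sigma> ts" "cs \<in> lab V (tp_prod \<sigma> ts) \<mu>"
    using assms(4) by (auto simp: conn_facs_def)
  have "\<forall>(r, s)\<in>set ts. r \<in> V \<and> s \<in> V \<and> r \<noteq> s" using x(1) by (auto simp: mono_seqs_def)
  from genus_exists[OF assms(1-3) this x(2)] show ?thesis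
    using x card_lab_length by (auto simp: mono_seqs_def)
qed

lemma bounded_facs_subset: "bounded_facs V \<sigma> m b \<mu> \<subseteq> conn_facs V \<sigma> m \<mu>"
  by (auto simp: bounded_facs_def conn_facs_def mono_seqs_le_def marked_lab_def)

section \<open>Interleaving monotone sequences\<close>

text \<open>Pairs with the same larger point lie on the same side of \<open>U\<close>, so a stable
  sort by larger point never has to decide between pairs from different sides.\<close>

lemma sort_key_merge:
  assumes "sorted (map snd ts)" "\<forall>(r, s)\<in>set ts. r \<in> U \<longleftrightarrow> s \<in> U"
  shows "sort_key snd (filter (\<lambda>t. fst t \<in> U) ts @ filter (\<lambda>t. fst t \<notin> U) ts) = ts"
proof (rule properties_for_sort_key)
  show "mset ts = mset (filter (\<lambda>t. fst t \<in> U) ts @ filter (\<lambda>t. fst t \<notin> U) ts)"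
    by (simp add: multiset_partition[symmetric])
  fix k assume k: "k \<in> set ts"
  have U: "fst x \<in> U \<longleftrightarrow> snd x \<in> U" if "x \<in> set ts" for x using assms(2) that by (auto simp: split_beta)
  show "filter (\<lambda>x. snd k = snd x) ts =
    filter (\<lambda>x. snd k = snd x) (filter (\<lambda>t. fst t \<in> U) ts @ filter (\<lambda>t. fst t \<notin> U) ts)"
  proof (cases "snd k \<in> U")
    case True
    have "filter (\<lambda>x. fst x \<in> U \<and> snd k = snd x) ts = filter (\<lambda>x. snd k = snd x) ts"
      using True U by (intro filter_cong) auto
    moreover have "filter (\<lambda>x. fst x \<notin> U \<and> snd k = snd x) ts = []"
      using True U by (intro filter_False) auto
    ultimately show ?thesis by simp
  next
    case False
    have "filter (\<lambda>x. fst x \<notin> U \<and> snd k = snd x) ts = filter (\<lambda>x. snd k = snd x) ts"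
      using False U by (intro filter_cong) auto
    moreover have "filter (\<lambda>x. fst x \<in> U \<and> snd k = snd x) ts = []"
      using False U by (intro filter_False) auto
    ultimately show ?thesis by simp
  qed
qed (rule assms)

text \<open>The inverse of splitting is merging by a stable sort. As \<open>U\<close> has no point
  above b, the bound b restricts only the sequence on the other side.\<close>

lemma sum_mono_seqs_split:
  fixes h :: "(nat \<times> nat) list \<Rightarrow> (nat \<times> nat) list \<Rightarrow> nat"
  assumes V: "finite V" "U \<subseteq> V" and Ub: "\<forall>x\<in>U. x \<le> b"
  shows "(\<Sum>ts\<in>{ts \<in> mono_seqs_le V m b. \<forall>(r, s)\<in>set ts. r \<in> U \<longleftrightarrow> s \<in> U}.
      h (filter (\<lambda>t. fst t \<in> U) ts) (filter (\<lambda>t. fst t \<notin> U) ts)) =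
    (\<Sum>j\<le>m. \<Sum>ts1\<in>mono_seqs U j. \<Sum>ts2\<in>mono_seqs_le (V - U) (m - j) b. h ts1 ts2)"
proof -
  let ?A = "{ts \<in> mono_seqs_le V m b. \<forall>(r, s)\<in>set ts. r \<in> U \<longleftrightarrow> s \<in> U}"
  let ?B = "SIGMA j:{..m}. mono_seqs U j \<times> mono_seqs_le (V - U) (m - j) b"
  let ?f = "\<lambda>ts. (length (filter (\<lambda>t. fst t \<in> U) ts), filter (\<lambda>t. fst t \<in> U) ts, filter (\<lambda>t. fst t \<notin> U) ts)"
  let ?g = "\<lambda>(j :: nat, ts1, ts2). sort_key snd (ts1 @ ts2)"
  have fin: "finite U" "finite (V - U)" using V finite_subset by auto
  have "bij_betw ?f ?A ?B"
  proof (rule bij_betw_byWitness[where f' = ?g])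
    show "\<forall>ts\<in>?A. ?g (?f ts) = ts"
      using sort_key_merge by (auto simp: mono_seqs_le_def mono_seqs_def)
    show "\<forall>x\<in>?B. ?f (?g x) = x"
    proof
      fix x assume "x \<in> ?B"
      then obtain j ts1 ts2 where x: "x = (j, ts1, ts2)" and t: "ts1 \<in> mono_seqs U j" "ts2 \<in> mono_seqs_le (V - U) (m - j) b"
        by auto
      have "filter (\<lambda>t. fst t \<in> U) ts1 = ts1" "filter (\<lambda>t. fst t \<notin> U) ts2 = ts2"
        using t by (intro filter_True; fastforce simp: mono_seqs_def mono_seqs_le_def)+
      moreover have "filter (\<lambda>t. fst t \<in> U) ts2 = []" "filter (\<lambda>t. fst t \<notin> U) ts1 = []"
        using t by (intro filter_False; fastforce simp: mono_seqs_def mono_seqs_le_def)+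
      ultimately show "?f (?g x) = x" using t
        by (simp add: x filter_sort sort_key_id_if_sorted mono_seqs_def mono_seqs_le_def)
    qed
    show "?f ` ?A \<subseteq> ?B"
    proof
      fix y assume "y \<in> ?f ` ?A"
      then obtain ts where ts: "ts \<in> ?A" and y: "y = ?f ts" by blast
      have "length (filter (\<lambda>t. fst t \<in> U) ts) + length (filter (\<lambda>t. fst t \<notin> U) ts) = m"
        using ts sum_length_filter_compl[of "\<lambda>t. fst t \<in> U" ts] by (simp add: mono_seqs_le_def mono_seqs_def)
      moreover have "sorted (map snd (filter P ts))" for P
        using ts by (intro sorted_filter) (simp add: mono_seqs_le_def mono_seqs_def)
      ultimately show "y \<in> ?B" using ts unfolding y by (fastforce simp: mono_seqs_le_def mono_seqs_def)
    qed
    show "?g ` ?B \<subseteq> ?A"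
    proof
      fix ts assume "ts \<in> ?g ` ?B"
      then obtain j ts1 ts2 where ts: "ts = sort_key snd (ts1 @ ts2)" and j: "j \<le> m"
        and t: "ts1 \<in> mono_seqs U j" "ts2 \<in> mono_seqs_le (V - U) (m - j) b" by auto
      have "(r \<in> V \<and> s \<in> V \<and> r < s) \<and> s \<le> b \<and> (r \<in> U \<longleftrightarrow> s \<in> U)" if "(r, s) \<in> set ts" for r s
      proof -
        have "(r, s) \<in> set ts1 \<or> (r, s) \<in> set ts2" using that by (simp add: ts)
        then show ?thesis
        proof
          assume "(r, s) \<in> set ts1"
          then have "r \<in> U \<and> s \<in> U \<and> r < s" using t(1) by (auto simp: mono_seqs_def)
          then show ?thesis using V(2) Ub by auto
        next
          assume "(r, s) \<in> set ts2"
          then show ?thesis using t(2) by (auto simp: mono_seqs_le_def mono_seqs_def)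
        qed
      qed
      moreover have "length ts = m" "sorted (map snd ts)"
        using t j by (simp_all add: ts mono_seqs_le_def mono_seqs_def)
      ultimately show "ts \<in> ?A" by (auto simp: mono_seqs_le_def mono_seqs_def)
    qed
  qed
  then have "(\<Sum>ts\<in>?A. case ?f ts of (j, ts1, ts2) \<Rightarrow> h ts1 ts2) = (\<Sum>(j, ts1, ts2)\<in>?B. h ts1 ts2)"
    by (rule sum.reindex_bij_betw)
  also have "\<dots> = (\<Sum>j\<le>m. \<Sum>(ts1, ts2)\<in>mono_seqs U j \<times> mono_seqs_le (V - U) (m - j) b. h ts1 ts2)"
    using fin by (subst sum.Sigma) (auto simp: finite_mono_seqs finite_mono_seqs_le)
  also have "\<dots> = (\<Sum>j\<le>m. \<Sum>ts1\<in>mono_seqs U j. \<Sum>ts2\<in>mono_seqs_le (V - U) (m - j) b. h ts1 ts2)"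
    by (simp add: sum.cartesian_product)
  finally show ?thesis by simp
qed

lemma card_conn_facs:
  assumes "finite V"
  shows "card (conn_facs V \<sigma> m \<mu>) =
    (\<Sum>ts\<in>mono_seqs V m. if conn V \<sigma> ts then card (lab V (tp_prod \<sigma> ts) \<mu>) else 0)"
proof -
  have "conn_facs V \<sigma> m \<mu> =
      (SIGMA ts:mono_seqs V m. {cs. conn V \<sigma> ts \<and> cs \<in> lab V (tp_prod \<sigma> ts) \<mu>})"
    by (auto simp: conn_facs_def)
  then have "card (conn_facs V \<sigma> m \<mu>) =
      (\<Sum>ts\<in>mono_seqs V m. card {cs. conn V \<sigma> ts \<and> cs \<in> lab V (tp_prod \<sigma> ts) \<mu>})"
    using assms by (simp add: finite_mono_seqs finite_lab)
  also have "\<dots> = (\<Sum>ts\<in>mono_seqs V m. if conn V \<sigma> ts then card (lab V (tp_prod \<sigma> ts) \<mu>) else 0)"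
    by (intro sum.cong refl) simp
  finally show ?thesis .
qed

text \<open>Sequence, connectedness and labelling each separate into a part on \<open>U\<close> and
  a part on the complement, so the count is a sum of products; j is the number of transpositions
  inside \<open>U\<close>.\<close>

theorem card_split_facs_eq:
  assumes V: "finite V" and \<sigma>: "\<sigma> permutes V" and U: "U \<subseteq> V" "\<forall>x\<in>V. \<sigma> x \<in> U \<longleftrightarrow> x \<in> U"
    and b: "b \<in> V - U" and Ub: "\<forall>x\<in>U. x \<le> b"
  shows "card (split_facs V \<sigma> m b (\<alpha> # \<nu> @ [\<beta>]) U) =
    (\<Sum>j\<le>m. \<Sum>(I, J)\<in>index_splits (length \<nu>).
      card (conn_facs U (perm_restrict \<sigma> U) j (nths \<nu> I @ [\<beta>])) *
      card (bounded_facs (V - U) (perm_restrict \<sigma> (V - U)) (m - j) b (\<alpha> # nths \<nu> J)))"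
proof -
  let ?\<sigma>1 = "perm_restrict \<sigma> U" and ?\<sigma>2 = "perm_restrict \<sigma> (V - U)"
  let ?f1 = "filter (\<lambda>t. fst t \<in> U)" and ?f2 = "filter (\<lambda>t. fst t \<notin> U)"
  let ?A = "{ts \<in> mono_seqs_le V m b. \<forall>(r, s)\<in>set ts. r \<in> U \<longleftrightarrow> s \<in> U}"
  define h1 where "h1 = (\<lambda>I ts1. if conn U ?\<sigma>1 ts1 then card (lab U (tp_prod ?\<sigma>1 ts1) (nths \<nu> I @ [\<beta>])) else 0)"
  define h2 where "h2 = (\<lambda>J ts2. if conn (V - U) ?\<sigma>2 ts2 then card (marked_lab (V - U) (tp_prod ?\<sigma>2 ts2) b (\<alpha> # nths \<nu> J)) else 0)"
  have fin: "finite U" "finite (V - U)" using V U(1) finite_subset by auto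
  have "split_facs V \<sigma> m b (\<alpha> # \<nu> @ [\<beta>]) U =
      (SIGMA ts:mono_seqs_le V m b. {cs. two_comp V \<sigma> ts U \<and> cs \<in> marked_lab V (tp_prod \<sigma> ts) b (\<alpha> # \<nu> @ [\<beta>]) \<and> last cs \<subseteq> U})"
    using b by (auto simp: split_facs_def)
  then have "card (split_facs V \<sigma> m b (\<alpha> # \<nu> @ [\<beta>]) U) =
      (\<Sum>ts\<in>mono_seqs_le V m b. card {cs. two_comp V \<sigma> ts U \<and> cs \<in> marked_lab V (tp_prod \<sigma> ts) b (\<alpha> # \<nu> @ [\<beta>]) \<and> last cs \<subseteq> U})"
    using V by (simp add: finite_mono_seqs_le finite_marked_lab)
  also have "\<dots> = (\<Sum>ts\<in>?A. card {cs. two_comp V \<sigma> ts U \<and> cs \<in> marked_lab V (tp_prod \<sigma> ts) b (\<alpha> # \<nu> @ [\<beta>]) \<and> last cs \<subseteq> U})"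
  proof (rule sum.mono_neutral_right)
    show "\<forall>ts\<in>mono_seqs_le V m b - ?A. card {cs. two_comp V \<sigma> ts U \<and> cs \<in> marked_lab V (tp_prod \<sigma> ts) b (\<alpha> # \<nu> @ [\<beta>]) \<and> last cs \<subseteq> U} = 0"
    proof
      fix ts assume "ts \<in> mono_seqs_le V m b - ?A"
      then have "\<not> two_comp V \<sigma> ts U" by (auto simp: two_comp_def)
      then show "card {cs. two_comp V \<sigma> ts U \<and> cs \<in> marked_lab V (tp_prod \<sigma> ts) b (\<alpha> # \<nu> @ [\<beta>]) \<and> last cs \<subseteq> U} = 0"
        by simp
    qed
  qed (use V in \<open>auto simp: finite_mono_seqs_le\<close>)
  also have "\<dots> = (\<Sum>ts\<in>?A. \<Sum>(I, J)\<in>index_splits (length \<nu>). h1 I (?f1 ts) * h2 J (?f2 ts))"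
  proof (rule sum.cong[OF refl])
    fix ts assume ts: "ts \<in> ?A"
    then have ts': "set ts \<subseteq> V \<times> V" and sep: "\<forall>(r, s)\<in>set ts. r \<in> U \<longleftrightarrow> s \<in> U"
      by (auto simp: mono_seqs_le_def mono_seqs_def)
    note P = two_comp_parts[OF \<sigma> ts' U sep]
    have tc: "two_comp V \<sigma> ts U \<longleftrightarrow> conn U ?\<sigma>1 (?f1 ts) \<and> conn (V - U) ?\<sigma>2 (?f2 ts)"
      using U sep by (simp add: two_comp_def conn_perm_restrict)
    have "card {cs \<in> marked_lab V (tp_prod \<sigma> ts) b (\<alpha> # \<nu> @ [\<beta>]). last cs \<subseteq> U} =
      (\<Sum>(I, J)\<in>index_splits (length \<nu>). card (lab U (tp_prod ?\<sigma>1 (?f1 ts)) (nths \<nu> I @ [\<beta>])) *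
        card (marked_lab (V - U) (tp_prod ?\<sigma>2 (?f2 ts)) b (\<alpha> # nths \<nu> J)))"
      by (rule card_split_labellings[OF V tp_prod_permutes[OF \<sigma> ts'] U(1)
            tp_prod_permutes[OF P(1,3)] P(5) tp_prod_permutes[OF P(2,4)] P(6) b])
    then show "card {cs. two_comp V \<sigma> ts U \<and> cs \<in> marked_lab V (tp_prod \<sigma> ts) b (\<alpha> # \<nu> @ [\<beta>]) \<and> last cs \<subseteq> U} =
       (\<Sum>(I, J)\<in>index_splits (length \<nu>). h1 I (?f1 ts) * h2 J (?f2 ts))"
      unfolding tc h1_def h2_def
      by (cases "conn U ?\<sigma>1 (?f1 ts)"; cases "conn (V - U) ?\<sigma>2 (?f2 ts)") (simp_all add: case_prod_beta)
  qed
  also have "\<dots> = (\<Sum>j\<le>m. \<Sum>ts1\<in>mono_seqs U j. \<Sum>ts2\<in>mono_seqs_le (V - U) (m - j) b.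
      \<Sum>(I, J)\<in>index_splits (length \<nu>). h1 I ts1 * h2 J ts2)"
    by (rule sum_mono_seqs_split[OF V U(1) Ub])
  also have "\<dots> = (\<Sum>j\<le>m. \<Sum>(I, J)\<in>index_splits (length \<nu>).
      (\<Sum>ts1\<in>mono_seqs U j. h1 I ts1) * (\<Sum>ts2\<in>mono_seqs_le (V - U) (m - j) b. h2 J ts2))"
  proof (rule sum.cong[OF refl])
    fix j
    have "(\<Sum>ts1\<in>mono_seqs U j. \<Sum>ts2\<in>mono_seqs_le (V - U) (m - j) b.
      \<Sum>x\<in>index_splits (length \<nu>). h1 (fst x) ts1 * h2 (snd x) ts2) =
      (\<Sum>ts1\<in>mono_seqs U j. \<Sum>x\<in>index_splits (length \<nu>). \<Sum>ts2\<in>mono_seqs_le (V - U) (m - j) b.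
        h1 (fst x) ts1 * h2 (snd x) ts2)"
      by (intro sum.cong refl sum.swap)
    also have "\<dots> = (\<Sum>x\<in>index_splits (length \<nu>). \<Sum>ts1\<in>mono_seqs U j. \<Sum>ts2\<in>mono_seqs_le (V - U) (m - j) b.
        h1 (fst x) ts1 * h2 (snd x) ts2)"
      by (rule sum.swap)
    finally show "(\<Sum>ts1\<in>mono_seqs U j. \<Sum>ts2\<in>mono_seqs_le (V - U) (m - j) b.
      \<Sum>(I, J)\<in>index_splits (length \<nu>). h1 I ts1 * h2 J ts2) =
      (\<Sum>(I, J)\<in>index_splits (length \<nu>).
      (\<Sum>ts1\<in>mono_seqs U j. h1 I ts1) * (\<Sum>ts2\<in>mono_seqs_le (V - U) (m - j) b. h2 J ts2))"
      by (simp add: case_prod_beta sum_product)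
  qed
  finally show ?thesis
    unfolding card_conn_facs[OF fin(1)] card_bounded_facs[OF fin(2)] h1_def h2_def .
qed

section \<open>Relabelling points\<close>

lemma eqcl_image: "(x, y) \<in> eqcl E \<Longrightarrow> (\<phi> x, \<phi> y) \<in> eqcl (map_prod \<phi> \<phi> ` E)"
proof (induction rule: eqcl_induct)
  case (step y z)
  have "(\<phi> y, \<phi> z) \<in> eqcl (map_prod \<phi> \<phi> ` E)"
    using step(2) eqcl_base[of _ "map_prod \<phi> \<phi> ` E"] eqcl_sym[of "\<phi> z" "\<phi> y"] by force
  then show ?case by (rule eqcl_trans[OF step(3)])
qed simp

lemma eqcl_image_iff:
  assumes "\<And>u v. (u, v) \<in> E \<Longrightarrow> \<psi> (\<phi> u) = u \<and> \<psi> (\<phi> v) = v" "\<psi> (\<phi> x) = x" "\<psi> (\<phi> y) = y"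
  shows "(\<phi> x, \<phi> y) \<in> eqcl (map_prod \<phi> \<phi> ` E) \<longleftrightarrow> (x, y) \<in> eqcl E"
proof
  have "map_prod \<psi> \<psi> ` map_prod \<phi> \<phi> ` E = (\<lambda>e. e) ` E"
    unfolding image_image by (rule image_cong) (use assms(1) in auto)
  then show "(x, y) \<in> eqcl E" if "(\<phi> x, \<phi> y) \<in> eqcl (map_prod \<phi> \<phi> ` E)"
    using eqcl_image[OF that, of \<psi>] assms(2,3) by simp
qed (rule eqcl_image)

text \<open>The order-free part, which is also applied with \<phi> an adjacent transposition or a
  conjugating permutation. Monotone sequences require an increasing \<phi> and follow in
  \<open>mono_relabelling\<close>.\<close>

locale relabelling =
  fixes V :: "nat set" and \<phi> :: "nat \<Rightarrow> nat" and \<sigma> \<sigma>' :: "nat \<Rightarrow> nat"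
  assumes V: "finite V" and \<phi>: "inj_on \<phi> V" and \<sigma>: "\<sigma> permutes V"
    and \<sigma>': "\<sigma>' permutes \<phi> ` V" and conj: "\<And>x. x \<in> V \<Longrightarrow> \<sigma>' (\<phi> x) = \<phi> (\<sigma> x)"
begin

lemma orbit_image: "x \<in> V \<Longrightarrow> orbit \<sigma>' (\<phi> x) = \<phi> ` orbit \<sigma> x"
  by (rule orbit_inverse[symmetric, OF self_in_orbit[OF V \<sigma>]])
     (use conj permutes_orbit_subset[OF \<sigma>] in auto)

lemma cyc_image: "cyc (\<phi> ` V) \<sigma>' = (`) \<phi> ` cyc V \<sigma>"
  unfolding cyc_def image_image by (rule image_cong[OF refl orbit_image])

lemma inj_on_image_cyc: "inj_on ((`) \<phi>) (cyc V \<sigma>)"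
  by (rule inj_on_subset[OF inj_on_image_Pow[OF \<phi>]]) (use cyc_subset[OF \<sigma>] in auto)

lemma card_image_cyc: "A \<in> cyc V \<sigma> \<Longrightarrow> card (\<phi> ` A) = card A"
  using cyc_subset[OF \<sigma>, of A] by (intro card_image inj_on_subset[OF \<phi>])

lemma bij_lab: "bij_betw (map ((`) \<phi>)) (lab V \<sigma> \<mu>) (lab (\<phi> ` V) \<sigma>' \<mu>)"
  unfolding bij_betw_def
proof
  show "inj_on (map ((`) \<phi>)) (lab V \<sigma> \<mu>)"
  proof (rule inj_onI)
    fix cs ds assume *: "cs \<in> lab V \<sigma> \<mu>" "ds \<in> lab V \<sigma> \<mu>" "map ((`) \<phi>) cs = map ((`) \<phi>) ds"
    show "cs = ds"
      using *(3) by (rule map_inj_on) (use * inj_on_image_cyc in \<open>auto simp: lab_def\<close>)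
  qed
  show "map ((`) \<phi>) ` lab V \<sigma> \<mu> = lab (\<phi> ` V) \<sigma>' \<mu>"
  proof (intro equalityI subsetI)
    fix ds assume "ds \<in> map ((`) \<phi>) ` lab V \<sigma> \<mu>"
    then obtain cs where cs: "cs \<in> lab V \<sigma> \<mu>" "ds = map ((`) \<phi>) cs" by blast
    then have "distinct cs" "set cs = cyc V \<sigma>" "map card cs = \<mu>" by (auto simp: lab_def)
    then show "ds \<in> lab (\<phi> ` V) \<sigma>' \<mu>"
      using inj_on_image_cyc card_image_cyc by (auto simp: lab_def cyc_image distinct_map cs(2))
  next
    fix ds assume ds: "ds \<in> lab (\<phi> ` V) \<sigma>' \<mu>"
    let ?\<psi> = "inv_into (cyc V \<sigma>) ((`) \<phi>)"
    let ?cs = "map ?\<psi> ds"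
    have set: "set ds = (`) \<phi> ` cyc V \<sigma>" using ds by (simp add: lab_def cyc_image)
    have e: "map ((`) \<phi>) ?cs = ds"
      unfolding map_map by (rule map_idI) (simp add: set f_inv_into_f)
    have s: "set ?cs = cyc V \<sigma>"
      using inv_into_image_cancel[OF inj_on_image_cyc] set by (simp)
    have d: "distinct ?cs"
      using ds set inj_on_inv_into[of "set ds" "(`) \<phi>" "cyc V \<sigma>"] by (simp add: distinct_map lab_def)
    have "map card (map ((`) \<phi>) cs) = map card cs" if "set cs \<subseteq> cyc V \<sigma>" for cs
      using that card_image_cyc by (induction cs) auto
    from this[of ?cs] have "map card (map ((`) \<phi>) ?cs) = map card ?cs" using s by blast
    then have "map card ?cs = \<mu>" using ds unfolding e by (simp add: lab_def del: map_map)
    then have "?cs \<in> lab V \<sigma> \<mu>" using s d by (simp add: lab_def)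
    then show "ds \<in> map ((`) \<phi>) ` lab V \<sigma> \<mu>" using e by (metis imageI)
  qed
qed

lemma card_lab: "card (lab (\<phi> ` V) \<sigma>' \<mu>) = card (lab V \<sigma> \<mu>)"
  using bij_betw_same_card[OF bij_lab] by simp

lemma card_marked_lab:
  assumes b: "b \<in> V"
  shows "card (marked_lab (\<phi> ` V) \<sigma>' (\<phi> b) (m # \<mu>)) = card (marked_lab V \<sigma> b (m # \<mu>))"
proof -
  have "\<phi> b \<in> hd (map ((`) \<phi>) cs) \<longleftrightarrow> b \<in> hd cs" if cs: "cs \<in> lab V \<sigma> (m # \<mu>)" for cs
  proof -
    obtain c cs' where c: "cs = c # cs'" using cs by (cases cs) (auto simp: lab_def)
    then have "c \<subseteq> V" using cs cyc_subset[OF \<sigma>, of c] by (auto simp: lab_def)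
    then show ?thesis using inj_on_image_mem_iff[OF \<phi> b] c by simp
  qed
  then have "bij_betw (map ((`) \<phi>)) (marked_lab V \<sigma> b (m # \<mu>)) (marked_lab (\<phi> ` V) \<sigma>' (\<phi> b) (m # \<mu>))"
    unfolding marked_lab_def by (rule bij_betw_Collect[OF bij_lab])
  then show ?thesis using bij_betw_same_card by fastforce
qed

abbreviation "rel \<equiv> map (map_prod \<phi> \<phi>)"

lemma tp_prod_rel:
  assumes "set ts \<subseteq> V \<times> V" "x \<in> V"
  shows "tp_prod \<sigma>' (rel ts) (\<phi> x) = \<phi> (tp_prod \<sigma> ts x)"
  using assms(1)
proof (induction ts rule: rev_induct)
  case Nil
  then show ?case using conj assms by simp
next
  case (snoc t ts)
  obtain r s where t: "t = (r, s)" by force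
  have "tp_prod \<sigma> ts x \<in> V"
    using tp_prod_permutes[OF \<sigma>, of ts] snoc.prems assms(2) by (simp add: permutes_in_image)
  then show ?case using snoc t inj_on_eq_iff[OF \<phi>] by (auto simp: transpose_def)
qed

lemma relabelling_tp_prod:
  assumes "set ts \<subseteq> V \<times> V" shows "relabelling V \<phi> (tp_prod \<sigma> ts) (tp_prod \<sigma>' (rel ts))"
proof
  show "tp_prod \<sigma> ts permutes V" by (rule tp_prod_permutes[OF \<sigma> assms])
  show "tp_prod \<sigma>' (rel ts) permutes \<phi> ` V"
    by (rule tp_prod_permutes[OF \<sigma>']) (use assms in auto)
qed (use V \<phi> tp_prod_rel[OF assms] in auto)

lemma conn_rel:
  assumes "set ts \<subseteq> V \<times> V" shows "conn (\<phi> ` V) \<sigma>' (rel ts) \<longleftrightarrow> conn V \<sigma> ts"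
proof -
  let ?\<psi> = "inv_into V \<phi>"
  have "edges (\<phi> ` V) \<sigma>' = map_prod \<phi> \<phi> ` edges V \<sigma>"
    unfolding edges_def image_image by (rule image_cong) (use conj in auto)
  then have E: "edges (\<phi> ` V) \<sigma>' \<union> set (rel ts) = map_prod \<phi> \<phi> ` (edges V \<sigma> \<union> set ts)" by auto
  have "edges V \<sigma> \<union> set ts \<subseteq> V \<times> V" using assms \<sigma> by (auto simp: edges_def permutes_in_image)
  then have "(\<phi> x, \<phi> y) \<in> eqcl (map_prod \<phi> \<phi> ` (edges V \<sigma> \<union> set ts)) \<longleftrightarrow> (x, y) \<in> eqcl (edges V \<sigma> \<union> set ts)"
    if "x \<in> V" "y \<in> V" for x y
    using that \<phi> by (intro eqcl_image_iff[where \<psi> = ?\<psi>]) auto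
  then show ?thesis unfolding conn_def E by simp
qed

end

locale mono_relabelling = relabelling +
  assumes mono: "strict_mono_on V \<phi>"
begin

lemma less_iff: "x \<in> V \<Longrightarrow> y \<in> V \<Longrightarrow> \<phi> x < \<phi> y \<longleftrightarrow> x < y"
  using strict_mono_on_less[OF mono] by blast

lemma le_iff: "x \<in> V \<Longrightarrow> y \<in> V \<Longrightarrow> \<phi> x \<le> \<phi> y \<longleftrightarrow> x \<le> y"
  using strict_mono_on_less_eq[OF mono] by blast

lemma rel_mono_seqs_iff:
  assumes "set ts \<subseteq> V \<times> V" shows "rel ts \<in> mono_seqs (\<phi> ` V) m \<longleftrightarrow> ts \<in> mono_seqs V m"
proof -
  have "sorted (map snd (rel ts)) \<longleftrightarrow> sorted (map snd ts)"
    unfolding sorted_wrt_map map_map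
    by (intro iffI; erule sorted_wrt_mono_rel[rotated]; use assms le_iff in force)
  moreover have "(\<forall>(r, s)\<in>set (rel ts). r \<in> \<phi> ` V \<and> s \<in> \<phi> ` V \<and> r < s) \<longleftrightarrow> (\<forall>(r, s)\<in>set ts. r \<in> V \<and> s \<in> V \<and> r < s)"
    using assms less_iff by fastforce
  ultimately show ?thesis by (simp add: mono_seqs_def)
qed

lemma bij_mono_seqs: "bij_betw rel (mono_seqs V m) (mono_seqs (\<phi> ` V) m)"
  unfolding bij_betw_def
proof
  have inj: "inj_on (map_prod \<phi> \<phi>) (V \<times> V)" using \<phi> by (rule map_prod_inj_on) (rule \<phi>)
  show "inj_on rel (mono_seqs V m)"
  proof (rule inj_onI)
    fix ts us assume *: "ts \<in> mono_seqs V m" "us \<in> mono_seqs V m" "rel ts = rel us"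
    show "ts = us"
      using *(3) by (rule map_inj_on)
        (rule inj_on_subset[OF inj], use *(1,2) mono_seqs_subset in blast)
  qed
  show "rel ` mono_seqs V m = mono_seqs (\<phi> ` V) m"
  proof (intro equalityI subsetI)
    fix us assume us: "us \<in> mono_seqs (\<phi> ` V) m"
    have sub: "set us \<subseteq> map_prod \<phi> \<phi> ` (V \<times> V)" using mono_seqs_subset[OF us] by auto
    let ?ts = "map (inv_into (V \<times> V) (map_prod \<phi> \<phi>)) us"
    have e: "rel ?ts = us"
      unfolding map_map by (rule map_idI) (simp only: o_apply f_inv_into_f[OF subsetD[OF sub]])
    have "set ?ts \<subseteq> V \<times> V" using sub inv_into_into[of _ "map_prod \<phi> \<phi>" "V \<times> V"] by fastforce
    then have "?ts \<in> mono_seqs V m" using rel_mono_seqs_iff us e by metis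
    then show "us \<in> rel ` mono_seqs V m" using e by (metis imageI)
  qed (use rel_mono_seqs_iff mono_seqs_subset in blast)
qed

lemma bij_mono_seqs_le:
  assumes "b \<in> V" shows "bij_betw rel (mono_seqs_le V m b) (mono_seqs_le (\<phi> ` V) m (\<phi> b))"
proof -
  have "(\<forall>(r, s)\<in>set (rel ts). s \<le> \<phi> b) \<longleftrightarrow> (\<forall>(r, s)\<in>set ts. s \<le> b)" if "ts \<in> mono_seqs V m" for ts
    using mono_seqs_subset[OF that] le_iff assms by fastforce
  then show ?thesis unfolding mono_seqs_le_def by (rule bij_betw_Collect[OF bij_mono_seqs])
qed

lemma card_conn_facs_image: "card (conn_facs (\<phi> ` V) \<sigma>' m \<mu>) = card (conn_facs V \<sigma> m \<mu>)"
proof -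
  have fin: "finite (\<phi> ` V)" using V by simp
  show ?thesis
    unfolding card_conn_facs[OF V] card_conn_facs[OF fin] sum.reindex_bij_betw[OF bij_mono_seqs, symmetric]
  proof (rule sum.cong[OF refl])
    fix ts assume "ts \<in> mono_seqs V m"
    then have ts: "set ts \<subseteq> V \<times> V" by (rule mono_seqs_subset)
    interpret P: relabelling V \<phi> "tp_prod \<sigma> ts" "tp_prod \<sigma>' (rel ts)" by (rule relabelling_tp_prod[OF ts])
    show "(if conn (\<phi> ` V) \<sigma>' (rel ts) then card (lab (\<phi> ` V) (tp_prod \<sigma>' (rel ts)) \<mu>) else 0) =
      (if conn V \<sigma> ts then card (lab V (tp_prod \<sigma> ts) \<mu>) else 0)"
      using conn_rel[OF ts] P.card_lab by simp
  qed
qed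

lemma card_bounded_facs_image:
  assumes b: "b \<in> V"
  shows "card (bounded_facs (\<phi> ` V) \<sigma>' m (\<phi> b) (k # \<mu>)) = card (bounded_facs V \<sigma> m b (k # \<mu>))"
proof -
  have fin: "finite (\<phi> ` V)" using V by simp
  show ?thesis
    unfolding card_bounded_facs[OF V] card_bounded_facs[OF fin]
      sum.reindex_bij_betw[OF bij_mono_seqs_le[OF b], symmetric]
  proof (rule sum.cong[OF refl])
    fix ts assume "ts \<in> mono_seqs_le V m b"
    then have ts: "set ts \<subseteq> V \<times> V" using mono_seqs_subset by (auto simp: mono_seqs_le_def)
    interpret P: relabelling V \<phi> "tp_prod \<sigma> ts" "tp_prod \<sigma>' (rel ts)" by (rule relabelling_tp_prod[OF ts])
    show "(if conn (\<phi> ` V) \<sigma>' (rel ts) then card (marked_lab (\<phi> ` V) (tp_prod \<sigma>' (rel ts)) (\<phi> b) (k # \<mu>)) else 0) =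
      (if conn V \<sigma> ts then card (marked_lab V (tp_prod \<sigma> ts) b (k # \<mu>)) else 0)"
      using conn_rel[OF ts] P.card_marked_lab[OF b] by simp
  qed
qed

end

section \<open>Invariance under conjugation\<close>

type_synonym state = "(nat \<Rightarrow> nat) \<times> (nat \<times> nat) set"

text \<open>Closing the relation at every step makes different sequences of transpositions lead to
  equal states, as the commutation relations below demand.\<close>

definition tstep :: "nat \<Rightarrow> nat \<Rightarrow> state \<Rightarrow> state" where
  "tstep r s st = (transpose r s \<circ> fst st, eqcl (insert (r, s) (snd st)))"

definition trun :: "(nat \<times> nat) list \<Rightarrow> state \<Rightarrow> state" where
  "trun ts st = foldl (\<lambda>st (r, s). tstep r s st) st ts"

text \<open>The operator pulls functions back along a step, so in
  \<open>jucys_murphy j (jucys_murphy k \<Phi>)\<close> the state takes the j-step before the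
  k-step.\<close>

definition jucys_murphy :: "nat \<Rightarrow> (state \<Rightarrow> int) \<Rightarrow> state \<Rightarrow> int" where
  "jucys_murphy k \<Phi> st = (\<Sum>r\<in>{1..<k}. \<Phi> (tstep r k st))"

text \<open>The complete homogeneous polynomial of degree m in the first k operators. The separate k
  permits adding variables one at a time.\<close>

definition hom_sum :: "nat \<Rightarrow> nat \<Rightarrow> (state \<Rightarrow> int) \<Rightarrow> state \<Rightarrow> int" where
  "hom_sum k m \<Phi> st = (\<Sum>ts\<in>mono_seqs {1..k} m. \<Phi> (trun ts st))"

lemma eqcl_insert_eqcl: "eqcl (insert e (eqcl X)) = eqcl (insert e X)"
  by (intro equalityI eqcl_subsetI)
     (auto intro: eqcl_base subsetD[OF eqcl_mono, rotated])

lemma eqcl_insert_swap: "eqcl (insert (r, s) X) = eqcl (insert (s, r) X)"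
proof -
  have "eqcl (insert (r, s) X) \<subseteq> eqcl (insert (s, r) X)" for r s
    by (rule eqcl_subsetI) (auto intro: eqcl_base eqcl_sym)
  then show ?thesis by blast
qed

lemma tstep_commute_args: "tstep r s st = tstep s r st"
  by (simp add: tstep_def transpose_commute eqcl_insert_swap[of r s])

text \<open>The two sides agree on permutations by a relation among the transpositions of three
  points, and on relations because any two edges of a triangle generate the third.\<close>

lemma tstep_triangle:
  assumes "a \<noteq> b" "b \<noteq> c" "a \<noteq> c"
  shows "tstep b c (tstep a b st) = tstep c a (tstep b c st)"
proof -
  obtain p E where st: "st = (p, E)" by force
  have "transpose b c \<circ> (transpose a b \<circ> p) = transpose c a \<circ> (transpose b c \<circ> p)"
    using assms by (auto simp: fun_eq_iff transpose_def)
  moreover have "eqcl (insert (b, c) (insert (a, b) E)) = eqcl (insert (c, a) (insert (b, c) E))"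
  proof (intro equalityI eqcl_subsetI)
    have "(c, a) \<in> eqcl (insert (c, a) (insert (b, c) E))" "(b, c) \<in> eqcl (insert (c, a) (insert (b, c) E))"
      by (auto intro: eqcl_base)
    then have "(a, b) \<in> eqcl (insert (c, a) (insert (b, c) E))" using eqcl_sym eqcl_trans by metis
    then show "insert (b, c) (insert (a, b) E) \<subseteq> eqcl (insert (c, a) (insert (b, c) E))"
      by (auto intro: eqcl_base)
    have "(a, b) \<in> eqcl (insert (b, c) (insert (a, b) E))" "(b, c) \<in> eqcl (insert (b, c) (insert (a, b) E))"
      by (auto intro: eqcl_base)
    then have "(c, a) \<in> eqcl (insert (b, c) (insert (a, b) E))" using eqcl_sym eqcl_trans by metis
    then show "insert (c, a) (insert (b, c) E) \<subseteq> eqcl (insert (b, c) (insert (a, b) E))"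
      by (auto intro: eqcl_base)
  qed
  ultimately show ?thesis by (simp add: st tstep_def eqcl_insert_eqcl)
qed

lemma tstep_commute:
  assumes "a \<noteq> c" "a \<noteq> d" "b \<noteq> c" "b \<noteq> d"
  shows "tstep a b (tstep c d st) = tstep c d (tstep a b st)"
proof -
  have "transpose a b \<circ> (transpose c d \<circ> p) = transpose c d \<circ> (transpose a b \<circ> p)" for p :: "nat \<Rightarrow> nat"
    using assms by (auto simp: fun_eq_iff transpose_def)
  then show ?thesis by (simp add: tstep_def eqcl_insert_eqcl insert_commute)
qed

lemma trun_Nil [simp]: "trun [] st = st"
  by (simp add: trun_def)

lemma trun_snoc [simp]: "trun (ts @ [(r, s)]) st = tstep r s (trun ts st)"
  by (simp add: trun_def)

lemma hom_sum_0 [simp]: "hom_sum k 0 \<Phi> = \<Phi>"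
proof -
  have "mono_seqs {1..k} 0 = {[]}" by (auto simp: mono_seqs_def)
  then show ?thesis by (simp add: hom_sum_def fun_eq_iff)
qed

lemma hom_sum_empty [simp]: "hom_sum 0 (Suc m) \<Phi> = (\<lambda>st. 0)"
proof -
  have "mono_seqs {1..0} (Suc m) = {}" by (auto simp: mono_seqs_def) (metis length_0_conv list.set_sel(1) nat.distinct(1) surj_pair)
  then show ?thesis by (simp add: hom_sum_def fun_eq_iff)
qed

text \<open>The identity \<open>h\<^sub>m(x\<^sub>1,...,x\<^sub>k\<^sub>+\<^sub>1) =
  h\<^sub>m(x\<^sub>1,...,x\<^sub>k) + x\<^sub>k\<^sub>+\<^sub>1
  h\<^sub>m\<^sub>-\<^sub>1(x\<^sub>1,...,x\<^sub>k\<^sub>+\<^sub>1)\<close>: a monotone sequence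
  either avoids the largest point or has it in its last pair.\<close>

lemma hom_sum_Suc:
  "hom_sum (Suc k) (Suc m) \<Phi> = (\<lambda>st. hom_sum k (Suc m) \<Phi> st + hom_sum (Suc k) m (jucys_murphy (Suc k) \<Phi>) st)"
proof
  fix st
  let ?A = "mono_seqs {1..k} (Suc m)"
  let ?S = "mono_seqs {1..Suc k} m \<times> {1..<Suc k}"
  let ?f = "\<lambda>(ts, r). ts @ [(r, Suc k)]"
  have le: "mono_seqs_le {1..Suc k} m (Suc k) = mono_seqs {1..Suc k} m"
    by (auto simp: mono_seqs_le_def mono_seqs_def)
  have "mono_seqs {1..Suc k} (Suc m) = ?A \<union> ?f ` ?S"
  proof (intro equalityI subsetI)
    fix us assume us: "us \<in> mono_seqs {1..Suc k} (Suc m)"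
    then obtain ts r s where e: "us = ts @ [(r, s)]"
      by (cases us rule: rev_cases) (auto simp: mono_seqs_def)
    show "us \<in> ?A \<union> ?f ` ?S"
    proof (cases "s = Suc k")
      case True
      then have "ts \<in> mono_seqs {1..Suc k} m" "r \<in> {1..<Suc k}"
        using us by (auto simp: e snoc_mono_seqs_iff mono_seqs_le_def)
      then show ?thesis using e True by force
    next
      case False
      have "s \<le> k" "r < s" using us False by (auto simp: e mono_seqs_def)
      moreover have "\<forall>(r', s')\<in>set ts. s' \<le> s" using us by (auto simp: e mono_seqs_def sorted_append)
      ultimately have "\<forall>(r, s)\<in>set us. r \<in> {1..k} \<and> s \<in> {1..k} \<and> r < s"
        using us by (fastforce simp: e mono_seqs_def)
      then show ?thesis using us by (auto simp: mono_seqs_def)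
    qed
  next
    fix us assume "us \<in> ?A \<union> ?f ` ?S"
    then show "us \<in> mono_seqs {1..Suc k} (Suc m)"
    proof
      assume "us \<in> ?A" then show ?thesis by (fastforce simp: mono_seqs_def)
    next
      assume "us \<in> ?f ` ?S"
      then show ?thesis by (auto simp: snoc_mono_seqs_iff le[simplified])
    qed
  qed
  moreover have "?A \<inter> ?f ` ?S = {}" by (fastforce simp: mono_seqs_def)
  moreover have "inj_on ?f ?S" by (auto simp: inj_on_def)
  ultimately have "hom_sum (Suc k) (Suc m) \<Phi> st = hom_sum k (Suc m) \<Phi> st + (\<Sum>x\<in>?S. \<Phi> (trun (?f x) st))"
    unfolding hom_sum_def by (simp add: sum.union_disjoint finite_mono_seqs sum.reindex)
  also have "(\<Sum>x\<in>?S. \<Phi> (trun (?f x) st)) = hom_sum (Suc k) m (jucys_murphy (Suc k) \<Phi>) st"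
    unfolding hom_sum_def jucys_murphy_def sum.cartesian_product by (rule sum.cong) auto
  finally show "hom_sum (Suc k) (Suc m) \<Phi> st = hom_sum k (Suc m) \<Phi> st + hom_sum (Suc k) m (jucys_murphy (Suc k) \<Phi>) st" .
qed

lemma hom_sum_add: "hom_sum k m (\<lambda>st. \<Phi> st + \<Psi> st) = (\<lambda>st. hom_sum k m \<Phi> st + hom_sum k m \<Psi> st)"
  by (simp add: fun_eq_iff hom_sum_def sum.distrib)

text \<open>
  This is \<open>h\<^sub>m(x\<^sub>1,\<dots>,x\<^sub>k\<^sub>+\<^sub>2) = h\<^sub>m(x\<^sub>1,\<dots>,x\<^sub>k) + (u + v) h\<^sub>m\<^sub>-\<^sub>1 - u v h\<^sub>m\<^sub>-\<^sub>2\<close> for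
  \<open>u = x\<^sub>k\<^sub>+\<^sub>1\<close>, \<open>v = x\<^sub>k\<^sub>+\<^sub>2\<close>: only symmetric functions of \<open>u\<close> and \<open>v\<close> occur.
\<close>
lemma hom_sum_Suc_Suc:
  fixes k \<Phi>
  defines "A \<equiv> jucys_murphy (Suc k)" and "B \<equiv> jucys_murphy (Suc (Suc k))"
  shows "hom_sum (Suc (Suc k)) (Suc (Suc m)) \<Phi> =
    (\<lambda>st. hom_sum k (Suc (Suc m)) \<Phi> st + hom_sum (Suc (Suc k)) (Suc m) (\<lambda>st. A \<Phi> st + B \<Phi> st) st
      - hom_sum (Suc (Suc k)) m (B (A \<Phi>)) st)"
    "hom_sum (Suc (Suc k)) (Suc 0) \<Phi> = (\<lambda>st. hom_sum k (Suc 0) \<Phi> st + (A \<Phi> st + B \<Phi> st))"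
  unfolding A_def B_def hom_sum_add hom_sum_Suc[of "Suc k"] hom_sum_Suc[of k]
  by (simp_all add: fun_eq_iff)

section \<open>Jucys-Murphy operators under conjugation by an adjacent transposition\<close>

definition conj_state :: "nat \<Rightarrow> state \<Rightarrow> state" where
  "conj_state i st = (transpose i (Suc i) \<circ> fst st \<circ> transpose i (Suc i),
     map_prod (transpose i (Suc i)) (transpose i (Suc i)) ` snd st)"

lemma eqcl_image_eq:
  assumes "\<And>x. \<psi> (\<phi> x) = x" "\<And>x. \<phi> (\<psi> x) = x"
  shows "eqcl (map_prod \<phi> \<phi> ` E) = map_prod \<phi> \<phi> ` eqcl E"
proof (intro equalityI subrelI)
  fix x y assume "(x, y) \<in> eqcl (map_prod \<phi> \<phi> ` E)"
  then have "(\<phi> (\<psi> x), \<phi> (\<psi> y)) \<in> eqcl (map_prod \<phi> \<phi> ` E)" using assms by simp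
  then have "(\<psi> x, \<psi> y) \<in> eqcl E" using assms by (subst (asm) eqcl_image_iff[where \<psi> = \<psi>]) auto
  then show "(x, y) \<in> map_prod \<phi> \<phi> ` eqcl E" using assms by (force intro!: rev_image_eqI)
qed (auto intro: eqcl_image)

lemma conj_state_tstep:
  "conj_state i (tstep (transpose i (Suc i) r) (transpose i (Suc i) s) st) = tstep r s (conj_state i st)"
proof -
  let ?t = "transpose i (Suc i)"
  have "?t \<circ> (transpose (?t r) (?t s) \<circ> fst st) \<circ> ?t = transpose r s \<circ> (?t \<circ> fst st \<circ> ?t)"
    by (auto simp: fun_eq_iff transpose_def)
  moreover have "map_prod ?t ?t ` eqcl (insert (?t r, ?t s) (snd st)) = eqcl (insert (r, s) (map_prod ?t ?t ` snd st))"
    by (subst eqcl_image_eq[where \<psi> = ?t, symmetric]) simp_all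
  ultimately show ?thesis by (simp add: conj_state_def tstep_def)
qed

text \<open>The transposition of i and i + 1 fixes k and maps the range below k to itself, so it
  only reorders the sum.\<close>

lemma jucys_murphy_conj_other:
  assumes "k \<noteq> i" "k \<noteq> Suc i" "1 \<le> i"
  shows "jucys_murphy k \<Phi> (conj_state i st) = jucys_murphy k (\<lambda>st. \<Phi> (conj_state i st)) st"
proof -
  let ?t = "transpose i (Suc i)"
  have k: "?t k = k" using assms by (simp add: transpose_def)
  have "bij_betw ?t {1..<k} {1..<k}"
    by (rule bij_betw_byWitness[where f' = ?t]) (use assms in \<open>auto simp: transpose_def\<close>)
  then have "jucys_murphy k (\<lambda>st. \<Phi> (conj_state i st)) st = (\<Sum>r\<in>{1..<k}. \<Phi> (conj_state i (tstep (?t r) k st)))"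
    unfolding jucys_murphy_def by (rule sum.reindex_bij_betw[symmetric])
  also have "\<dots> = jucys_murphy k \<Phi> (conj_state i st)"
    unfolding jucys_murphy_def using conj_state_tstep[of i _ k st] k by simp
  finally show ?thesis by simp
qed

lemma conj_state_tstep_low:
  assumes "r < i"
  shows "tstep r i (conj_state i st) = conj_state i (tstep r (Suc i) st)"
    "tstep r (Suc i) (conj_state i st) = conj_state i (tstep r i st)"
proof -
  have t: "transpose i (Suc i) r = r" using assms by (simp add: transpose_def)
  show "tstep r i (conj_state i st) = conj_state i (tstep r (Suc i) st)"
    "tstep r (Suc i) (conj_state i st) = conj_state i (tstep r i st)"
    using conj_state_tstep[of i r i st] conj_state_tstep[of i r "Suc i" st] t by simp_all
qed

lemma jucys_murphy_Suc:
  "1 \<le> i \<Longrightarrow> jucys_murphy (Suc i) \<Phi> st = (\<Sum>r\<in>{1..<i}. \<Phi> (tstep r (Suc i) st)) + \<Phi> (tstep i (Suc i) st)"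
  by (simp add: jucys_murphy_def)

lemma tstep_i_conj:
  "tstep i (Suc i) (conj_state i st) = conj_state i (tstep i (Suc i) st)"
  using conj_state_tstep[of i i "Suc i" st] tstep_commute_args[of "Suc i" i] by simp

text \<open>For r < i, conjugation exchanges the steps (r i) and (r i+1), and it keeps (i i+1). Each
  operator alone changes, but their sum does not.\<close>

lemma jucys_murphy_add_conj:
  assumes "1 \<le> i"
  shows "jucys_murphy i \<Phi> (conj_state i st) + jucys_murphy (Suc i) \<Phi> (conj_state i st) =
    jucys_murphy i (\<lambda>st. \<Phi> (conj_state i st)) st + jucys_murphy (Suc i) (\<lambda>st. \<Phi> (conj_state i st)) st"
  unfolding jucys_murphy_Suc[OF assms] using assms
  by (simp add: jucys_murphy_def conj_state_tstep_low tstep_i_conj)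

text \<open>After conjugation the product of the operators contains the same steps in another order.
  Steps with different r commute; the terms with equal r and the terms with (i i+1) are exchanged by
  the triangle relation.\<close>

lemma jucys_murphy_mult_conj:
  assumes "1 \<le> i"
  shows "jucys_murphy (Suc i) (jucys_murphy i \<Phi>) (conj_state i st) =
    jucys_murphy (Suc i) (jucys_murphy i (\<lambda>st. \<Phi> (conj_state i st))) st"
proof -
  define \<Psi> where "\<Psi> = (\<lambda>st. \<Phi> (conj_state i st))"
  let ?I = "{1..<i}" and ?x = "\<lambda>r. tstep r i" and ?y = "\<lambda>r. tstep r (Suc i)" and ?t = "tstep i (Suc i)"
  \<comment> \<open>Triangle relations for r, i, i + 1, where \<open>tstep_commute_args\<close>
    absorbs the order of the two points of a step.\<close>
  have tri: "?y r (?t st) = ?t (?x r st)" "?y r (?x r st) = ?x r (?t st)" "?x r (?y r st) = ?t (?x r st)"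
    if "r \<in> ?I" for r st
    using that tstep_triangle[of i "Suc i" r st] tstep_triangle[of "Suc i" r i st] tstep_triangle[of i r "Suc i" st]
      tstep_triangle[of r i "Suc i" st] tstep_triangle[of r "Suc i" i st] tstep_triangle[of "Suc i" i r st]
      tstep_commute_args[of "Suc i" i] tstep_commute_args[of i r] tstep_commute_args[of "Suc i" r]
    by auto
  have comm: "?y r' (?x r st) = ?x r (?y r' st)" if "r \<in> ?I" "r' \<in> ?I" "r \<noteq> r'" for r r' st
    using that by (intro tstep_commute) auto
  have L: "jucys_murphy (Suc i) (jucys_murphy i \<Phi>) (conj_state i st) =
      (\<Sum>r'\<in>?I. \<Sum>r\<in>?I. \<Psi> (?y r (?x r' st))) + (\<Sum>r\<in>?I. \<Psi> (?y r (?t st)))"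
    unfolding jucys_murphy_Suc[OF assms] using assms
    by (simp add: jucys_murphy_def conj_state_tstep_low tstep_i_conj \<Psi>_def)
  have R: "jucys_murphy (Suc i) (jucys_murphy i \<Psi>) st =
      (\<Sum>r'\<in>?I. \<Sum>r\<in>?I. \<Psi> (?x r (?y r' st))) + (\<Sum>r\<in>?I. \<Psi> (?x r (?t st)))"
    unfolding jucys_murphy_Suc[OF assms] by (simp add: jucys_murphy_def)
  \<comment> \<open>Separates off r = r', where the two steps share a point and cannot be
    commuted.\<close>
  have split: "(\<Sum>r'\<in>?I. \<Sum>r\<in>?I. f r r') =
      (\<Sum>r'\<in>?I. \<Sum>r\<in>?I. if r = r' then 0 else f r r') + (\<Sum>r\<in>?I. f r r)" for f :: "nat \<Rightarrow> nat \<Rightarrow> int"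
    unfolding sum.distrib[symmetric]
  proof (rule sum.cong[OF refl])
    fix r' assume r': "r' \<in> ?I"
    have "(\<Sum>r\<in>?I. f r r') = (\<Sum>r\<in>?I. (if r = r' then 0 else f r r') + (if r = r' then f r' r' else 0))"
      by (intro sum.cong) auto
    then show "(\<Sum>r\<in>?I. f r r') = (\<Sum>r\<in>?I. if r = r' then 0 else f r r') + f r' r'"
      using r' by (simp add: sum.distrib)
  qed
  have "(\<Sum>r'\<in>?I. \<Sum>r\<in>?I. if r = r' then 0 else \<Psi> (?y r (?x r' st))) =
      (\<Sum>r'\<in>?I. \<Sum>r\<in>?I. if r = r' then 0 else \<Psi> (?x r' (?y r st)))"
    by (intro sum.cong refl) (auto simp: comm)
  also have "\<dots> = (\<Sum>r'\<in>?I. \<Sum>r\<in>?I. if r = r' then 0 else \<Psi> (?x r (?y r' st)))"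
    by (subst sum.swap) (intro sum.cong refl, auto)
  finally have off: "(\<Sum>r'\<in>?I. \<Sum>r\<in>?I. if r = r' then 0 else \<Psi> (?y r (?x r' st))) =
      (\<Sum>r'\<in>?I. \<Sum>r\<in>?I. if r = r' then 0 else \<Psi> (?x r (?y r' st)))" .
  have "(\<Sum>r\<in>?I. \<Psi> (?y r (?x r st))) = (\<Sum>r\<in>?I. \<Psi> (?x r (?t st)))"
    by (intro sum.cong refl) (simp only: tri)
  moreover have "(\<Sum>r\<in>?I. \<Psi> (?y r (?t st))) = (\<Sum>r\<in>?I. \<Psi> (?x r (?y r st)))"
    by (intro sum.cong refl) (simp only: tri)
  ultimately have "jucys_murphy (Suc i) (jucys_murphy i \<Phi>) (conj_state i st) = jucys_murphy (Suc i) (jucys_murphy i \<Psi>) st"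
    unfolding L R split[of "\<lambda>r r'. \<Psi> (?y r (?x r' st))"] split[of "\<lambda>r r'. \<Psi> (?x r (?y r' st))"] off by simp
  then show ?thesis by (simp add: \<Psi>_def)
qed

definition conj_invariant :: "nat \<Rightarrow> nat \<Rightarrow> bool" where
  "conj_invariant i k \<longleftrightarrow>
     (\<forall>m \<Phi>. (\<lambda>st. hom_sum k m \<Phi> (conj_state i st)) = hom_sum k m (\<lambda>st. \<Phi> (conj_state i st)))"

lemma conj_invariant_Suc:
  assumes "1 \<le> i" "Suc k \<noteq> i" "k \<noteq> i" "conj_invariant i k"
  shows "conj_invariant i (Suc k)"
proof -
  have "(\<lambda>st. hom_sum (Suc k) m \<Phi> (conj_state i st)) = hom_sum (Suc k) m (\<lambda>st. \<Phi> (conj_state i st))" for m \<Phi>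
  proof (induction m arbitrary: \<Phi>)
    case (Suc m)
    have "(\<lambda>st. jucys_murphy (Suc k) \<Phi> (conj_state i st)) = jucys_murphy (Suc k) (\<lambda>st. \<Phi> (conj_state i st))"
      using assms jucys_murphy_conj_other[of "Suc k" i \<Phi>] by auto
    then have "hom_sum (Suc k) m (jucys_murphy (Suc k) \<Phi>) (conj_state i st) =
        hom_sum (Suc k) m (jucys_murphy (Suc k) (\<lambda>st. \<Phi> (conj_state i st))) st" for st
      using fun_cong[OF Suc.IH[of "jucys_murphy (Suc k) \<Phi>"]] by simp
    moreover have "hom_sum k (Suc m) \<Phi> (conj_state i st) = hom_sum k (Suc m) (\<lambda>st. \<Phi> (conj_state i st)) st" for st
      using fun_cong[OF assms(4)[unfolded conj_invariant_def, rule_format]] .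
    ultimately show ?case unfolding hom_sum_Suc by simp
  qed simp
  then show ?thesis by (simp add: conj_invariant_def)
qed

text \<open>Two operators are added at once: with only the first of them present, conjugation would
  exchange it with an operator that does not occur. By \<open>hom_sum_Suc_Suc\<close> only their sum
  and their product have to be invariant.\<close>

lemma conj_invariant_Suc_Suc:
  assumes "conj_invariant (Suc k) k" shows "conj_invariant (Suc k) (Suc (Suc k))"
proof -
  let ?c = "conj_state (Suc k)"
  let ?A = "jucys_murphy (Suc k)" and ?B = "jucys_murphy (Suc (Suc k))"
  have K: "hom_sum k m \<Phi> (?c st) = hom_sum k m (\<lambda>st. \<Phi> (?c st)) st" for m \<Phi> st
    using assms unfolding conj_invariant_def fun_eq_iff by blast
  have add: "?A \<Phi> (?c st) + ?B \<Phi> (?c st) = ?A (\<lambda>st. \<Phi> (?c st)) st + ?B (\<lambda>st. \<Phi> (?c st)) st" for \<Phi> st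
    by (rule jucys_murphy_add_conj) simp
  have mult: "?B (?A \<Phi>) (?c st) = ?B (?A (\<lambda>st. \<Phi> (?c st))) st" for \<Phi> st
    by (rule jucys_murphy_mult_conj) simp
  have "hom_sum (Suc (Suc k)) m \<Phi> (?c st) = hom_sum (Suc (Suc k)) m (\<lambda>st. \<Phi> (?c st)) st" for m \<Phi> st
  proof (induction m arbitrary: \<Phi> st rule: less_induct)
    case (less m)
    consider "m = 0" | "m = Suc 0" | n where "m = Suc (Suc n)" by (metis nat.exhaust)
    then show ?case
    proof cases
      case 2
      show ?thesis unfolding 2 hom_sum_Suc_Suc(2) by (simp only: K add)
    next
      case (3 n)
      have "n < m" "Suc n < m" using 3 by auto
      note IH = less.IH[OF this(1)] less.IH[OF this(2)]
      show ?thesis unfolding 3 hom_sum_Suc_Suc(1) by (simp only: K IH add mult)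
    qed simp
  qed
  then show ?thesis by (simp add: conj_invariant_def fun_eq_iff)
qed

text \<open>Below i neither of the exchanged operators is present, from i + 1 on both are; the value
  i in between is jumped over.\<close>

lemma conj_invariant:
  assumes "1 \<le> i" "Suc i \<le> d" shows "conj_invariant i d"
proof -
  have low: "k < i \<Longrightarrow> conj_invariant i k" for k
  proof (induction k)
    case 0
    have "(\<lambda>st. hom_sum 0 m \<Phi> (conj_state i st)) = hom_sum 0 m (\<lambda>st. \<Phi> (conj_state i st))" for m \<Phi>
      by (cases m) simp_all
    then show ?case by (simp add: conj_invariant_def)
  qed (use assms(1) conj_invariant_Suc in simp)
  obtain k where k: "i = Suc k" using assms(1) by (cases i) auto
  have "conj_invariant i (Suc i)" using conj_invariant_Suc_Suc low[of k] k by simp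
  with assms(2) show ?thesis
  proof (induction rule: dec_induct)
    case (step n)
    then show ?case using assms(1) by (intro conj_invariant_Suc) auto
  qed simp
qed

section \<open>From adjacent transpositions to all conjugating permutations\<close>

text \<open>Taking \<open>eqcl\<close> here allows the initial state to carry the bare edges of
  \<sigma>. The guard on the permutation makes the function invariant on all states, as an identity
  between operators requires.\<close>

definition count_state :: "nat set \<Rightarrow> nat list \<Rightarrow> state \<Rightarrow> int" where
  "count_state V \<mu> st = (if fst st permutes V \<and> (\<forall>x\<in>V. \<forall>y\<in>V. (x, y) \<in> eqcl (snd st))
     then int (card (lab V (fst st) \<mu>)) else 0)"

lemma count_state_conj:
  assumes "1 \<le> i" "Suc i \<le> d"
  shows "count_state {1..d} \<mu> (conj_state i st) = count_state {1..d} \<mu> st"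
proof -
  let ?t = "transpose i (Suc i)" and ?V = "{1..d}"
  obtain p E where st: "st = (p, E)" by force
  have t: "?t permutes ?V" using assms by (intro permutes_swap_id) auto
  have tV: "?t ` ?V = ?V" by (rule permutes_image[OF t])
  have conn: "(\<forall>x\<in>?V. \<forall>y\<in>?V. (x, y) \<in> eqcl (map_prod ?t ?t ` E)) \<longleftrightarrow> (\<forall>x\<in>?V. \<forall>y\<in>?V. (x, y) \<in> eqcl E)"
  proof -
    have "(\<forall>x\<in>?t ` ?V. \<forall>y\<in>?t ` ?V. (x, y) \<in> eqcl (map_prod ?t ?t ` E)) \<longleftrightarrow> (\<forall>x\<in>?V. \<forall>y\<in>?V. (x, y) \<in> eqcl E)"
      unfolding ball_simps by (subst eqcl_image_iff[where \<psi> = ?t]) simp_all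
    then show ?thesis unfolding tV .
  qed
  have perm: "?t \<circ> p \<circ> ?t permutes ?V" if "p permutes ?V" for p
    using that t by (intro permutes_compose)
  have perm_iff: "?t \<circ> p \<circ> ?t permutes ?V \<longleftrightarrow> p permutes ?V"
  proof
    assume "?t \<circ> p \<circ> ?t permutes ?V"
    from perm[OF this] show "p permutes ?V" by (simp add: comp_def)
  qed (rule perm)
  have "card (lab ?V (?t \<circ> p \<circ> ?t) \<mu>) = card (lab ?V p \<mu>)" if p: "p permutes ?V"
  proof -
    interpret relabelling ?V ?t p "?t \<circ> p \<circ> ?t"
      by unfold_locales (use p perm[OF p] tV permutes_inj_on[OF t] in auto)
    show ?thesis using card_lab[of \<mu>] unfolding tV .
  qed
  then show ?thesis unfolding st count_state_def conj_state_def fst_conv snd_conv perm_iff conn by auto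
qed

lemma trun_eq:
  "fst (trun ts (p, E)) = tp_prod p ts \<and> eqcl (snd (trun ts (p, E))) = eqcl (E \<union> set ts)"
proof (induction ts rule: rev_induct)
  case (snoc t ts)
  obtain r s where t: "t = (r, s)" by force
  have "eqcl (eqcl X) = eqcl X" for X :: "(nat \<times> nat) set"
    by (intro equalityI eqcl_subsetI) (auto intro: eqcl_base subsetD[OF eqcl_mono, rotated])
  moreover have "eqcl (insert e (snd (trun ts (p, E)))) = eqcl (insert e (E \<union> set ts))" for e
    using eqcl_insert_eqcl snoc by metis
  ultimately show ?case using snoc by (simp add: t tstep_def)
qed simp

lemma card_conn_facs_eq_hom_sum:
  assumes "\<sigma> permutes {1..d}"
  shows "int (card (conn_facs {1..d} \<sigma> m \<mu>)) = hom_sum d m (count_state {1..d} \<mu>) (\<sigma>, edges {1..d} \<sigma>)"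
proof -
  have "int (card (conn_facs {1..d} \<sigma> m \<mu>)) =
      (\<Sum>ts\<in>mono_seqs {1..d} m. int (if conn {1..d} \<sigma> ts then card (lab {1..d} (tp_prod \<sigma> ts) \<mu>) else 0))"
    by (subst card_conn_facs) simp_all
  also have "\<dots> = hom_sum d m (count_state {1..d} \<mu>) (\<sigma>, edges {1..d} \<sigma>)"
    unfolding hom_sum_def
  proof (rule sum.cong[OF refl])
    fix ts assume "ts \<in> mono_seqs {1..d} m"
    then have "tp_prod \<sigma> ts permutes {1..d}" by (intro tp_prod_permutes[OF assms] mono_seqs_subset)
    then show "int (if conn {1..d} \<sigma> ts then card (lab {1..d} (tp_prod \<sigma> ts) \<mu>) else 0) =
      count_state {1..d} \<mu> (trun ts (\<sigma>, edges {1..d} \<sigma>))"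
      by (simp add: count_state_def trun_eq conn_def)
  qed
  finally show ?thesis .
qed

lemma card_conn_facs_adjacent:
  assumes \<sigma>: "\<sigma> permutes {1..d}" and i: "1 \<le> i" "Suc i \<le> d"
  defines "t \<equiv> transpose i (Suc i)"
  shows "card (conn_facs {1..d} (t \<circ> \<sigma> \<circ> t) m \<mu>) = card (conn_facs {1..d} \<sigma> m \<mu>)"
proof -
  let ?V = "{1..d}"
  have t: "t permutes ?V" unfolding t_def using i by (intro permutes_swap_id) auto
  have p: "t \<circ> \<sigma> \<circ> t permutes ?V" using \<sigma> t by (intro permutes_compose)
  have "edges ?V (t \<circ> \<sigma> \<circ> t) = edges (t ` ?V) (t \<circ> \<sigma> \<circ> t)" by (simp only: permutes_image[OF t])
  also have "\<dots> = map_prod t t ` edges ?V \<sigma>"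
    unfolding edges_def image_image by (intro image_cong refl) (simp add: t_def)
  finally have c: "(t \<circ> \<sigma> \<circ> t, edges ?V (t \<circ> \<sigma> \<circ> t)) = conj_state i (\<sigma>, edges ?V \<sigma>)"
    by (simp add: conj_state_def t_def)
  have "hom_sum d m (count_state ?V \<mu>) (conj_state i (\<sigma>, edges ?V \<sigma>)) =
      hom_sum d m (\<lambda>st. count_state ?V \<mu> (conj_state i st)) (\<sigma>, edges ?V \<sigma>)"
    using conj_invariant[OF i] unfolding conj_invariant_def fun_eq_iff by blast
  also have "(\<lambda>st. count_state ?V \<mu> (conj_state i st)) = count_state ?V \<mu>"
    using count_state_conj[OF i] by blast
  finally have "int (card (conn_facs ?V (t \<circ> \<sigma> \<circ> t) m \<mu>)) = int (card (conn_facs ?V \<sigma> m \<mu>))"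
    unfolding card_conn_facs_eq_hom_sum[OF p] card_conn_facs_eq_hom_sum[OF \<sigma>] c .
  then show ?thesis by simp
qed

text \<open>The conjugating permutations \<tau> for which the claim holds are closed under
  composition. They contain the adjacent transpositions, hence all transpositions, hence all
  permutations of the interval.\<close>

theorem card_conn_facs_conj:
  assumes "\<tau> permutes {1..d}" "\<sigma> permutes {1..d}" "\<sigma>' permutes {1..d}" "\<tau> \<circ> \<sigma> = \<sigma>' \<circ> \<tau>"
  shows "card (conn_facs {1..d} \<sigma>' m \<mu>) = card (conn_facs {1..d} \<sigma> m \<mu>)"
proof -
  define f where "f \<sigma> = card (conn_facs {1..d} \<sigma> m \<mu>)" for \<sigma>
  define adm where "adm \<tau> \<longleftrightarrow> (\<forall>\<sigma> \<sigma>'. \<sigma> permutes {1..d} \<longrightarrow> \<sigma>' permutes {1..d} \<longrightarrow> \<tau> \<circ> \<sigma> = \<sigma>' \<circ> \<tau> \<longrightarrow> f \<sigma>' = f \<sigma>)"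
    for \<tau> :: "nat \<Rightarrow> nat"
  have comp: "adm (t \<circ> \<tau>)" if "adm t" "adm \<tau>" "\<tau> permutes {1..d}" for t \<tau>
    unfolding adm_def
  proof (intro allI impI)
    fix \<sigma> \<sigma>' assume s: "\<sigma> permutes {1..d}" "\<sigma>' permutes {1..d}" "(t \<circ> \<tau>) \<circ> \<sigma> = \<sigma>' \<circ> (t \<circ> \<tau>)"
    \<comment> \<open>The intermediate conjugate, reached by \<tau> and left by t.\<close>
    let ?\<rho> = "\<tau> \<circ> \<sigma> \<circ> inv' \<tau>"
    have \<rho>: "?\<rho> permutes {1..d}" using s(1) that(3) by (intro permutes_compose permutes_inv)
    have 1: "\<tau> \<circ> \<sigma> = ?\<rho> \<circ> \<tau>" by (simp add: comp_assoc permutes_inv_o[OF that(3)])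
    have "t \<circ> ?\<rho> = (t \<circ> \<tau> \<circ> \<sigma>) \<circ> inv' \<tau>" by (simp add: comp_assoc)
    also have "\<dots> = \<sigma>' \<circ> t \<circ> (\<tau> \<circ> inv' \<tau>)" unfolding s(3) by (simp add: comp_assoc)
    finally have 2: "t \<circ> ?\<rho> = \<sigma>' \<circ> t" by (simp add: permutes_inv_o[OF that(3)])
    have "f \<sigma>' = f ?\<rho>" using that(1) \<rho> s(2) 2 unfolding adm_def by blast
    also have "\<dots> = f \<sigma>" using that(2) s(1) \<rho> 1 unfolding adm_def by blast
    finally show "f \<sigma>' = f \<sigma>" .
  qed
  have adj: "adm (transpose i (Suc i))" if "1 \<le> i" "Suc i \<le> d" for i
    unfolding adm_def
  proof (intro allI impI)
    fix \<sigma> \<sigma>' assume s: "\<sigma> permutes {1..d}" "\<sigma>' permutes {1..d}"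
      "transpose i (Suc i) \<circ> \<sigma> = \<sigma>' \<circ> transpose i (Suc i)"
    have "\<sigma>' = (\<sigma>' \<circ> transpose i (Suc i)) \<circ> transpose i (Suc i)" by (simp add: comp_assoc)
    then have "\<sigma>' = transpose i (Suc i) \<circ> \<sigma> \<circ> transpose i (Suc i)" unfolding s(3)[symmetric] .
    then show "f \<sigma>' = f \<sigma>" unfolding f_def using card_conn_facs_adjacent[OF s(1) that] by simp
  qed
  have tp: "transpose i j permutes {1..d}" if "i \<in> {1..d}" "j \<in> {1..d}" for i j
    using that by (rule permutes_swap_id)
  have tr: "adm (transpose i j)" if "1 \<le> i" "Suc i \<le> j" "j \<le> d" for i j
    using that(2,3)
  proof (induction rule: dec_induct)
    case base
    then show ?case using adj that by simp
  next
    case (step j)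
    let ?a = "transpose j (Suc j)"
    have "transpose i (Suc j) = ?a \<circ> (transpose i j \<circ> ?a)"
      using step.hyps by (auto simp: fun_eq_iff transpose_def)
    moreover have "adm ?a" using step.prems step.hyps by (intro adj) auto
    moreover have "adm (transpose i j)" using step by simp
    moreover have "i \<in> {1..d}" "j \<in> {1..d}" "Suc j \<in> {1..d}"
      using step.prems step.hyps that(1) by auto
    then have "?a permutes {1..d}" "transpose i j permutes {1..d}" by (simp_all only: tp)
    ultimately show ?case using comp permutes_compose by metis
  qed
  have tr': "adm (transpose i j)" if "i \<in> {1..d}" "j \<in> {1..d}" "i \<noteq> j" for i j
    using that tr[of i j] tr[of j i] by (cases "i < j") (auto simp: transpose_commute)
  have id: "adm id" by (auto simp: adm_def)
  have "adm \<tau>"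
    using assms(1) finite_atLeastAtMost[of 1 d]
  proof (induction rule: permutes_induct)
    case (swap a b p)
    then show ?case using comp[OF tr'] by blast
  qed (rule id)
  then show ?thesis using assms(2-4) unfolding adm_def f_def by blast
qed

section \<open>Permutations with all cycles of equal length\<close>

text \<open>Coordinates for all that follows: block number q and position j, both counted from 0,
  while points start at 1.\<close>

lemma block_decomp:
  assumes "x \<in> {1..a * k :: nat}"
  obtains q j where "q < k" "j < a" "x = Suc (a * q + j)"
proof -
  have a: "0 < a" using assms by (cases a) auto
  let ?q = "(x - 1) div a" and ?j = "(x - 1) mod a"
  have "x - 1 < a * k" using assms by auto
  then have "?q < k" using a by (simp add: less_mult_imp_div_less mult.commute)
  moreover have "?j < a" using a by simp
  moreover have "x = Suc (a * ?q + ?j)" using assms by simp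
  ultimately show ?thesis using that by blast
qed

lemma block_mem:
  assumes "q < k" "j < a" shows "Suc (a * q + j) \<in> {1..a * k :: nat}"
proof -
  have "a * q + j < a * Suc q" using assms by simp
  also have "\<dots> \<le> a * k" using assms by (intro mult_le_mono2) simp
  finally show ?thesis by simp
qed

lemma block_eq_iff:
  assumes "j < a" "j' < a" shows "a * q + j = a * q' + j' \<longleftrightarrow> q = q' \<and> j = (j' :: nat)"
proof
  assume e: "a * q + j = a * q' + j'"
  have "(a * q + j) div a = q" "(a * q' + j') div a = q'" using assms by (simp_all add: div_mult_self4)
  then have "q = q'" using e by simp
  then show "q = q' \<and> j = j'" using e by simp
qed simp

lemma standard_perm_block:
  assumes "q < k" "j < a"
  shows "standard_perm a (a * k) (Suc (a * q + j)) = Suc (a * q + Suc j mod a)"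
proof -
  have "a dvd Suc (a * q + j) \<longleftrightarrow> a dvd Suc j"
    using dvd_add_right_iff[of a "a * q" "Suc j"] by simp
  also have "\<dots> \<longleftrightarrow> Suc j = a" using assms(2) by (auto dest: dvd_imp_le)
  finally show ?thesis
    using block_mem[OF assms] assms(2) by (auto simp: standard_perm_def mod_Suc)
qed

lemma standard_perm_permutes: "standard_perm a (a * k) permutes {1..a * k}"
proof (rule bij_imp_permutes)
  let ?s = "standard_perm a (a * k)" and ?V = "{1..a * k}"
  have "?V \<subseteq> ?s ` ?V"
  proof
    fix x assume "x \<in> ?V"
    then obtain q j where q: "q < k" "j < a" "x = Suc (a * q + j)" by (rule block_decomp)
    show "x \<in> ?s ` ?V"
    \<comment> \<open>The preimage is the cyclically preceding point of the block.\<close>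
    proof (cases j)
      case 0
      have "?s (Suc (a * q + (a - 1))) = x"
        using q by (subst standard_perm_block) (auto simp: 0)
      from sym[OF this] show ?thesis by (rule image_eqI[OF _ block_mem]) (use q in auto)
    next
      case (Suc i)
      have "?s (Suc (a * q + i)) = x"
        using q by (subst standard_perm_block) (auto simp: Suc)
      from sym[OF this] show ?thesis by (rule image_eqI[OF _ block_mem]) (use q Suc in auto)
    qed
  qed
  moreover have "card (?s ` ?V) \<le> card ?V" by (rule card_image_le) simp
  ultimately have "?s ` ?V = ?V" using card_seteq[of "?s ` ?V" ?V] by simp
  then show "bij_betw ?s ?V ?V" by (simp add: bij_betw_def eq_card_imp_inj_on)
qed (auto simp: standard_perm_def)

lemma standard_perm_funpow:
  assumes "q < k" "j < a"
  shows "(standard_perm a (a * k) ^^ i) (Suc (a * q + j)) = Suc (a * q + (j + i) mod a)"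
proof (induction i)
  case (Suc i)
  have "(j + i) mod a < a" using assms by simp
  then show ?case using Suc standard_perm_block[OF assms(1)] by (simp add: mod_Suc_eq)
qed (use assms in simp)

lemma standard_perm_orbit:
  assumes "q < k" "j < a"
  shows "orbit (standard_perm a (a * k)) (Suc (a * q + j)) = (\<lambda>i. Suc (a * q + i)) ` {..<a}"
proof -
  let ?s = "standard_perm a (a * k)"
  have "orbit ?s (Suc (a * q + j)) = orbit ?s (Suc (a * q))"
  proof -
    have a: "0 < a" using assms by simp
    have "Suc (a * q + j) = (?s ^^ j) (Suc (a * q))"
      using standard_perm_funpow[OF assms(1) a, of j] assms by simp
    then have "Suc (a * q + j) \<in> orbit ?s (Suc (a * q))"
      using funpow_in_orbit[OF self_in_orbit[OF _ standard_perm_permutes]] by simp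
    then show ?thesis by (rule orbit_eq_if_mem[OF _ standard_perm_permutes, rotated]) simp
  qed
  also have "\<dots> = {(?s ^^ i) (Suc (a * q)) |i. i < a}"
    using standard_perm_funpow[OF assms(1), of 0 a a] assms(2) by (intro orbit_altdef_bounded; simp)
  also have "\<dots> = {Suc (a * q + i) |i. i < a}"
  proof -
    have "(?s ^^ i) (Suc (a * q)) = Suc (a * q + i)" if "i < a" for i
      using standard_perm_funpow[OF assms(1), of 0 a i] that assms by simp
    then show ?thesis by (intro Collect_cong) metis
  qed
  finally show ?thesis by auto
qed

lemma card_standard_perm_orbit:
  assumes "A \<in> cyc {1..a * k} (standard_perm a (a * k))" shows "card A = a"
proof -
  obtain x where x: "x \<in> {1..a * k}" "A = orbit (standard_perm a (a * k)) x" using assms by (auto simp: cyc_def)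
  obtain q j where q: "q < k" "j < a" "x = Suc (a * q + j)" using x(1) by (rule block_decomp)
  show ?thesis unfolding x(2) q(3) standard_perm_orbit[OF q(1,2)] by (subst card_image) (auto simp: inj_on_def)
qed

lemma card_cyc_uniform:
  assumes "finite V" "\<sigma> permutes V" "\<forall>A\<in>cyc V \<sigma>. card A = a"
  shows "card V = a * card (cyc V \<sigma>)"
proof -
  have "(\<Sum>A\<in>cyc V \<sigma>. card A) = (\<Sum>A\<in>cyc V \<sigma>. a)" using assms(3) by (intro sum.cong) auto
  then show ?thesis using sum_card_cyc[OF assms(1,2)] by (simp add: mult.commute)
qed

section \<open>Counting conjugating permutations\<close>

text \<open>For j equal to the number of cycles, these are the possible images of the first points
  of the blocks under a conjugating permutation.\<close>

definition transversals :: "nat set \<Rightarrow> (nat \<Rightarrow> nat) \<Rightarrow> nat \<Rightarrow> nat list set" where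
  "transversals V \<sigma> j = {xs. length xs = j \<and> set xs \<subseteq> V \<and> distinct (map (orbit \<sigma>) xs)}"

text \<open>Each point already chosen excludes its cycle of a points. When no cycle is left, the
  difference is 0.\<close>

lemma card_transversals:
  assumes V: "finite V" and \<sigma>: "\<sigma> permutes V" and a: "\<forall>A\<in>cyc V \<sigma>. card A = a"
  shows "card (transversals V \<sigma> j) = (\<Prod>i<j. card V - a * i)"
proof (induction j)
  case 0
  have "transversals V \<sigma> 0 = {[]}" by (auto simp: transversals_def)
  then show ?case by simp
next
  case (Suc j)
  let ?S = "SIGMA xs:transversals V \<sigma> j. V - \<Union>(orbit \<sigma> ` set xs)"
  have fin: "finite (transversals V \<sigma> j)"
    by (rule finite_subset[OF _ finite_lists_length_eq[OF V, of j]]) (auto simp: transversals_def)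
  have "bij_betw (\<lambda>(xs, x). x # xs) ?S (transversals V \<sigma> (Suc j))"
    unfolding bij_betw_def
  proof
    show "inj_on (\<lambda>(xs, x). x # xs) ?S" by (auto simp: inj_on_def)
    have mem: "orbit \<sigma> x \<in> orbit \<sigma> ` set xs \<longleftrightarrow> x \<in> \<Union>(orbit \<sigma> ` set xs)" for x xs
      using orbit_eq_iff[OF V \<sigma>] by auto
    show "(\<lambda>(xs, x). x # xs) ` ?S = transversals V \<sigma> (Suc j)"
    proof (intro equalityI subsetI)
      fix ys assume "ys \<in> transversals V \<sigma> (Suc j)"
      then obtain x xs where "ys = x # xs" "xs \<in> transversals V \<sigma> j" "x \<in> V" "orbit \<sigma> x \<notin> orbit \<sigma> ` set xs"
        by (cases ys) (auto simp: transversals_def)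
      then show "ys \<in> (\<lambda>(xs, x). x # xs) ` ?S" unfolding mem by force
    next
      fix ys assume "ys \<in> (\<lambda>(xs, x). x # xs) ` ?S"
      then obtain x xs where "ys = x # xs" "xs \<in> transversals V \<sigma> j" "x \<in> V" "x \<notin> \<Union>(orbit \<sigma> ` set xs)"
        by auto
      then show "ys \<in> transversals V \<sigma> (Suc j)" unfolding mem[symmetric] by (simp add: transversals_def)
    qed
  qed
  then have "card (transversals V \<sigma> (Suc j)) = card ?S" using bij_betw_same_card by metis
  also have "\<dots> = (\<Sum>xs\<in>transversals V \<sigma> j. card (V - \<Union>(orbit \<sigma> ` set xs)))"
    using fin V by (intro card_SigmaI) auto
  also have "\<dots> = (\<Sum>xs\<in>transversals V \<sigma> j. card V - a * j)"
  proof (rule sum.cong[OF refl])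
    fix xs assume xs: "xs \<in> transversals V \<sigma> j"
    then have sub: "orbit \<sigma> ` set xs \<subseteq> cyc V \<sigma>" by (auto simp: transversals_def cyc_def)
    have "card (\<Union>(orbit \<sigma> ` set xs)) = (\<Sum>A\<in>orbit \<sigma> ` set xs. card A)"
    proof (rule card_Union_disjoint)
      show "pairwise disjnt (orbit \<sigma> ` set xs)"
        using cyc_eqI[OF V \<sigma>] sub unfolding pairwise_def disjnt_def by blast
      show "finite A" if "A \<in> orbit \<sigma> ` set xs" for A
        using that sub cyc_subset[OF \<sigma>, of A] by (intro finite_subset[OF _ V]) auto
    qed
    also have "\<dots> = (\<Sum>A\<in>orbit \<sigma> ` set xs. a)" using a sub by (intro sum.cong) auto
    also have "\<dots> = a * j"
    proof -
      have "card (orbit \<sigma> ` set xs) = j"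
        using xs distinct_card[of "map (orbit \<sigma>) xs"] by (simp add: transversals_def)
      then show ?thesis by simp
    qed
    finally have "card (\<Union>(orbit \<sigma> ` set xs)) = a * j" .
    then show "card (V - \<Union>(orbit \<sigma> ` set xs)) = card V - a * j"
    proof -
      have "\<Union>(orbit \<sigma> ` set xs) \<subseteq> V" using sub cyc_subset[OF \<sigma>] by blast
      then show ?thesis
        using card_Diff_subset[OF finite_subset[OF _ V]] \<open>card (\<Union>(orbit \<sigma> ` set xs)) = a * j\<close> by metis
    qed
  qed
  finally show ?case using Suc by simp
qed

definition conjugators :: "nat \<Rightarrow> nat \<Rightarrow> (nat \<Rightarrow> nat) \<Rightarrow> (nat \<Rightarrow> nat) set" where
  "conjugators a k \<sigma> = {h. h permutes {1..a * k} \<and> h \<circ> standard_perm a (a * k) = \<sigma> \<circ> h}"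

lemma funpow_intertwine: "h \<circ> s = \<sigma> \<circ> h \<Longrightarrow> h ((s ^^ i) x) = (\<sigma> ^^ i) (h x)"
  by (induction i) (auto simp: fun_eq_iff)

text \<open>A conjugating permutation commutes with taking iterates, so the images of the first
  points of the blocks determine it. They can form any transversal, and the product of a (k - i)
  over i < k is \<open>a ^ k * fact k\<close>, the order of the centraliser.\<close>

lemma card_conjugators:
  assumes \<sigma>: "\<sigma> permutes {1..a * k}" and cyc: "\<forall>A\<in>cyc {1..a * k} \<sigma>. card A = a" and a: "0 < a"
  shows "card (conjugators a k \<sigma>) = a ^ k * fact k"
proof -
  let ?V = "{1..a * k}" and ?s = "standard_perm a (a * k)"
  let ?f = "\<lambda>h. map (\<lambda>q. h (Suc (a * q))) [0..<k]"
  have V: "finite ?V" by simp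
  have k: "card (cyc ?V \<sigma>) = k" using card_cyc_uniform[OF V \<sigma> cyc] a by simp
  have s: "h (Suc (a * q + j)) = (\<sigma> ^^ j) (h (Suc (a * q)))"
    if "h \<in> conjugators a k \<sigma>" "q < k" "j < a" for h q j
    using funpow_intertwine[of h ?s \<sigma> j "Suc (a * q)"] standard_perm_funpow[of q k 0 a j] that a
    by (simp add: conjugators_def)
  have "bij_betw ?f (conjugators a k \<sigma>) (transversals ?V \<sigma> k)"
    unfolding bij_betw_def
  proof
    show "inj_on ?f (conjugators a k \<sigma>)"
    proof (rule inj_onI)
      fix h h' assume h: "h \<in> conjugators a k \<sigma>" and h': "h' \<in> conjugators a k \<sigma>" and e: "?f h = ?f h'"
      have e': "h (Suc (a * q)) = h' (Suc (a * q))" if "q < k" for q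
        using arg_cong[OF e, of "\<lambda>xs. xs ! q"] that by simp
      show "h = h'"
      proof
        fix x show "h x = h' x"
        proof (cases "x \<in> ?V")
          case True
          then obtain q j where "q < k" "j < a" "x = Suc (a * q + j)" by (rule block_decomp)
          then show ?thesis using s[OF h] s[OF h'] e' by simp
        next
          case False
          then show ?thesis
            using h h' permutes_not_in[of h ?V x] permutes_not_in[of h' ?V x] by (auto simp: conjugators_def)
        qed
      qed
    qed
    show "?f ` conjugators a k \<sigma> = transversals ?V \<sigma> k"
    proof (intro equalityI subsetI)
      fix xs assume "xs \<in> ?f ` conjugators a k \<sigma>"
      then obtain h where h: "h \<in> conjugators a k \<sigma>" and xs: "xs = ?f h" by blast
      have hV: "h permutes ?V" using h by (simp add: conjugators_def)
      have mem: "Suc (a * q) \<in> ?V" if "q < k" for q using block_mem[OF that a] by simp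
      have "inj_on (\<lambda>q. orbit \<sigma> (h (Suc (a * q)))) {..<k}"
      proof (rule inj_onI)
        fix q q' assume q: "q \<in> {..<k}" "q' \<in> {..<k}" and e: "orbit \<sigma> (h (Suc (a * q))) = orbit \<sigma> (h (Suc (a * q')))"
        have "h (Suc (a * q)) \<in> orbit \<sigma> (h (Suc (a * q')))" using e self_in_orbit[OF V \<sigma>] by metis
        moreover have "q' < k" using q by simp
        then have "h (Suc (a * q')) \<in> ?V" using mem permutes_in_image[OF hV] by blast
        then have "card (orbit \<sigma> (h (Suc (a * q')))) = a" using cyc by (auto simp: cyc_def)
        ultimately obtain j where "j < a" "h (Suc (a * q)) = (\<sigma> ^^ j) (h (Suc (a * q')))"
          using funpow_card_orbit(3)[OF V \<sigma>, of "h (Suc (a * q'))"] by auto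
        then have "h (Suc (a * q)) = h (Suc (a * q' + j))" using s[OF h] q by simp
        then have "a * q + 0 = a * q' + j" using permutes_inj[OF hV] by (simp add: inj_eq)
        then show "q = q'" using block_eq_iff[of 0 a j] \<open>j < a\<close> a by simp
      qed
      then have "distinct (map (orbit \<sigma>) xs)" by (simp add: xs distinct_map comp_def lessThan_atLeast0)
      moreover have "set xs \<subseteq> ?V"
      proof
        fix y assume "y \<in> set xs"
        then obtain q where "q < k" "y = h (Suc (a * q))" by (auto simp: xs)
        then show "y \<in> ?V" using mem permutes_in_image[OF hV] by blast
      qed
      ultimately show "xs \<in> transversals ?V \<sigma> k" by (simp add: transversals_def xs)
    next
      fix xs assume "xs \<in> transversals ?V \<sigma> k"
      then have xs: "length xs = k" "set xs \<subseteq> ?V" "distinct (map (orbit \<sigma>) xs)" by (auto simp: transversals_def)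
      \<comment> \<open>The only possible extension: position j of block q goes to the j-th iterate
        of the q-th chosen point.\<close>
      define h where "h x = (if x \<in> ?V then (\<sigma> ^^ ((x - 1) mod a)) (xs ! ((x - 1) div a)) else x)" for x
      have hb: "h (Suc (a * q + j)) = (\<sigma> ^^ j) (xs ! q)" if "q < k" "j < a" for q j
        using block_mem[OF that] that by (simp add: h_def)
      have xV: "xs ! q \<in> ?V" if "q < k" for q using xs that nth_mem by blast
      have orb: "card (orbit \<sigma> (xs ! q)) = a" if "q < k" for q using xV[OF that] cyc by (auto simp: cyc_def)
      have cov: "orbit \<sigma> ` set xs = cyc ?V \<sigma>"
      proof (rule card_subset_eq)
        show "orbit \<sigma> ` set xs \<subseteq> cyc ?V \<sigma>" using xs(2) by (auto simp: cyc_def)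
        show "card (orbit \<sigma> ` set xs) = card (cyc ?V \<sigma>)" using distinct_card[OF xs(3)] xs(1) k by simp
      qed simp
      have "?V \<subseteq> h ` ?V"
      proof
        fix y assume "y \<in> ?V"
        then have "orbit \<sigma> y \<in> orbit \<sigma> ` set xs" unfolding cov by (simp add: cyc_def del: atLeastAtMost_iff)
        then obtain q where q: "q < k" "orbit \<sigma> y = orbit \<sigma> (xs ! q)" using xs(1) by (auto simp: in_set_conv_nth)
        then have "y \<in> orbit \<sigma> (xs ! q)" using self_in_orbit[OF V \<sigma>] by metis
        then obtain j where j: "j < a" "y = (\<sigma> ^^ j) (xs ! q)"
          using funpow_card_orbit(3)[OF V \<sigma>, of "xs ! q"] orb[OF q(1)] by auto
        then show "y \<in> h ` ?V" using hb[OF q(1) j(1)] block_mem[OF q(1) j(1)] by (metis imageI)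
      qed
      moreover have "card (h ` ?V) \<le> card ?V" by (rule card_image_le) simp
      ultimately have "h ` ?V = ?V" using card_seteq[of "h ` ?V" ?V] by simp
      then have "bij_betw h ?V ?V" by (simp add: bij_betw_def eq_card_imp_inj_on)
      then have hV: "h permutes ?V" by (rule bij_imp_permutes) (auto simp: h_def)
      have "h \<circ> ?s = \<sigma> \<circ> h"
      proof
        fix x show "(h \<circ> ?s) x = (\<sigma> \<circ> h) x"
        proof (cases "x \<in> ?V")
          case True
          then obtain q j where q: "q < k" "j < a" "x = Suc (a * q + j)" by (rule block_decomp)
          \<comment> \<open>The wrap-around at the end of a block is respected because the cycle of
            \<open>xs ! q\<close> has length a.\<close>
          have "(\<sigma> ^^ (Suc j mod a)) (xs ! q) = (\<sigma> ^^ Suc j) (xs ! q)"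
            using funpow_card_orbit(1)[OF V \<sigma>, of "xs ! q"] orb[OF q(1)] by (intro funpow_mod_eq) simp
          then show ?thesis using q a by (simp add: standard_perm_block hb)
        next
          case False
          then show ?thesis by (simp add: permutes_not_in[OF hV] permutes_not_in[OF \<sigma>] permutes_not_in[OF standard_perm_permutes])
        qed
      qed
      then have "h \<in> conjugators a k \<sigma>" using hV by (simp add: conjugators_def)
      moreover have "?f h = xs"
        by (rule nth_equalityI) (use xs(1) hb[of _ 0] a in auto)
      ultimately show "xs \<in> ?f ` conjugators a k \<sigma>" by (metis imageI)
    qed
  qed
  then have "card (conjugators a k \<sigma>) = (\<Prod>i<k. a * k - a * i)"
    using bij_betw_same_card card_transversals[OF V \<sigma> cyc, of k] by fastforce
  also have "\<dots> = (\<Prod>i<k. a * (k - i))" by (simp add: right_diff_distrib')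
  also have "\<dots> = a ^ k * fact k" by (simp add: prod.distrib fact_prod_rev lessThan_atLeast0)
  finally show ?thesis .
qed

definition uniform_perms :: "nat \<Rightarrow> nat \<Rightarrow> (nat \<Rightarrow> nat) set" where
  "uniform_perms a d = {\<sigma>. \<sigma> permutes {1..d} \<and> (\<forall>A\<in>cyc {1..d} \<sigma>. card A = a)}"

lemma finite_uniform_perms: "finite (uniform_perms a d)"
  unfolding uniform_perms_def using finite_permutations[of "{1..d}"] by simp

text \<open>The orbit-stabiliser argument in multiplicative form: pairs of \<sigma> and a
  permutation conjugating the standard one to \<sigma> are counted in two ways.\<close>

theorem sum_uniform_perms:
  fixes f :: "(nat \<Rightarrow> nat) \<Rightarrow> nat"
  assumes a: "0 < a"
    and f: "\<And>h \<sigma>. h permutes {1..a * k} \<Longrightarrow> \<sigma> permutes {1..a * k} \<Longrightarrow>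
      h \<circ> standard_perm a (a * k) = \<sigma> \<circ> h \<Longrightarrow> f \<sigma> = f (standard_perm a (a * k))"
  shows "(\<Sum>\<sigma>\<in>uniform_perms a (a * k). f \<sigma>) * (a ^ k * fact k) = fact (a * k) * f (standard_perm a (a * k))"
proof -
  let ?V = "{1..a * k}" and ?s = "standard_perm a (a * k)" and ?C = "uniform_perms a (a * k)"
  have fin: "finite (conjugators a k \<sigma>)" for \<sigma>
    by (rule finite_subset[OF _ finite_permutations[of ?V]]) (auto simp: conjugators_def)
  have "(\<Sum>\<sigma>\<in>?C. f \<sigma>) * (a ^ k * fact k) = (\<Sum>\<sigma>\<in>?C. \<Sum>h\<in>conjugators a k \<sigma>. f \<sigma>)"
    unfolding sum_distrib_right
    by (intro sum.cong refl) (use card_conjugators[OF _ _ a] in \<open>simp add: uniform_perms_def\<close>)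
  also have "\<dots> = (\<Sum>\<sigma>\<in>?C. \<Sum>h\<in>conjugators a k \<sigma>. f ?s)"
  proof (intro sum.cong refl)
    fix \<sigma> h assume "\<sigma> \<in> ?C" "h \<in> conjugators a k \<sigma>"
    then show "f \<sigma> = f ?s" using f[of h \<sigma>] by (simp add: uniform_perms_def conjugators_def)
  qed
  also have "\<dots> = card (SIGMA \<sigma>:?C. conjugators a k \<sigma>) * f ?s"
    using fin finite_uniform_perms by (simp add: card_SigmaI sum_distrib_right)
  \<comment> \<open>Every permutation h occurs with exactly one \<sigma>, the conjugate of the
    standard permutation by h.\<close>
  also have "card (SIGMA \<sigma>:?C. conjugators a k \<sigma>) = card {h. h permutes ?V}"
  proof (rule bij_betw_same_card)
    show "bij_betw snd (SIGMA \<sigma>:?C. conjugators a k \<sigma>) {h. h permutes ?V}"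
      unfolding bij_betw_def
    proof
      show "inj_on snd (SIGMA \<sigma>:?C. conjugators a k \<sigma>)"
      proof (rule inj_onI)
        fix x y assume x: "x \<in> (SIGMA \<sigma>:?C. conjugators a k \<sigma>)" and y: "y \<in> (SIGMA \<sigma>:?C. conjugators a k \<sigma>)"
          and e: "snd x = snd y"
        have "fst x \<circ> snd x = fst y \<circ> snd x" using x y e by (auto simp: conjugators_def)
        moreover have "snd x permutes ?V" using x by (auto simp: conjugators_def)
        ultimately have "fst x = fst y" using permutes_surj[of "snd x" ?V]
          by (auto simp: fun_eq_iff) (metis surjD)
        then show "x = y" using e by (rule prod_eqI)
      qed
      show "snd ` (SIGMA \<sigma>:?C. conjugators a k \<sigma>) = {h. h permutes ?V}"
      proof (intro equalityI subsetI)
        fix h assume "h \<in> {h. h permutes ?V}"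
        then have h: "h permutes ?V" by simp
        let ?\<sigma> = "h \<circ> ?s \<circ> inv' h"
        have hsh: "?\<sigma> permutes ?V"
          using h standard_perm_permutes by (intro permutes_compose permutes_inv)
        have e: "h \<circ> ?s = ?\<sigma> \<circ> h" by (simp add: comp_assoc permutes_inv_o[OF h])
        interpret relabelling ?V h ?s ?\<sigma>
        proof
          show "?\<sigma> permutes h ` ?V" unfolding permutes_image[OF h] by (rule hsh)
        qed (simp_all add: standard_perm_permutes[of a k, simplified] permutes_inj_on[OF h] permutes_inverses[OF h])
        have "cyc ?V ?\<sigma> = (`) h ` cyc ?V ?s" using cyc_image unfolding permutes_image[OF h] .
        then have "\<forall>A\<in>cyc ?V ?\<sigma>. card A = a"
          using card_image_cyc card_standard_perm_orbit by auto
        then have "?\<sigma> \<in> ?C" unfolding uniform_perms_def using hsh by blast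
        moreover have "h \<in> conjugators a k ?\<sigma>" unfolding conjugators_def using h e by blast
        ultimately have "(?\<sigma>, h) \<in> (SIGMA \<sigma>:?C. conjugators a k \<sigma>)" by blast
        then show "h \<in> snd ` (SIGMA \<sigma>:?C. conjugators a k \<sigma>)" by force
      qed (auto simp: conjugators_def)
    qed
  qed
  also have "card {h. h permutes ?V} = fact (a * k)" by (rule card_permutations) auto
  finally show ?thesis .
qed

section \<open>Unions of blocks\<close>

definition blocks :: "nat \<Rightarrow> nat set \<Rightarrow> nat set" where
  "blocks a K = (\<Union>q\<in>K. (\<lambda>i. Suc (a * q + i)) ` {..<a})"

lemma blocksE:
  assumes "x \<in> blocks a K" obtains q j where "q \<in> K" "j < a" "x = Suc (a * q + j)"
  using assms by (auto simp: blocks_def)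

lemma mem_blocks:
  assumes "j < a" shows "Suc (a * q + j) \<in> blocks a K \<longleftrightarrow> q \<in> K"
proof
  assume "Suc (a * q + j) \<in> blocks a K"
  then obtain q' j' where q': "q' \<in> K" "j' < a" "Suc (a * q + j) = Suc (a * q' + j')" by (rule blocksE)
  then have "q = q'" using block_eq_iff[OF assms q'(2), of q q'] by simp
  then show "q \<in> K" using q' by simp
qed (use assms in \<open>auto simp: blocks_def\<close>)

lemma blocks_subset:
  assumes "K \<subseteq> {..<k}" shows "blocks a K \<subseteq> {1..a * k}"
proof
  fix x assume "x \<in> blocks a K"
  then obtain q j where "q \<in> K" "j < a" "x = Suc (a * q + j)" by (rule blocksE)
  then show "x \<in> {1..a * k}" using block_mem[of q k j a] assms by blast
qed

lemma blocks_compl: "{1..a * k} - blocks a K = blocks a ({..<k} - K)"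
proof (intro equalityI subsetI)
  fix x assume x: "x \<in> {1..a * k} - blocks a K"
  then have "x \<in> {1..a * k}" by blast
  then obtain q j where "q < k" "j < a" "x = Suc (a * q + j)" by (rule block_decomp)
  then show "x \<in> blocks a ({..<k} - K)" using x mem_blocks by auto
next
  fix x assume "x \<in> blocks a ({..<k} - K)"
  then obtain q j where q: "q \<in> {..<k} - K" "j < a" "x = Suc (a * q + j)" by (rule blocksE)
  then have "x \<in> {1..a * k}" using block_mem[of q k j a] by blast
  then show "x \<in> {1..a * k} - blocks a K" using q mem_blocks by blast
qed

lemma blocks_invariant:
  assumes "K \<subseteq> {..<k}" "x \<in> {1..a * k}"
  shows "standard_perm a (a * k) x \<in> blocks a K \<longleftrightarrow> x \<in> blocks a K"
proof -
  obtain q j where q: "q < k" "j < a" "x = Suc (a * q + j)" using assms(2) by (rule block_decomp)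
  have "Suc j mod a < a" using q by simp
  then show ?thesis unfolding q(3) standard_perm_block[OF q(1,2)]
    by (simp only: mem_blocks[OF q(2)] mem_blocks)
qed

text \<open>The permutation sweeps a block from its first point, so an invariant set contains a
  block as soon as it contains that point, and misses it otherwise.\<close>

lemma invariant_imp_blocks:
  assumes a: "0 < a" and U: "U \<subseteq> {1..a * k}" "\<forall>x\<in>{1..a * k}. standard_perm a (a * k) x \<in> U \<longleftrightarrow> x \<in> U"
  shows "\<exists>K\<subseteq>{..<k}. U = blocks a K"
proof -
  define K where "K = {q. q < k \<and> Suc (a * q) \<in> U}"
  have *: "Suc (a * q + j) \<in> U \<longleftrightarrow> q \<in> K" if "q < k" "j < a" for q j
    using that(2)
  proof (induction j)
    case 0
    then show ?case using that by (simp add: K_def)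
  next
    case (Suc j)
    have "Suc (a * q + Suc j) = standard_perm a (a * k) (Suc (a * q + j))"
      using standard_perm_block[of q k j a] that(1) Suc.prems by simp
    then show ?case using U(2) block_mem[of q k j a] that(1) Suc by auto
  qed
  have "U = blocks a K"
  proof (intro equalityI subsetI)
    fix x assume "x \<in> U"
    moreover then have "x \<in> {1..a * k}" using U by blast
    then obtain q j where "q < k" "j < a" "x = Suc (a * q + j)" by (rule block_decomp)
    ultimately show "x \<in> blocks a K" using * mem_blocks by blast
  next
    fix x assume "x \<in> blocks a K"
    then obtain q j where "q \<in> K" "j < a" "x = Suc (a * q + j)" by (rule blocksE)
    then show "x \<in> U" using * by (simp add: K_def)
  qed
  moreover have "K \<subseteq> {..<k}" by (auto simp: K_def)
  ultimately show ?thesis by blast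
qed

text \<open>The increasing enumeration of \<open>K\<close> is applied to block numbers and positions
  are kept. If the last block belongs to the union, it is the image of the last block, so base
  points correspond; this is the third property.\<close>

lemma blocks_relabelling:
  assumes a: "0 < a" and K: "K \<subseteq> {..<k}"
  obtains \<phi> where
    "mono_relabelling {1..a * card K} \<phi> (standard_perm a (a * card K)) (perm_restrict (standard_perm a (a * k)) (blocks a K))"
    "\<phi> ` {1..a * card K} = blocks a K"
    "\<And>j. k - 1 \<in> K \<Longrightarrow> j < a \<Longrightarrow> \<phi> (Suc (a * (card K - 1) + j)) = Suc (a * (k - 1) + j)"
proof -
  let ?k = "card K" and ?s = "standard_perm a (a * k)"
  let ?V = "{1..a * ?k}"
  have "finite K" using K finite_subset by blast
  then obtain h where h: "bij_betw h {..<?k} K" "strict_mono_on {..<?k} h"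
    using ex_bij_betw_strict_mono_card by blast
  have hK: "h q \<in> K" if "q < ?k" for q using bij_betwE[OF h(1)] that by auto
  define \<phi> where "\<phi> x = Suc (a * h ((x - 1) div a) + (x - 1) mod a)" for x
  have \<phi>: "\<phi> (Suc (a * q + j)) = Suc (a * h q + j)" if "j < a" for q j
    using that by (simp add: \<phi>_def)
  have im: "\<phi> ` ?V = blocks a K"
  proof (intro equalityI subsetI)
    fix y assume "y \<in> \<phi> ` ?V"
    then obtain x where x: "x \<in> ?V" "y = \<phi> x" by blast
    obtain q j where q: "q < ?k" "j < a" "x = Suc (a * q + j)" using x(1) by (rule block_decomp)
    then show "y \<in> blocks a K" using x(2) \<phi> mem_blocks hK by simp
  next
    fix y assume "y \<in> blocks a K"
    then obtain q j where q: "q \<in> K" "j < a" "y = Suc (a * q + j)" by (rule blocksE)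
    then obtain p where p: "p < ?k" "q = h p" using bij_betw_imp_surj_on[OF h(1)] by auto
    have "y = \<phi> (Suc (a * p + j))" using \<phi> q p by simp
    then show "y \<in> \<phi> ` ?V" using block_mem[OF p(1) q(2)] by blast
  qed
  have mono: "strict_mono_on ?V \<phi>"
  proof (rule strict_mono_onI)
    fix x y assume xy: "x \<in> ?V" "y \<in> ?V" "x < y"
    obtain q j where q: "q < ?k" "j < a" "x = Suc (a * q + j)" using xy(1) by (rule block_decomp)
    obtain q' j' where q': "q' < ?k" "j' < a" "y = Suc (a * q' + j')" using xy(2) by (rule block_decomp)
    have lt: "a * u + v < a * u' + v'" if "u < u'" "v < a" for u u' v v' :: nat
    proof -
      have "a * u + v < a * Suc u" using that by simp
      also have "\<dots> \<le> a * u'" using that by (intro mult_le_mono2) simp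
      finally show ?thesis by simp
    qed
    have "q \<le> q'" using lt[of q' q j' j] xy(3) q q' by (metis Suc_less_eq not_le_imp_less not_less_iff_gr_or_eq)
    show "\<phi> x < \<phi> y"
    proof (cases "q = q'")
      case True
      then show ?thesis using xy(3) q q' \<phi> by simp
    next
      case False
      then have "h q < h q'" using strict_mono_onD[OF h(2), of q q'] \<open>q \<le> q'\<close> q q' by simp
      then show ?thesis using lt[of "h q" "h q'" j j'] q q' \<phi> by simp
    qed
  qed
  have "mono_relabelling ?V \<phi> (standard_perm a (a * ?k)) (perm_restrict ?s (blocks a K))"
  proof
    show "inj_on \<phi> ?V" using mono by (rule strict_mono_on_imp_inj_on)
    show "standard_perm a (a * ?k) permutes ?V" by (rule standard_perm_permutes)
    show "perm_restrict ?s (blocks a K) permutes \<phi> ` ?V" unfolding im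
      by (rule perm_restrict_permutes[OF standard_perm_permutes blocks_subset[OF K]])
         (use blocks_invariant[OF K] in blast)
    show "strict_mono_on ?V \<phi>" by (rule mono)
    fix x assume "x \<in> ?V"
    then obtain q j where q: "q < ?k" "j < a" "x = Suc (a * q + j)" by (rule block_decomp)
    have hq: "h q < k" using hK[OF q(1)] K by auto
    have "Suc (a * h q + j) \<in> blocks a K" using mem_blocks[OF q(2)] hK[OF q(1)] by simp
    then show "perm_restrict ?s (blocks a K) (\<phi> x) = \<phi> (standard_perm a (a * ?k) x)"
      using q hq a by (simp add: \<phi> standard_perm_block perm_restrict_def)
  qed simp
  moreover have "\<phi> (Suc (a * (?k - 1) + j)) = Suc (a * (k - 1) + j)" if kK: "k - 1 \<in> K" and j: "j < a" for j
  proof -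
    have "k - 1 \<in> h ` {..<?k}" using bij_betw_imp_surj_on[OF h(1)] kK by simp
    then obtain p where p: "p < ?k" "h p = k - 1" by (metis imageE lessThan_iff)
    have "p = ?k - 1"
    proof (rule ccontr)
      assume "p \<noteq> ?k - 1"
      then have "h p < h (?k - 1)" using strict_mono_onD[OF h(2), of p "?k - 1"] p by auto
      moreover have "h (?k - 1) < k" using hK[of "?k - 1"] p K by auto
      ultimately show False using p by simp
    qed
    then show ?thesis using \<phi>[OF j] p by simp
  qed
  ultimately show ?thesis using that im by blast
qed

section \<open>Counts for the standard permutation\<close>

definition conn_count :: "nat \<Rightarrow> nat \<Rightarrow> nat \<Rightarrow> nat list \<Rightarrow> nat" where
  "conn_count a k m \<mu> = card (conn_facs {1..a * k} (standard_perm a (a * k)) m \<mu>)"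

definition bounded_count :: "nat \<Rightarrow> nat \<Rightarrow> nat \<Rightarrow> nat \<Rightarrow> nat \<Rightarrow> nat list \<Rightarrow> nat" where
  "bounded_count a k m l c \<nu> =
     card (bounded_facs {1..a * k} (standard_perm a (a * k)) m (a * k - a + l) (c # \<nu>))"

definition last_count :: "nat \<Rightarrow> nat \<Rightarrow> nat \<Rightarrow> nat \<Rightarrow> nat \<Rightarrow> nat list \<Rightarrow> nat" where
  "last_count a k m l c \<nu> =
     card (last_facs {1..a * k} (standard_perm a (a * k)) m (a * k - a + l) (c # \<nu>))"

lemma last_block_eq:
  assumes "0 < k" "1 \<le> l" shows "a * k - a + l = Suc (a * (k - 1) + (l - 1 :: nat))"
  using assms by (cases k) auto

lemma card_conn_facs_blocks:
  assumes "0 < a" "K \<subseteq> {..<k}"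
  shows "card (conn_facs (blocks a K) (perm_restrict (standard_perm a (a * k)) (blocks a K)) m \<mu>) =
    conn_count a (card K) m \<mu>"
proof -
  obtain \<phi> where \<phi>: "mono_relabelling {1..a * card K} \<phi> (standard_perm a (a * card K)) (perm_restrict (standard_perm a (a * k)) (blocks a K))"
    "\<phi> ` {1..a * card K} = blocks a K" using blocks_relabelling[OF assms] by metis
  show ?thesis
    using mono_relabelling.card_conn_facs_image[OF \<phi>(1)] unfolding \<phi>(2) conn_count_def .
qed

lemma card_bounded_facs_blocks:
  assumes "0 < a" "K \<subseteq> {..<k}" "k - 1 \<in> K" "1 \<le> l" "l \<le> a"
  shows "card (bounded_facs (blocks a K) (perm_restrict (standard_perm a (a * k)) (blocks a K)) m (a * k - a + l) (c # \<nu>)) =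
    bounded_count a (card K) m l c \<nu>"
proof -
  obtain \<phi> where \<phi>: "mono_relabelling {1..a * card K} \<phi> (standard_perm a (a * card K)) (perm_restrict (standard_perm a (a * k)) (blocks a K))"
    "\<phi> ` {1..a * card K} = blocks a K"
    "\<And>j. k - 1 \<in> K \<Longrightarrow> j < a \<Longrightarrow> \<phi> (Suc (a * (card K - 1) + j)) = Suc (a * (k - 1) + j)"
    using blocks_relabelling[OF assms(1,2)] by blast
  have "finite K" using assms(2) finite_subset by blast
  then have k: "0 < card K" "0 < k" using assms(2,3) by (auto simp: card_gt_0_iff)
  have b: "\<phi> (a * card K - a + l) = a * k - a + l"
    using \<phi>(3)[OF assms(3), of "l - 1"] assms(4,5) last_block_eq[OF k(1) assms(4)] last_block_eq[OF k(2) assms(4)]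
    by simp
  have "a * card K - a + l \<in> {1..a * card K}"
    using assms(4,5) k by (cases "card K") auto
  from mono_relabelling.card_bounded_facs_image[OF \<phi>(1) this] show ?thesis
    unfolding \<phi>(2) bounded_count_def b .
qed

lemma sum_Pow_card:
  fixes F :: "nat \<Rightarrow> nat"
  assumes "finite A"
  shows "(\<Sum>K\<in>Pow A. F (card K)) = (\<Sum>i\<le>card A. (card A choose i) * F i)"
proof -
  have "(\<Sum>K\<in>Pow A. F (card K)) = (\<Sum>i\<le>card A. \<Sum>K\<in>{K \<in> Pow A. card K = i}. F (card K))"
    using assms by (intro sum.group[symmetric]) (auto intro: card_mono)
  also have "\<dots> = (\<Sum>i\<le>card A. (card A choose i) * F i)"
    using n_subsets[OF assms] by (intro sum.cong refl) simp
  finally show ?thesis .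
qed

text \<open>A component \<open>U\<close> is invariant under the standard permutation, hence a union
  of blocks, and it omits b, hence the last block. After relabelling, the summand depends only on
  the number i of its blocks, so each value occurs \<open>k - 1 choose i\<close> times.\<close>

theorem sum_split_facs:
  assumes a: "0 < a" and k: "0 < k" and l: "1 \<le> l" "l \<le> a"
  shows "(\<Sum>U\<in>Pow {1..a * k}. card (split_facs {1..a * k} (standard_perm a (a * k)) m (a * k - a + l) (\<alpha> # \<nu> @ [\<beta>]) U)) =
    (\<Sum>i\<le>k - 1. (k - 1 choose i) * (\<Sum>j\<le>m. \<Sum>(I, J)\<in>index_splits (length \<nu>).
      conn_count a i j (nths \<nu> I @ [\<beta>]) * bounded_count a (k - i) (m - j) l \<alpha> (nths \<nu> J)))"
proof -
  let ?V = "{1..a * k}" and ?s = "standard_perm a (a * k)" and ?b = "a * k - a + l"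
  let ?g = "\<lambda>U. card (split_facs ?V ?s m ?b (\<alpha> # \<nu> @ [\<beta>]) U)"
  have b: "?b = Suc (a * (k - 1) + (l - 1))" by (rule last_block_eq[OF k l(1)])
  have bV: "?b \<in> ?V" unfolding b using k l by (intro block_mem) auto
  have b_mem: "?b \<in> blocks a K \<longleftrightarrow> k - 1 \<in> K" for K unfolding b using l by (intro mem_blocks) auto
  have inj: "inj_on (blocks a) (Pow {..<k - 1})"
  proof (rule inj_onI)
    fix K K' assume e: "blocks a K = blocks a K'"
    show "K = K'" using mem_blocks[OF a, of _ K] mem_blocks[OF a, of _ K'] e by auto
  qed
  have "(\<Sum>U\<in>Pow ?V. ?g U) = (\<Sum>U\<in>blocks a ` Pow {..<k - 1}. ?g U)"
  proof (rule sum.mono_neutral_right)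
    show "blocks a ` Pow {..<k - 1} \<subseteq> Pow ?V"
    proof (intro subsetI, elim imageE)
      fix U K assume "K \<in> Pow {..<k - 1}" "U = blocks a K"
      moreover from this have "K \<subseteq> {..<k}" by auto
      ultimately show "U \<in> Pow ?V" using blocks_subset by blast
    qed
    show "\<forall>U\<in>Pow ?V - blocks a ` Pow {..<k - 1}. ?g U = 0"
    proof
      fix U assume U: "U \<in> Pow ?V - blocks a ` Pow {..<k - 1}"
      have "split_facs ?V ?s m ?b (\<alpha> # \<nu> @ [\<beta>]) U = {}"
      proof (rule ccontr)
        assume "split_facs ?V ?s m ?b (\<alpha> # \<nu> @ [\<beta>]) U \<noteq> {}"
        then have U': "\<forall>x\<in>?V. ?s x \<in> U \<longleftrightarrow> x \<in> U" "?b \<notin> U" by (auto simp: split_facs_def two_comp_def)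
        then obtain K where K: "K \<subseteq> {..<k}" "U = blocks a K" using invariant_imp_blocks[OF a _ U'(1)] U by auto
        have nK: "k - 1 \<notin> K" using b_mem U'(2) K(2) by blast
        have "K \<subseteq> {..<k - 1}"
        proof
          fix q assume "q \<in> K"
          then have "q < k" "q \<noteq> k - 1" using K(1) nK by auto
          then show "q \<in> {..<k - 1}" by simp
        qed
        then show False using U K(2) by blast
      qed
      then show "?g U = 0" by simp
    qed
  qed simp
  also have "\<dots> = (\<Sum>K\<in>Pow {..<k - 1}. ?g (blocks a K))" using inj by (simp add: sum.reindex)
  also have "\<dots> = (\<Sum>K\<in>Pow {..<k - 1}. \<Sum>j\<le>m. \<Sum>(I, J)\<in>index_splits (length \<nu>).
      conn_count a (card K) j (nths \<nu> I @ [\<beta>]) * bounded_count a (k - card K) (m - j) l \<alpha> (nths \<nu> J))"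
  proof (rule sum.cong[OF refl])
    fix K assume "K \<in> Pow {..<k - 1}"
    then have K1: "K \<subseteq> {..<k - 1}" by simp
    then have K: "K \<subseteq> {..<k}" and nK: "k - 1 \<notin> K" by auto
    let ?K' = "{..<k} - K"
    have K': "?K' \<subseteq> {..<k}" "k - 1 \<in> ?K'" using nK k by auto
    have cK': "card ?K' = k - card K" using K by (simp add: card_Diff_subset finite_subset[OF K])
    have bU: "?b \<in> ?V - blocks a K" using bV b_mem nK by blast
    \<comment> \<open>Blocks before the last one lie entirely below b, as the splitting of bounded
      sequences requires.\<close>
    have le: "\<forall>x\<in>blocks a K. x \<le> ?b"
    proof
      fix x assume "x \<in> blocks a K"
      then obtain q j where q: "q \<in> K" "j < a" "x = Suc (a * q + j)" by (rule blocksE)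
      have "a * q + j < a * Suc q" using q by simp
      also have "\<dots> \<le> a * (k - 1)" using q K1 by (intro mult_le_mono2) auto
      finally show "x \<le> ?b" unfolding b q by simp
    qed
    have "?g (blocks a K) = (\<Sum>j\<le>m. \<Sum>(I, J)\<in>index_splits (length \<nu>).
      card (conn_facs (blocks a K) (perm_restrict ?s (blocks a K)) j (nths \<nu> I @ [\<beta>])) *
      card (bounded_facs (?V - blocks a K) (perm_restrict ?s (?V - blocks a K)) (m - j) ?b (\<alpha> # nths \<nu> J)))"
      using blocks_invariant[OF K]
      by (intro card_split_facs_eq[OF _ standard_perm_permutes blocks_subset[OF K] _ bU le]) auto
    also have "\<dots> = (\<Sum>j\<le>m. \<Sum>(I, J)\<in>index_splits (length \<nu>).
      conn_count a (card K) j (nths \<nu> I @ [\<beta>]) * bounded_count a (k - card K) (m - j) l \<alpha> (nths \<nu> J))"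
      unfolding blocks_compl card_conn_facs_blocks[OF a K] card_bounded_facs_blocks[OF a K' l] cK' ..
    finally show "?g (blocks a K) = (\<Sum>j\<le>m. \<Sum>(I, J)\<in>index_splits (length \<nu>).
      conn_count a (card K) j (nths \<nu> I @ [\<beta>]) * bounded_count a (k - card K) (m - j) l \<alpha> (nths \<nu> J))" .
  qed
  also have "\<dots> = (\<Sum>i\<le>k - 1. (k - 1 choose i) * (\<Sum>j\<le>m. \<Sum>(I, J)\<in>index_splits (length \<nu>).
      conn_count a i j (nths \<nu> I @ [\<beta>]) * bounded_count a (k - i) (m - j) l \<alpha> (nths \<nu> J)))"
    using sum_Pow_card[of "{..<k - 1}" "\<lambda>i. \<Sum>j\<le>m. \<Sum>(I, J)\<in>index_splits (length \<nu>).
      conn_count a i j (nths \<nu> I @ [\<beta>]) * bounded_count a (k - i) (m - j) l \<alpha> (nths \<nu> J)"] by simp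
  finally show ?thesis .
qed

section \<open>Factorisations as lists of pairs\<close>

definition tps :: "(nat \<times> nat) list \<Rightarrow> (nat \<Rightarrow> nat) list" where
  "tps ts = map (\<lambda>(r, s). transpose r s) ts"

lemma perm_prod_tps: "perm_prod (\<sigma> # tps ts) = tp_prod \<sigma> ts"
proof -
  have "foldl (\<lambda>p q. q \<circ> p) \<sigma> (tps ts) = tp_prod \<sigma> ts"
    by (induction ts rule: rev_induct) (auto simp: tps_def)
  then show ?thesis by (simp add: perm_prod_def)
qed

lemma cycles_of_eq: "cycles_of d p = cyc {1..d} p"
  by (simp add: cycles_of_def cyc_def)

lemma transpose_eq_iff:
  fixes r s r' s' :: nat
  assumes "r < s" "r' < s'" "transpose r s = transpose r' s'" shows "r = r' \<and> s = s'"
proof -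
  have "transpose r' s' r = s" "transpose r' s' s = r" using assms(3)[symmetric] by simp_all
  then show ?thesis using assms(1,2) by (auto simp: transpose_def split: if_splits)
qed

lemma inj_on_tps: "inj_on tps {ts. \<forall>(r, s)\<in>set ts. r < s}"
proof (rule inj_onI)
  fix ts us :: "(nat \<times> nat) list"
  assume *: "ts \<in> {ts. \<forall>(r, s)\<in>set ts. r < s}" "us \<in> {ts. \<forall>(r, s)\<in>set ts. r < s}" "tps ts = tps us"
  show "ts = us"
    using *(3) unfolding tps_def
  proof (rule map_inj_on)
    show "inj_on (\<lambda>(r, s). transpose r s) (set ts \<union> set us)"
    proof (rule inj_onI)
      fix x y assume "x \<in> set ts \<union> set us" "y \<in> set ts \<union> set us"
        "(case x of (r, s) \<Rightarrow> transpose r s) = (case y of (r, s) \<Rightarrow> transpose r s)"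
      then show "x = y" using *(1,2) transpose_eq_iff[of "fst x" "snd x" "fst y" "snd y"]
        by (auto simp: case_prod_beta prod_eq_iff)
    qed
  qed
qed

lemma monotone_transpositions_iff:
  "monotone_transpositions d \<sigma>s \<longleftrightarrow> (\<exists>ts\<in>mono_seqs {1..d} (length \<sigma>s). \<sigma>s = tps ts)"
proof
  assume "monotone_transpositions d \<sigma>s"
  then obtain ts where ts: "\<sigma>s = tps ts" "\<forall>(r, s)\<in>set ts. 1 \<le> r \<and> r < s \<and> s \<le> d" "sorted (map snd ts)"
    by (auto simp: monotone_transpositions_def tps_def)
  have "ts \<in> mono_seqs {1..d} (length \<sigma>s)" using ts by (fastforce simp: mono_seqs_def tps_def)
  then show "\<exists>ts\<in>mono_seqs {1..d} (length \<sigma>s). \<sigma>s = tps ts" using ts(1) by blast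
next
  assume "\<exists>ts\<in>mono_seqs {1..d} (length \<sigma>s). \<sigma>s = tps ts"
  then obtain ts where ts: "ts \<in> mono_seqs {1..d} (length \<sigma>s)" "\<sigma>s = tps ts" by blast
  have "\<forall>(r, s)\<in>set ts. 1 \<le> r \<and> r < s \<and> s \<le> d" "sorted (map snd ts)"
    using ts(1) by (auto simp: mono_seqs_def)
  then show "monotone_transpositions d \<sigma>s" using ts(2) unfolding monotone_transpositions_def tps_def by blast
qed

text \<open>A path in the graph may use an edge of \<sigma> backwards, which corresponds to the
  inverse in the group; transpositions are their own inverses. Conversely, each generator moves a
  point along an edge, and products concatenate paths.\<close>

lemma transitive_iff_conn:
  assumes \<sigma>: "\<sigma> permutes {1..d}" and ts: "set ts \<subseteq> {1..d} \<times> {1..d}"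
  shows "transitive_on d (generate (sym_group d) (set (\<sigma> # tps ts))) \<longleftrightarrow> conn {1..d} \<sigma> ts"
proof -
  let ?V = "{1..d}" and ?H = "set (\<sigma> # tps ts)"
  let ?G = "generate (sym_group d) ?H" and ?E = "edges {1..d} \<sigma> \<union> set ts"
  interpret G: group "sym_group d" by (rule sym_group_is_group)
  have H: "h permutes ?V" if "h \<in> ?H" for h
    using that \<sigma> ts by (auto simp: tps_def intro!: permutes_swap_id)
  have mult: "p \<otimes>\<^bsub>sym_group d\<^esub> q = p \<circ> q" for p q by (simp add: sym_group_def)
  have inv_eq: "inv\<^bsub>sym_group d\<^esub> h = inv' h" if "h permutes ?V" for h
  proof (rule G.inv_equality)
    show "inv' h \<otimes>\<^bsub>sym_group d\<^esub> h = \<one>\<^bsub>sym_group d\<^esub>"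
      using permutes_inv_o(2)[OF that] by (simp add: sym_group_def)
  qed (use that permutes_inv[OF that] in \<open>simp_all add: sym_group_def\<close>)
  have GV: "p permutes ?V" if "p \<in> ?G" for p
    using that
  proof (induction rule: generate.induct)
    case one show ?case unfolding sym_group_one by (rule permutes_id)
  next
    case (incl h) then show ?case by (rule H)
  next
    case (inv h)
    then have h: "h permutes ?V" by (rule H)
    show ?case unfolding inv_eq[OF h] by (rule permutes_inv[OF h])
  next
    case (eng p q)
    show ?case unfolding mult by (rule permutes_compose[OF eng.IH(2,1)])
  qed
  have step: "(x, h x) \<in> eqcl ?E" if h: "h \<in> ?H" and x: "x \<in> ?V" for h x
  proof -
    have "h = \<sigma> \<or> (\<exists>r s. (r, s) \<in> set ts \<and> h = transpose r s)" using h by (auto simp: tps_def)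
    then consider "h = \<sigma>" | r s where "(r, s) \<in> set ts" "h = transpose r s" by blast
    then show ?thesis
    proof cases
      case 1
      have "(x, \<sigma> x) \<in> ?E" using x by (auto simp: edges_def)
      then show ?thesis unfolding 1 by (rule eqcl_base)
    next
      case 2
      then have "(r, s) \<in> ?E" by blast
      then have "(r, s) \<in> eqcl ?E" "(s, r) \<in> eqcl ?E" using eqcl_base[of "(r, s)" ?E] eqcl_sym[of r s ?E] by auto
      then show ?thesis unfolding 2 by (simp add: transpose_def)
    qed
  qed
  have gen: "\<forall>x\<in>?V. (x, p x) \<in> eqcl ?E" if "p \<in> ?G" for p
    using that
  proof (induction rule: generate.induct)
    case one then show ?case by (simp add: sym_group_def)
  next
    case (incl h) then show ?case using step by blast
  next
    case (inv h)
    show ?case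
    proof
      fix x assume x: "x \<in> ?V"
      have hV: "h permutes ?V" using H inv by blast
      then have "inv' h x \<in> ?V" using permutes_in_image[OF permutes_inv[OF hV]] x by blast
      then have "(inv' h x, h (inv' h x)) \<in> eqcl ?E" using step inv by blast
      then have "(inv' h x, x) \<in> eqcl ?E" using permutes_inverses(1)[OF hV] by simp
      then show "(x, (inv\<^bsub>sym_group d\<^esub> h) x) \<in> eqcl ?E" unfolding inv_eq[OF hV] by (rule eqcl_sym)
    qed
  next
    case (eng p q)
    show ?case
    proof
      fix x assume x: "x \<in> ?V"
      then have "q x \<in> ?V" using permutes_in_image[OF GV[OF eng.hyps(2)]] by blast
      then show "(x, (p \<otimes>\<^bsub>sym_group d\<^esub> q) x) \<in> eqcl ?E"
        using eng.IH x eqcl_trans[of x "q x" ?E "p (q x)"] by (simp add: mult)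
    qed
  qed
  have conv: "y \<in> ?V \<and> (\<exists>p\<in>?G. p x = y)" if "(x, y) \<in> eqcl ?E" "x \<in> ?V" for x y
    using that(1)
  proof (induction rule: eqcl_induct)
    case refl
    have "\<one>\<^bsub>sym_group d\<^esub> \<in> ?G" by (rule generate.one)
    then show ?case using that(2) by (auto simp: sym_group_def intro!: bexI[of _ id])
  next
    case (step y z)
    then obtain p where p: "p \<in> ?G" "p x = y" and y: "y \<in> ?V" by blast
    have ext: "y' \<in> ?V \<and> (\<exists>p\<in>?G. p x = y')" if "h \<in> ?G" "h y = y'" for h y'
    proof
      show "y' \<in> ?V" using permutes_in_image[OF GV[OF that(1)]] y that(2) by blast
      have "h \<otimes>\<^bsub>sym_group d\<^esub> p \<in> ?G" by (rule generate.eng[OF that(1) p(1)])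
      then show "\<exists>p\<in>?G. p x = y'" using p(2) that(2) by (auto simp: mult intro!: bexI[of _ "h \<circ> p"])
    qed
    consider "z = \<sigma> y" | "y = \<sigma> z" | "(y, z) \<in> set ts" | "(z, y) \<in> set ts"
      using step(2) by (auto simp: edges_def)
    then show ?case
    proof cases
      case 1
      then show ?thesis using ext[OF generate.incl[of \<sigma>]] by simp
    next
      case 2
      have "inv\<^bsub>sym_group d\<^esub> \<sigma> \<in> ?G" by (rule generate.inv) simp
      moreover have "(inv\<^bsub>sym_group d\<^esub> \<sigma>) y = z" unfolding inv_eq[OF \<sigma>] 2 using permutes_inverses(2)[OF \<sigma>] by simp
      ultimately show ?thesis by (rule ext)
    next
      case 3
      have "transpose y z \<in> ?G" by (rule generate.incl) (use 3 in \<open>force simp: tps_def\<close>)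
      then show ?thesis by (rule ext) simp
    next
      case 4
      have "transpose z y \<in> ?G" by (rule generate.incl) (use 4 in \<open>force simp: tps_def\<close>)
      then show ?thesis by (rule ext) simp
    qed
  qed
  show ?thesis
  proof
    assume tr: "transitive_on d ?G"
    show "conn ?V \<sigma> ts"
      unfolding conn_def
    proof (intro ballI)
      fix x y assume xy: "x \<in> ?V" "y \<in> ?V"
      then obtain p where "p \<in> ?G" "p x = y" using tr unfolding transitive_on_def by blast
      then show "(x, y) \<in> eqcl ?E" using gen xy(1) by blast
    qed
  next
    assume "conn ?V \<sigma> ts"
    then show "transitive_on d ?G" using conv unfolding transitive_on_def conn_def by blast
  qed
qed

lemma cycle_type_uniform_iff:
  assumes \<sigma>: "\<sigma> permutes {1..a * k}" and a: "0 < a"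
  shows "cycle_type (a * k) \<sigma> = replicate_mset k a \<longleftrightarrow> (\<forall>A\<in>cyc {1..a * k} \<sigma>. card A = a)"
proof
  assume "cycle_type (a * k) \<sigma> = replicate_mset k a"
  then have "set_mset (cycle_type (a * k) \<sigma>) \<subseteq> {a}" by (simp add: set_mset_replicate_mset_subset)
  then show "\<forall>A\<in>cyc {1..a * k} \<sigma>. card A = a" by (auto simp: cycle_type_def cycles_of_eq)
next
  assume *: "\<forall>A\<in>cyc {1..a * k} \<sigma>. card A = a"
  have "card (cyc {1..a * k} \<sigma>) = k" using card_cyc_uniform[OF _ \<sigma> *] a by simp
  moreover have "image_mset card (mset_set (cyc {1..a * k} \<sigma>)) = image_mset (\<lambda>_. a) (mset_set (cyc {1..a * k} \<sigma>))"
    using * by (intro image_mset_cong) simp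
  ultimately show "cycle_type (a * k) \<sigma> = replicate_mset k a"
    by (simp add: cycle_type_def cycles_of_eq image_mset_const_eq)
qed

text \<open>The real equation for the number of transpositions becomes one over the naturals. The
  subtraction of 2 does not truncate, because \<open>\<mu>\<close> is non-empty and k is
  positive.\<close>

lemma monotone_factorisation_iff:
  assumes a: "0 < a" and d: "sum_list \<mu> = a * k" and k: "0 < k" and n: "\<mu> \<noteq> []"
  shows "monotone_factorisation a g \<mu> \<sigma> \<sigma>s cs \<longleftrightarrow> \<sigma> \<in> uniform_perms a (a * k) \<and>
    (\<exists>ts. \<sigma>s = tps ts \<and> (ts, cs) \<in> conn_facs {1..a * k} \<sigma> (2 * g + length \<mu> + k - 2) \<mu>)"
proof -
  let ?m = "2 * g + length \<mu> + k - 2"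
  have n1: "1 \<le> length \<mu>" using n by (simp add: Suc_le_eq)
  then have len: "real (length \<sigma>s) = 2 * real g - 2 + real (length \<mu>) + real (a * k) / real a \<longleftrightarrow> length \<sigma>s = ?m"
    using a k by (simp add: of_nat_diff) linarith
  show ?thesis
  proof
    assume mf: "monotone_factorisation a g \<mu> \<sigma> \<sigma>s cs"
    have \<sigma>: "\<sigma> permutes {1..a * k}" and m: "length \<sigma>s = ?m"
      using mf len unfolding monotone_factorisation_def Let_def d by blast+
    have "cycle_type (a * k) \<sigma> = replicate_mset k a"
      using mf a unfolding monotone_factorisation_def Let_def d by simp
    then have u: "\<sigma> \<in> uniform_perms a (a * k)" using \<sigma> cycle_type_uniform_iff[OF \<sigma> a] by (simp add: uniform_perms_def)
    obtain ts where ts: "ts \<in> mono_seqs {1..a * k} (length \<sigma>s)" "\<sigma>s = tps ts"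
      using mf unfolding monotone_factorisation_def Let_def d monotone_transpositions_iff by blast
    have "transitive_on (a * k) (generate (sym_group (a * k)) (set (\<sigma> # \<sigma>s)))"
      using mf unfolding monotone_factorisation_def Let_def d by blast
    then have "conn {1..a * k} \<sigma> ts"
      using transitive_iff_conn[OF \<sigma> mono_seqs_subset[OF ts(1)]] ts(2) by simp
    moreover have "cs \<in> lab {1..a * k} (tp_prod \<sigma> ts) \<mu>"
      using mf unfolding monotone_factorisation_def Let_def d ts(2) perm_prod_tps cycles_of_eq lab_def by blast
    ultimately have "(ts, cs) \<in> conn_facs {1..a * k} \<sigma> ?m \<mu>"
      using ts(1)[unfolded m] by (simp add: conn_facs_def)
    then show "\<sigma> \<in> uniform_perms a (a * k) \<and> (\<exists>ts. \<sigma>s = tps ts \<and> (ts, cs) \<in> conn_facs {1..a * k} \<sigma> ?m \<mu>)"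
      using u ts(2) by blast
  next
    assume R: "\<sigma> \<in> uniform_perms a (a * k) \<and> (\<exists>ts. \<sigma>s = tps ts \<and> (ts, cs) \<in> conn_facs {1..a * k} \<sigma> ?m \<mu>)"
    then obtain ts where ts: "\<sigma>s = tps ts" "ts \<in> mono_seqs {1..a * k} ?m" "conn {1..a * k} \<sigma> ts"
      "cs \<in> lab {1..a * k} (tp_prod \<sigma> ts) \<mu>" by (auto simp: conn_facs_def)
    have \<sigma>: "\<sigma> permutes {1..a * k}" and c: "\<forall>A\<in>cyc {1..a * k} \<sigma>. card A = a"
      using R by (auto simp: uniform_perms_def)
    have m: "length \<sigma>s = ?m" using ts by (simp add: tps_def mono_seqs_def)
    have ct: "cycle_type (a * k) \<sigma> = replicate_mset (a * k div a) a" using cycle_type_uniform_iff[OF \<sigma> a] c a by simp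
    have mt: "monotone_transpositions (a * k) \<sigma>s" unfolding monotone_transpositions_iff using ts m by metis
    have tr: "transitive_on (a * k) (generate (sym_group (a * k)) (set (\<sigma> # \<sigma>s)))"
      using transitive_iff_conn[OF \<sigma> mono_seqs_subset[OF ts(2)]] ts(1,3) by simp
    have l: "distinct cs" "set cs = cycles_of (a * k) (perm_prod (\<sigma> # \<sigma>s))" "map card cs = \<mu>"
      using ts(4) unfolding ts(1) perm_prod_tps cycles_of_eq lab_def by blast+
    show "monotone_factorisation a g \<mu> \<sigma> \<sigma>s cs"
      unfolding monotone_factorisation_def Let_def d
      by (intro conjI len[THEN iffD2, OF m] \<sigma> ct mt tr l)
  qed
qed

text \<open>The number of transpositions is an integer, so the quotient of the size by a is one
  too.\<close>

lemma monotone_factorisation_dvd: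
  assumes "0 < a" "monotone_factorisation a g \<mu> \<sigma> \<sigma>s cs" shows "a dvd sum_list \<mu>"
proof -
  have "real (length \<sigma>s) = 2 * real g - 2 + real (length \<mu>) + real (sum_list \<mu>) / real a"
    using assms(2) by (simp add: monotone_factorisation_def Let_def)
  then have "real (sum_list \<mu>) = real_of_int (int a * (int (length \<sigma>s) + 2 - 2 * int g - int (length \<mu>)))"
    using assms(1) by (simp add: field_simps)
  then have "int (sum_list \<mu>) = int a * (int (length \<sigma>s) + 2 - 2 * int g - int (length \<mu>))"
    by (metis of_int_eq_iff of_int_of_nat_eq)
  then have "int a dvd int (sum_list \<mu>)" by simp
  then show ?thesis by simp
qed

text \<open>By conjugation invariance all admissible first permutations contribute equally. Their
  number divided by the factorial of the size is the inverse of the centraliser order, which is the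
  normalisation of the refined numbers.\<close>

theorem monotone_hurwitz_eq:
  assumes a: "0 < a" and d: "sum_list \<mu> = a * k" and k: "0 < k" and n: "\<mu> \<noteq> []"
  shows "monotone_hurwitz a g \<mu> = real (conn_count a k (2 * g + length \<mu> + k - 2) \<mu>) / (real a ^ k * fact k)"
proof -
  let ?m = "2 * g + length \<mu> + k - 2" and ?V = "{1..a * k}" and ?s = "standard_perm a (a * k)"
  let ?C = "uniform_perms a (a * k)"
  let ?f = "\<lambda>(\<sigma>, ts, cs). (\<sigma>, tps ts, cs)"
  have fin: "finite (conn_facs ?V \<sigma> ?m \<mu>)" for \<sigma>
    by (rule finite_subset[of _ "SIGMA ts:mono_seqs ?V ?m. lab ?V (tp_prod \<sigma> ts) \<mu>"])
       (auto simp: conn_facs_def finite_mono_seqs finite_lab)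
  have "{(\<sigma>, \<sigma>s, cs). monotone_factorisation a g \<mu> \<sigma> \<sigma>s cs} = ?f ` (SIGMA \<sigma>:?C. conn_facs ?V \<sigma> ?m \<mu>)"
    unfolding monotone_factorisation_iff[OF assms] by force
  moreover have "inj_on ?f (SIGMA \<sigma>:?C. conn_facs ?V \<sigma> ?m \<mu>)"
  proof (rule inj_onI)
    fix x y assume x: "x \<in> (SIGMA \<sigma>:?C. conn_facs ?V \<sigma> ?m \<mu>)" and y: "y \<in> (SIGMA \<sigma>:?C. conn_facs ?V \<sigma> ?m \<mu>)"
      and e: "?f x = ?f y"
    obtain \<sigma> ts cs \<sigma>' ts' cs' where xy: "x = (\<sigma>, ts, cs)" "y = (\<sigma>', ts', cs')" by (metis prod.exhaust)
    have "ts \<in> {ts. \<forall>(r, s)\<in>set ts. r < s}" "ts' \<in> {ts. \<forall>(r, s)\<in>set ts. r < s}"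
      using x y by (auto simp: xy conn_facs_def mono_seqs_def)
    then have "ts = ts'" using inj_onD[OF inj_on_tps, of ts ts'] e by (simp add: xy)
    then show "x = y" using e by (simp add: xy)
  qed
  ultimately have "card {(\<sigma>, \<sigma>s, cs). monotone_factorisation a g \<mu> \<sigma> \<sigma>s cs} =
      (\<Sum>\<sigma>\<in>?C. card (conn_facs ?V \<sigma> ?m \<mu>))"
    using fin finite_uniform_perms by (simp add: card_image card_SigmaI)
  moreover have "(\<Sum>\<sigma>\<in>?C. card (conn_facs ?V \<sigma> ?m \<mu>)) * (a ^ k * fact k) =
      fact (a * k) * card (conn_facs ?V ?s ?m \<mu>)"
    using card_conn_facs_conj[OF _ standard_perm_permutes] by (intro sum_uniform_perms[OF a]) blast
  ultimately have "real (card {(\<sigma>, \<sigma>s, cs). monotone_factorisation a g \<mu> \<sigma> \<sigma>s cs}) * (real a ^ k * fact k) =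
      fact (a * k) * real (conn_count a k ?m \<mu>)"
    unfolding conn_count_def by (metis (no_types, lifting) of_nat_fact of_nat_mult of_nat_power)
  then show ?thesis using a by (simp add: monotone_hurwitz_def d field_simps)
qed

lemma monotone_hurwitz_not_dvd:
  assumes "0 < a" "\<not> a dvd sum_list \<mu>" shows "monotone_hurwitz a g \<mu> = 0"
proof -
  have e: "{(\<sigma>, \<sigma>s, cs). monotone_factorisation a g \<mu> \<sigma> \<sigma>s cs} = {}"
    using monotone_factorisation_dvd[OF assms(1)] assms(2) by blast
  show ?thesis unfolding monotone_hurwitz_def e by simp
qed

text \<open>The only multiple of a in the last block is its end, so every other point there moves up
  by one.\<close>

lemma standard_perm_last_block:
  assumes "0 < k" "1 \<le> l" "a * k - a + l \<le> x" "x < a * k"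
  shows "standard_perm a (a * k) x = Suc x"
proof -
  have "\<not> a dvd x"
  proof
    assume "a dvd x"
    then obtain q where q: "x = a * q" by blast
    have "q < k" using q assms(4) by simp
    then have "a * q \<le> a * (k - 1)" by (intro mult_le_mono2) simp
    also have "\<dots> = a * k - a" by (simp add: diff_mult_distrib2)
    finally show False using assms(2,3) q by simp
  qed
  moreover have "1 \<le> x" using assms(2,3) by linarith
  ultimately show ?thesis using assms(4) by (simp add: standard_perm_def)
qed

section \<open>The refined counts\<close>

text \<open>The points from the base point upwards are its successive iterates. In particular the
  marks for p and for l impose the same condition when p \<le> l and the sequence is bounded by the
  base point for p.\<close>

lemma marked_hd_iff:
  assumes k: "0 < k" and l: "1 \<le> l" "l \<le> a" and ts: "ts \<in> mono_seqs_le {1..a * k} m (a * k - a + l)"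
    and cs: "cs \<in> lab {1..a * k} (tp_prod (standard_perm a (a * k)) ts) (c # \<nu>)"
    and x: "a * k - a + l \<le> x" "x \<le> a * k"
  shows "x \<in> hd cs \<longleftrightarrow> a * k - a + l \<in> hd cs"
proof -
  let ?p = "tp_prod (standard_perm a (a * k)) ts" and ?b = "a * k - a + l" and ?V = "{1..a * k}"
  have p: "?p permutes ?V"
    using ts mono_seqs_subset by (intro tp_prod_permutes[OF standard_perm_permutes]) (auto simp: mono_seqs_le_def)
  have step: "?p y = Suc y" if "?b \<le> y" "y < a * k" for y
    using standard_perm_last_block[OF k l(1)] ts that
    by (intro tp_prod_above[of ?b "a * k"]) (auto simp: mono_seqs_le_def mono_seqs_def)
  have "(?p ^^ (x - ?b)) ?b = x"
    using funpow_above[of ?b "a * k" ?p "x - ?b", OF step] x by simp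
  then have "x \<in> orbit ?p ?b" using funpow_in_orbit[OF self_in_orbit[OF _ p]] by (metis finite_atLeastAtMost)
  then have o: "orbit ?p x = orbit ?p ?b" using orbit_eq_if_mem[OF _ p] by simp
  have "cs \<noteq> []" using cs by (auto simp: lab_def)
  then have "hd cs \<in> cyc ?V ?p" using cs hd_in_set by (auto simp: lab_def)
  then have "hd cs = orbit ?p y" if "y \<in> hd cs" for y using cyc_eq_orbit[OF _ p _ that] by simp
  then show ?thesis using o self_in_orbit[OF _ p] by (metis finite_atLeastAtMost)
qed

lemma mono_seqs_le_last:
  assumes "ts \<in> mono_seqs V m" "ts \<noteq> []" shows "ts \<in> mono_seqs_le V m b \<longleftrightarrow> snd (last ts) \<le> b"
proof -
  obtain us r s where ts: "ts = us @ [(r, s)]" using assms(2) by (cases ts rule: rev_cases) auto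
  show ?thesis using assms(1) by (fastforce simp: ts mono_seqs_le_def mono_seqs_def sorted_append)
qed

lemma last_count_alt:
  assumes k: "0 < k" and l: "1 \<le> l" "l \<le> a"
  defines "b \<equiv> a * k - a + l"
  shows "last_facs {1..a * k} (standard_perm a (a * k)) m b (c # \<nu>) =
    {(ts, cs) \<in> conn_facs {1..a * k} (standard_perm a (a * k)) m (c # \<nu>).
      ts \<noteq> [] \<and> snd (last ts) = b \<and> {b..a * k} \<subseteq> hd cs}"
proof -
  have "b \<le> a * k" unfolding b_def using k l by (cases k) auto
  then have bd: "b \<in> {b..a * k}" by simp
  have key: "{b..a * k} \<subseteq> hd cs \<longleftrightarrow> b \<in> hd cs"
    if ts: "ts \<in> mono_seqs {1..a * k} m" "ts \<noteq> []" "snd (last ts) = b"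
      and cs: "cs \<in> lab {1..a * k} (tp_prod (standard_perm a (a * k)) ts) (c # \<nu>)" for ts cs
  proof -
    have "ts \<in> mono_seqs_le {1..a * k} m b" using mono_seqs_le_last[OF ts(1,2)] ts(3) by simp
    note m = marked_hd_iff[OF k l, folded b_def, OF this cs]
    have "x \<in> hd cs \<longleftrightarrow> b \<in> hd cs" if "x \<in> {b..a * k}" for x using m[of x] that by simp
    then show ?thesis using bd by blast
  qed
  show ?thesis
  proof (intro equalityI subrelI)
    fix ts cs assume "(ts, cs) \<in> last_facs {1..a * k} (standard_perm a (a * k)) m b (c # \<nu>)"
    then have f: "ts \<in> mono_seqs {1..a * k} m" "ts \<noteq> []" "snd (last ts) = b" "conn {1..a * k} (standard_perm a (a * k)) ts"
      "cs \<in> lab {1..a * k} (tp_prod (standard_perm a (a * k)) ts) (c # \<nu>)" "b \<in> hd cs"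
      by (auto simp: last_facs_def marked_lab_def)
    then show "(ts, cs) \<in> {(ts, cs) \<in> conn_facs {1..a * k} (standard_perm a (a * k)) m (c # \<nu>).
      ts \<noteq> [] \<and> snd (last ts) = b \<and> {b..a * k} \<subseteq> hd cs}"
      using key[OF f(1,2,3,5)] unfolding conn_facs_def by blast
  next
    fix ts cs assume "(ts, cs) \<in> {(ts, cs) \<in> conn_facs {1..a * k} (standard_perm a (a * k)) m (c # \<nu>).
      ts \<noteq> [] \<and> snd (last ts) = b \<and> {b..a * k} \<subseteq> hd cs}"
    then have "ts \<in> mono_seqs {1..a * k} m" "ts \<noteq> []" "snd (last ts) = b" "conn {1..a * k} (standard_perm a (a * k)) ts"
      "cs \<in> lab {1..a * k} (tp_prod (standard_perm a (a * k)) ts) (c # \<nu>)" "b \<in> hd cs"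
      using bd by (auto simp: conn_facs_def)
    then show "(ts, cs) \<in> last_facs {1..a * k} (standard_perm a (a * k)) m b (c # \<nu>)"
      unfolding last_facs_def marked_lab_def by blast
  qed
qed

lemma standard_perm_uniform: "standard_perm a (a * k) \<in> uniform_perms a (a * k)"
  using standard_perm_permutes card_standard_perm_orbit by (auto simp: uniform_perms_def)

lemma refined_count_eq:
  assumes a: "0 < a" and d: "\<mu>1 + sum_list \<nu> = a * k" and k: "0 < k" and l: "1 \<le> l" "l \<le> a"
    and nb: "\<not> (g = 0 \<and> \<nu> = [] \<and> \<mu>1 = a)"
  shows "refined_count a g l \<mu>1 \<nu> = last_count a k (2 * g + Suc (length \<nu>) + k - 2) l \<mu>1 \<nu>"
proof -
  let ?m = "2 * g + Suc (length \<nu>) + k - 2" and ?b = "a * k - a + l" and ?s = "standard_perm a (a * k)"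
  let ?S = "{(\<sigma>s, cs). monotone_factorisation a g (\<mu>1 # \<nu>) ?s \<sigma>s cs \<and> \<sigma>s \<noteq> [] \<and>
           (\<exists>r. 1 \<le> r \<and> r < ?b \<and> last \<sigma>s = transpose r ?b) \<and> {?b..a * k} \<subseteq> hd cs}"
  let ?L = "last_facs {1..a * k} ?s ?m ?b (\<mu>1 # \<nu>)"
  let ?f = "\<lambda>(ts, cs). (tps ts, cs)"
  have mf: "monotone_factorisation a g (\<mu>1 # \<nu>) ?s \<sigma>s cs \<longleftrightarrow>
    (\<exists>ts. \<sigma>s = tps ts \<and> (ts, cs) \<in> conn_facs {1..a * k} ?s ?m (\<mu>1 # \<nu>))" for \<sigma>s cs
    using monotone_factorisation_iff[OF a _ k, of "\<mu>1 # \<nu>" g ?s \<sigma>s cs] d standard_perm_uniform by simp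
  have last: "(\<exists>r. 1 \<le> r \<and> r < ?b \<and> last (tps ts) = transpose r ?b) \<longleftrightarrow> snd (last ts) = ?b"
    if ts: "ts \<in> mono_seqs {1..a * k} ?m" "ts \<noteq> []" for ts
  proof -
    obtain us r s where e: "ts = us @ [(r, s)]" using ts(2) by (cases ts rule: rev_cases) auto
    have rs: "1 \<le> r" "r < s" using ts(1) by (auto simp: e mono_seqs_def)
    have "last (tps ts) = transpose r s" by (simp add: e tps_def)
    then show ?thesis using rs transpose_eq_iff[of r s _ ?b] by (auto simp: e)
  qed
  have "?S = ?f ` ?L"
  proof (intro equalityI subsetI)
    fix x assume "x \<in> ?S"
    then obtain \<sigma>s cs where x: "x = (\<sigma>s, cs)" "monotone_factorisation a g (\<mu>1 # \<nu>) ?s \<sigma>s cs" "\<sigma>s \<noteq> []"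
      "\<exists>r. 1 \<le> r \<and> r < ?b \<and> last \<sigma>s = transpose r ?b" "{?b..a * k} \<subseteq> hd cs" by blast
    obtain ts where ts: "\<sigma>s = tps ts" "(ts, cs) \<in> conn_facs {1..a * k} ?s ?m (\<mu>1 # \<nu>)"
      using x(2) mf by blast
    have "ts \<noteq> []" "ts \<in> mono_seqs {1..a * k} ?m" using x(3) ts by (auto simp: tps_def conn_facs_def)
    then have "(ts, cs) \<in> ?L" using x(4,5) ts last last_count_alt[OF k l] by blast
    then show "x \<in> ?f ` ?L" using x(1) ts(1) by force
  next
    fix x assume "x \<in> ?f ` ?L"
    then obtain ts cs where x: "x = (tps ts, cs)" "(ts, cs) \<in> ?L" by auto
    then have L: "(ts, cs) \<in> conn_facs {1..a * k} ?s ?m (\<mu>1 # \<nu>)" "ts \<noteq> []" "snd (last ts) = ?b" "{?b..a * k} \<subseteq> hd cs"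
      using last_count_alt[OF k l] by auto
    have "ts \<in> mono_seqs {1..a * k} ?m" "tps ts \<noteq> []" using L by (auto simp: conn_facs_def tps_def)
    then have "\<exists>r. 1 \<le> r \<and> r < ?b \<and> last (tps ts) = transpose r ?b" using last L by blast
    moreover have "monotone_factorisation a g (\<mu>1 # \<nu>) ?s (tps ts) cs" using mf L(1) by blast
    ultimately show "x \<in> ?S" unfolding x(1) mem_Collect_eq case_prod_conv
      using L(4) \<open>tps ts \<noteq> []\<close> by blast
  qed
  moreover have "inj_on ?f ?L"
  proof (rule inj_onI)
    fix x y assume x: "x \<in> ?L" and y: "y \<in> ?L" and e: "?f x = ?f y"
    have "fst x \<in> {ts. \<forall>(r, s)\<in>set ts. r < s}" "fst y \<in> {ts. \<forall>(r, s)\<in>set ts. r < s}"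
      using x y by (auto simp: last_facs_def mono_seqs_def)
    then have "fst x = fst y" using inj_onD[OF inj_on_tps, of "fst x" "fst y"] e by (simp add: case_prod_beta)
    then show "x = y" using e by (simp add: case_prod_beta prod_eq_iff)
  qed
  ultimately have S: "card ?S = card ?L" by (simp add: card_image)
  have "refined_count a g l \<mu>1 \<nu> = card ?S"
    unfolding refined_count_def Let_def d using nb by (simp only: if_False)
  also note S
  finally show ?thesis by (simp only: last_count_def)
qed

text \<open>Otherwise no transposition would touch the last block, which would be cut off from the
  points moved by the sequence. A non-empty sequence supplies such a point.\<close>

lemma conn_last_block:
  assumes a: "0 < a" and k: "0 < k" and c: "conn {1..a * k} (standard_perm a (a * k)) ts"
    and ts: "ts \<in> mono_seqs {1..a * k} m" "ts \<noteq> []"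
  shows "a * k - a < snd (last ts)"
proof (rule ccontr)
  let ?V = "{1..a * k}" and ?s = "standard_perm a (a * k)"
  assume n: "\<not> a * k - a < snd (last ts)"
  have "ts \<in> mono_seqs_le ?V m (a * k - a)" using mono_seqs_le_last[OF ts] n by simp
  then have "r < s \<and> s \<le> a * k - a" if "(r, s) \<in> set ts" for r s
    using that by (auto simp: mono_seqs_le_def mono_seqs_def)
  then have le: "r \<le> a * k - a" "s \<le> a * k - a" if "(r, s) \<in> set ts" for r s
    using that by fastforce+
  have blk: "x \<in> blocks a {..<k - 1} \<longleftrightarrow> x \<le> a * k - a" if x: "x \<in> ?V" for x
  proof -
    obtain q j where q: "q < k" "j < a" "x = Suc (a * q + j)" using x by (rule block_decomp)
    have e: "a * k - a = a * (k - 1)" by (simp add: diff_mult_distrib2)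
    show ?thesis
    proof (cases "q = k - 1")
      case True
      then show ?thesis using q mem_blocks[OF q(2), of q "{..<k - 1}"] unfolding e by simp
    next
      case False
      then have "a * Suc q \<le> a * (k - 1)" using q by (intro mult_le_mono2) simp
      then show ?thesis using q False mem_blocks[OF q(2), of q "{..<k - 1}"] unfolding e by simp
    qed
  qed
  obtain r s where rs: "(r, s) \<in> set ts" using ts(2) by (metis list.set_intros(1) neq_Nil_conv surj_pair)
  have rV: "r \<in> ?V" using ts(1) rs by (auto simp: mono_seqs_def)
  have dV: "a * k \<in> ?V" using a k by simp
  have "(r, a * k) \<in> eqcl (edges ?V ?s \<union> set ts)" using c rV dV unfolding conn_def by blast
  then have "a * k \<in> blocks a {..<k - 1}"
  proof (rule eqcl_invariant)
    fix u v assume uv: "(u, v) \<in> edges ?V ?s \<union> set ts"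
    show "u \<in> blocks a {..<k - 1} \<longleftrightarrow> v \<in> blocks a {..<k - 1}"
    proof (cases "(u, v) \<in> set ts")
      case True
      then have "u \<in> ?V" "v \<in> ?V" using mono_seqs_subset[OF ts(1)] by auto
      then show ?thesis using blk le[OF True] by simp
    next
      case False
      then have "u \<in> ?V" "v = ?s u" using uv by (auto simp: edges_def)
      then show ?thesis using blocks_invariant[of "{..<k - 1}" k u a] by auto
    qed
  next
    show "r \<in> blocks a {..<k - 1}" using blk[OF rV] le(1)[OF rs] by simp
  qed
  then have "a * k \<le> a * k - a" using blk[OF dV] by simp
  moreover have "0 < a * k" using a k by simp
  ultimately show False using a by linarith
qed

lemma finite_last_facs: "finite V \<Longrightarrow> finite (last_facs V \<sigma> m b \<mu>)"
  by (rule finite_subset[of _ "SIGMA ts:mono_seqs V m. lab V (tp_prod \<sigma> ts) \<mu>"])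
     (auto simp: last_facs_def marked_lab_def finite_mono_seqs finite_lab)

text \<open>Sorted by the larger point of the last transposition. \<open>conn_last_block\<close>
  puts it into the last block, so it is the base point for some p \<le> l, and marking that one or
  the one for l is the same.\<close>

lemma bounded_count_eq_sum:
  assumes a: "0 < a" and k: "0 < k" and m: "0 < m" and l: "1 \<le> l" "l \<le> a"
  shows "bounded_count a k m l c \<nu> = (\<Sum>p=1..l. last_count a k m p c \<nu>)"
proof -
  let ?V = "{1..a * k}" and ?s = "standard_perm a (a * k)" and ?b = "\<lambda>p. a * k - a + p"
  have mk: "?b l \<in> hd cs \<longleftrightarrow> ?b p \<in> hd cs"
    if "p \<in> {1..l}" "ts \<in> mono_seqs ?V m" "ts \<noteq> []" "snd (last ts) = ?b p" "cs \<in> lab ?V (tp_prod ?s ts) (c # \<nu>)" for p ts cs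
  proof (rule marked_hd_iff[OF k])
    show "ts \<in> mono_seqs_le ?V m (?b p)" using mono_seqs_le_last[OF that(2,3)] that(4) by simp
    show "?b l \<le> a * k" using l k by (cases k) auto
  qed (use that l in auto)
  have "bounded_facs ?V ?s m (?b l) (c # \<nu>) = (\<Union>p\<in>{1..l}. last_facs ?V ?s m (?b p) (c # \<nu>))"
  proof (intro equalityI subsetI)
    fix x assume "x \<in> bounded_facs ?V ?s m (?b l) (c # \<nu>)"
    then obtain ts cs where x: "x = (ts, cs)" "ts \<in> mono_seqs_le ?V m (?b l)" "conn ?V ?s ts"
      "cs \<in> lab ?V (tp_prod ?s ts) (c # \<nu>)" "?b l \<in> hd cs" by (auto simp: bounded_facs_def marked_lab_def)
    have ts: "ts \<in> mono_seqs ?V m" "ts \<noteq> []" using x(2) m by (auto simp: mono_seqs_le_def mono_seqs_def)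
    have "snd (last ts) \<le> ?b l" using mono_seqs_le_last[OF ts] x(2) by simp
    moreover have "a * k - a < snd (last ts)" by (rule conn_last_block[OF a k x(3) ts])
    ultimately have p: "snd (last ts) - (a * k - a) \<in> {1..l}" "snd (last ts) = ?b (snd (last ts) - (a * k - a))" by auto
    have "?b (snd (last ts) - (a * k - a)) \<in> hd cs" using mk[OF p(1) ts p(2) x(4)] x(5) by simp
    then have "x \<in> last_facs ?V ?s m (?b (snd (last ts) - (a * k - a))) (c # \<nu>)"
      using x ts p(2) by (simp add: last_facs_def marked_lab_def)
    then show "x \<in> (\<Union>p\<in>{1..l}. last_facs ?V ?s m (?b p) (c # \<nu>))" using p(1) by blast
  next
    fix x assume "x \<in> (\<Union>p\<in>{1..l}. last_facs ?V ?s m (?b p) (c # \<nu>))"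
    then obtain p ts cs where p: "p \<in> {1..l}" and x: "x = (ts, cs)" "ts \<in> mono_seqs ?V m" "conn ?V ?s ts"
      "cs \<in> lab ?V (tp_prod ?s ts) (c # \<nu>)" "?b p \<in> hd cs" "ts \<noteq> []" "snd (last ts) = ?b p"
      by (auto simp: last_facs_def marked_lab_def)
    have "ts \<in> mono_seqs_le ?V m (?b l)" using mono_seqs_le_last[OF x(2,6)] x(7) p by simp
    then show "x \<in> bounded_facs ?V ?s m (?b l) (c # \<nu>)"
      using x mk[OF p x(2,6,7,4)] by (simp add: bounded_facs_def marked_lab_def)
  qed
  then have "bounded_count a k m l c \<nu> = card (\<Union>p\<in>{1..l}. last_facs ?V ?s m (?b p) (c # \<nu>))"
    by (simp add: bounded_count_def)
  also have "\<dots> = (\<Sum>p=1..l. card (last_facs ?V ?s m (?b p) (c # \<nu>)))"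
  proof (rule card_UN_disjoint)
    show "\<forall>p\<in>{1..l}. finite (last_facs ?V ?s m (?b p) (c # \<nu>))" by (simp add: finite_last_facs)
  qed (auto simp: last_facs_def)
  finally show ?thesis by (simp add: last_count_def)
qed

text \<open>Without transpositions the bounded count is 1 for every l. The convention that the
  refined count is 1 for l = 1 and 0 otherwise has just these partial sums.\<close>

lemma bounded_count_base:
  assumes a: "0 < a" and l: "1 \<le> l" "l \<le> a" shows "bounded_count a 1 0 l a [] = 1"
proof -
  let ?V = "{1..a * 1}" and ?s = "standard_perm a (a * 1)"
  have orb: "orbit ?s x = ?V" if x: "x \<in> ?V" for x
  proof -
    obtain q j where q: "q < 1" "j < a" "x = Suc (a * q + j)" using x by (rule block_decomp)
    have "orbit ?s x = (\<lambda>i. Suc (a * q + i)) ` {..<a}" unfolding q(3) by (rule standard_perm_orbit[OF q(1,2)])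
    also have "\<dots> = Suc ` {..<a}" using q(1) by simp
    also have "\<dots> = ?V" by (simp add: image_Suc_lessThan)
    finally show ?thesis .
  qed
  have lV: "l \<in> ?V" using l by simp
  have "cyc ?V ?s = {?V}" using orb lV unfolding cyc_def by (metis (no_types, lifting) empty_iff image_cong image_constant)
  moreover have "conn ?V ?s []"
    unfolding conn_def
  proof (intro ballI)
    fix x y assume xy: "x \<in> ?V" "y \<in> ?V"
    have "y \<in> orbit (tp_prod ?s []) x" using orb[OF xy(1)] xy(2) by simp
    then show "(x, y) \<in> eqcl (edges ?V ?s \<union> set [])"
      using orbit_eqcl[OF standard_perm_permutes, of "[]" a 1 x y] xy(1) by simp
  qed
  moreover have "mono_seqs_le ?V 0 l = {[]}" by (auto simp: mono_seqs_le_def mono_seqs_def)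
  moreover have "cs \<in> marked_lab ?V ?s l [a] \<longleftrightarrow> cs = [?V]" for cs
    unfolding marked_lab_iff[OF finite_atLeastAtMost standard_perm_permutes]
    using orb[OF lV] lV \<open>cyc ?V ?s = {?V}\<close> by (cases cs) auto
  ultimately have "bounded_facs ?V ?s 0 l [a] = {([], [?V])}"
    by (auto simp: bounded_facs_def)
  then show ?thesis using l by (simp add: bounded_count_def)
qed

text \<open>The marked point lies in exactly one cycle; i is the position of its label, and that
  cycle is moved to the front.\<close>

lemma card_lab_eq_sum_marked:
  assumes V: "finite V" "p permutes V" and b: "b \<in> V"
  shows "card (lab V p \<mu>) = (\<Sum>i<length \<mu>. card (marked_lab V p b (\<mu> ! i # drop_nth i \<mu>)))"
proof -
  let ?S = "SIGMA i:{..<length \<mu>}. marked_lab V p b (\<mu> ! i # drop_nth i \<mu>)"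
  let ?f = "\<lambda>(i, cs). insert_nth i (hd cs) (tl cs)"
  have S: "cs \<noteq> []" "hd cs = orbit p b" "distinct (tl cs)" "set (tl cs) = cyc V p - {orbit p b}"
    "map card (tl cs) = drop_nth i \<mu>" "card (hd cs) = \<mu> ! i" "i < length \<mu>" "i \<le> length (tl cs)"
    if "(i, cs) \<in> ?S" for i cs
  proof -
    show *: "cs \<noteq> []" "hd cs = orbit p b" "distinct (tl cs)" "set (tl cs) = cyc V p - {orbit p b}"
      "map card (tl cs) = drop_nth i \<mu>" "card (hd cs) = \<mu> ! i" "i < length \<mu>"
      using that marked_lab_iff[OF V] by auto
    have "length (tl cs) = length \<mu> - 1" using *(5,7) by (metis length_map length_drop_nth)
    then show "i \<le> length (tl cs)" using *(7) by linarith
  qed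
  have ob: "orbit p b \<in> cyc V p" using b by (auto simp: cyc_def)
  have "bij_betw ?f ?S (lab V p \<mu>)"
    unfolding bij_betw_def
  proof
    show "inj_on ?f ?S"
    proof (rule inj_onI)
      fix x y assume x: "x \<in> ?S" and y: "y \<in> ?S" and e: "?f x = ?f y"
      obtain i cs j ds where xy: "x = (i, cs)" "y = (j, ds)" by force
      note A = S[OF x[unfolded xy]] and B = S[OF y[unfolded xy]]
      let ?I = "insert_nth i (hd cs) (tl cs)"
      have e': "?I = insert_nth j (hd ds) (tl ds)" using e by (simp add: xy)
      have d: "distinct ?I" using A by (simp add: distinct_insert_nth)
      have "?I ! i = orbit p b" "?I ! j = orbit p b" using nth_insert_nth A(2,8) B(2,8) e' by metis+
      moreover have "i < length ?I" "j < length ?I"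
        using A(8) B(8) arg_cong[OF e', of length] by (simp_all add: length_insert_nth)
      ultimately have ij: "i = j" using d nth_eq_iff_index_eq by metis
      have "tl cs = tl ds" using e' ij A(8) B(8) drop_insert_nth by metis
      then show "x = y" using A(1,2) B(1,2) ij by (simp add: xy) (metis list.collapse)
    qed
    show "?f ` ?S = lab V p \<mu>"
    proof (intro equalityI subsetI)
      fix y assume "y \<in> ?f ` ?S"
      then obtain i cs where x: "(i, cs) \<in> ?S" and y: "y = insert_nth i (hd cs) (tl cs)" by auto
      note A = S[OF x]
      have "map card y = \<mu>" using A insert_drop_nth[OF A(7)] by (simp add: y map_insert_nth)
      then show "y \<in> lab V p \<mu>" using A ob by (auto simp: lab_def y distinct_insert_nth set_insert_nth)
    next
      fix y assume "y \<in> lab V p \<mu>"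
      then have y: "distinct y" "set y = cyc V p" "map card y = \<mu>" by (auto simp: lab_def)
      obtain i where i: "i < length y" "y ! i = orbit p b" using ob y(2) by (metis in_set_conv_nth)
      have i': "i < length \<mu>" using i y(3) by auto
      have "card (orbit p b) = \<mu> ! i" using i y(3) nth_map by metis
      moreover have "map card (drop_nth i y) = drop_nth i \<mu>" using y(3) by (simp add: map_drop_nth)
      ultimately have "orbit p b # drop_nth i y \<in> marked_lab V p b (\<mu> ! i # drop_nth i \<mu>)"
        unfolding marked_lab_iff[OF V] using drop_nth_distinct[OF i(1) y(1)] i y b by auto
      moreover have "?f (i, orbit p b # drop_nth i y) = y" using insert_drop_nth[OF i(1)] i(2) by simp
      ultimately show "y \<in> ?f ` ?S" using i' by (metis (no_types, lifting) SigmaI imageI lessThan_iff)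
    qed
  qed
  from bij_betw_same_card[OF this] have "card (lab V p \<mu>) = card ?S" by simp
  also have "\<dots> = (\<Sum>i<length \<mu>. card (marked_lab V p b (\<mu> ! i # drop_nth i \<mu>)))"
    using V by (simp add: finite_marked_lab)
  finally show ?thesis .
qed

text \<open>For l = a the base point is the largest point, so the bound on the sequences imposes no
  restriction and only the mark remains.\<close>

theorem conn_count_eq_sum:
  assumes a: "0 < a" and k: "0 < k"
  shows "conn_count a k m \<mu> = (\<Sum>i<length \<mu>. bounded_count a k m a (\<mu> ! i) (drop_nth i \<mu>))"
proof -
  let ?V = "{1..a * k}" and ?s = "standard_perm a (a * k)"
  have d: "a * k - a + a = a * k" using k by (cases k) auto
  have dV: "a * k \<in> ?V" using a k by simp
  have M: "mono_seqs_le ?V m (a * k) = mono_seqs ?V m" by (auto simp: mono_seqs_le_def mono_seqs_def)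
  have "conn_count a k m \<mu> = (\<Sum>ts\<in>mono_seqs ?V m. if conn ?V ?s ts then card (lab ?V (tp_prod ?s ts) \<mu>) else 0)"
    unfolding conn_count_def by (rule card_conn_facs) simp
  also have "\<dots> = (\<Sum>ts\<in>mono_seqs ?V m. \<Sum>i<length \<mu>. if conn ?V ?s ts then
      card (marked_lab ?V (tp_prod ?s ts) (a * k) (\<mu> ! i # drop_nth i \<mu>)) else 0)"
  proof (rule sum.cong[OF refl])
    fix ts assume "ts \<in> mono_seqs ?V m"
    then have "tp_prod ?s ts permutes ?V" by (intro tp_prod_permutes[OF standard_perm_permutes] mono_seqs_subset)
    from card_lab_eq_sum_marked[OF _ this dV, of \<mu>]
    show "(if conn ?V ?s ts then card (lab ?V (tp_prod ?s ts) \<mu>) else 0) =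
      (\<Sum>i<length \<mu>. if conn ?V ?s ts then card (marked_lab ?V (tp_prod ?s ts) (a * k) (\<mu> ! i # drop_nth i \<mu>)) else 0)"
      by simp
  qed
  also have "\<dots> = (\<Sum>i<length \<mu>. \<Sum>ts\<in>mono_seqs ?V m. if conn ?V ?s ts then
      card (marked_lab ?V (tp_prod ?s ts) (a * k) (\<mu> ! i # drop_nth i \<mu>)) else 0)"
    by (rule sum.swap)
  also have "\<dots> = (\<Sum>i<length \<mu>. bounded_count a k m a (\<mu> ! i) (drop_nth i \<mu>))"
    unfolding bounded_count_def d by (subst card_bounded_facs) (simp_all only: M finite_atLeastAtMost)
  finally show ?thesis .
qed

section \<open>The recursion\<close>

lemma nths_split:
  fixes xs :: "nat list"
  assumes "I \<inter> J = {}" "{..<length xs} \<subseteq> I \<union> J"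
  shows "sum_list (nths xs I) + sum_list (nths xs J) = sum_list xs"
    "length (nths xs I) + length (nths xs J) = length xs"
proof -
  have "sum_list (nths xs I) + sum_list (nths xs J) = sum_list xs \<and>
    length (nths xs I) + length (nths xs J) = length xs"
    using assms(2)
  proof (induction xs rule: rev_induct)
    case (snoc x xs)
    have "length xs \<in> I \<longleftrightarrow> length xs \<notin> J" using assms(1) snoc.prems by auto
    moreover have "{..<length xs} \<subseteq> I \<union> J" using snoc.prems by (simp add: lessThan_Suc)
    ultimately show ?case using snoc.IH by (auto simp: nths_snoc)
  qed simp
  then show "sum_list (nths xs I) + sum_list (nths xs J) = sum_list xs"
    "length (nths xs I) + length (nths xs J) = length xs" by auto
qed

lemma sum_list_drop_nth:
  fixes xs :: "nat list"
  assumes "i < length xs" shows "xs ! i + sum_list (drop_nth i xs) = sum_list xs"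
proof -
  have "sum_list xs = sum_list (insert_nth i (xs ! i) (drop_nth i xs))" using insert_drop_nth[OF assms] by simp
  also have "\<dots> = sum_mset (mset (insert_nth i (xs ! i) (drop_nth i xs)))" by (simp only: sum_mset_sum_list)
  also have "\<dots> = xs ! i + sum_list (drop_nth i xs)" by (simp add: mset_insert_nth sum_mset_sum_list)
  finally show ?thesis by simp
qed

lemma all_pos_drop_nth: "i < length \<mu> \<Longrightarrow> all_pos \<mu> \<Longrightarrow> all_pos (drop_nth i \<mu>)"
  by (auto simp: all_pos_def drop_nth_def dest: in_set_takeD in_set_dropD)

lemma all_pos_nths: "all_pos \<nu> \<Longrightarrow> all_pos (nths \<nu> I)"
  by (auto simp: all_pos_def dest: in_set_nthsD)

lemma all_pos_append [simp]: "all_pos (xs @ ys) \<longleftrightarrow> all_pos xs \<and> all_pos ys"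
  by (auto simp: all_pos_def)

lemma all_pos_Cons [simp]: "all_pos (x # xs) \<longleftrightarrow> 1 \<le> x \<and> all_pos xs" "all_pos []"
  by (auto simp: all_pos_def)

lemma card_cyc_standard_perm: "0 < a \<Longrightarrow> card (cyc {1..a * k} (standard_perm a (a * k))) = k"
  using card_cyc_uniform[OF _ standard_perm_permutes, of a k a] card_standard_perm_orbit by simp

text \<open>Used to discard summands: a nonzero count fixes the number of blocks by the total size
  and restricts the number of transpositions to those of a genus.\<close>

lemma conn_count_genus:
  assumes a: "0 < a" and nz: "conn_count a k m \<mu> \<noteq> 0" and n: "\<mu> \<noteq> []" "all_pos \<mu>"
  shows "\<exists>g. m + 2 = 2 * g + length \<mu> + k" "sum_list \<mu> = a * k"
proof -
  let ?V = "{1..a * k}" and ?s = "standard_perm a (a * k)"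
  have "conn_facs ?V ?s m \<mu> \<noteq> {}" using nz unfolding conn_count_def by force
  then obtain ts cs where x: "(ts, cs) \<in> conn_facs ?V ?s m \<mu>" by fastforce
  then have ts: "ts \<in> mono_seqs ?V m" and cs: "cs \<in> lab ?V (tp_prod ?s ts) \<mu>" by (auto simp: conn_facs_def)
  show s: "sum_list \<mu> = a * k"
    using sum_list_lab[OF _ tp_prod_permutes[OF standard_perm_permutes mono_seqs_subset[OF ts]] cs] by simp
  have "0 < sum_list \<mu>" using n by (cases \<mu>) auto
  then have "?V \<noteq> {}" using s by auto
  from conn_facs_genus[OF _ this standard_perm_permutes x]
  show "\<exists>g. m + 2 = 2 * g + length \<mu> + k" using card_cyc_standard_perm[OF a] by simp
qed

lemma bounded_count_genus:
  assumes a: "0 < a" and nz: "bounded_count a k m l c \<nu> \<noteq> 0" and p: "1 \<le> c" "all_pos \<nu>"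
  shows "\<exists>g. m + 2 = 2 * g + Suc (length \<nu>) + k"
proof -
  let ?V = "{1..a * k}" and ?s = "standard_perm a (a * k)" and ?b = "a * k - a + l"
  have "bounded_facs ?V ?s m ?b (c # \<nu>) \<noteq> {}" using nz unfolding bounded_count_def by force
  then have "conn_facs ?V ?s m (c # \<nu>) \<noteq> {}" using bounded_facs_subset by blast
  moreover have "finite (conn_facs ?V ?s m (c # \<nu>))"
    by (rule finite_subset[of _ "SIGMA ts:mono_seqs ?V m. lab ?V (tp_prod ?s ts) (c # \<nu>)"])
       (auto simp: conn_facs_def finite_mono_seqs finite_lab)
  ultimately have "conn_count a k m (c # \<nu>) \<noteq> 0" by (simp add: conn_count_def)
  from conn_count_genus(1)[OF a this] show ?thesis using p by simp
qed

lemma refined_hurwitz_not_dvd: "\<not> a dvd \<mu>1 + sum_list \<nu> \<Longrightarrow> refined_hurwitz a g l \<mu>1 \<nu> = 0"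
  by (simp add: refined_hurwitz_def Let_def)

lemma refined_hurwitz_eq:
  assumes "0 < a" "\<mu>1 + sum_list \<nu> = a * k" "0 < k" "1 \<le> l" "l \<le> a" "\<not> (g = 0 \<and> \<nu> = [] \<and> \<mu>1 = a)"
  shows "refined_hurwitz a g l \<mu>1 \<nu> =
    real (last_count a k (2 * g + Suc (length \<nu>) + k - 2) l \<mu>1 \<nu>) / (real a ^ k * fact k)"
  using assms by (simp add: refined_hurwitz_def Let_def refined_count_eq)

lemma refined_hurwitz_base:
  assumes "0 < a" shows "refined_hurwitz a 0 l a [] = (if l = 1 then 1 / real a else 0)"
  using assms by (simp add: refined_hurwitz_def refined_count_def Let_def)

text \<open>Partial sums over p are the form in which the refined numbers enter the recursion. For
  them the exceptional case without transpositions obeys the same formula as all others.\<close>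

lemma sum_refined_hurwitz:
  assumes a: "0 < a" and d: "\<mu>1 + sum_list \<nu> = a * k" and k: "0 < k" and l: "1 \<le> l" "l \<le> a"
  shows "(\<Sum>p=1..l. refined_hurwitz a g p \<mu>1 \<nu>) =
    real (bounded_count a k (2 * g + Suc (length \<nu>) + k - 2) l \<mu>1 \<nu>) / (real a ^ k * fact k)"
proof (cases "g = 0 \<and> \<nu> = [] \<and> \<mu>1 = a")
  case True
  then have k1: "k = 1" using d a by simp
  have "(\<Sum>p=1..l. refined_hurwitz a g p \<mu>1 \<nu>) = (\<Sum>p=1..l. if p = 1 then 1 / real a else 0)"
    using True refined_hurwitz_base[OF a] by simp
  also have "\<dots> = 1 / real a" using l by simp
  finally show ?thesis using True k1 bounded_count_base[OF a l] by simp
next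
  case False
  let ?m = "2 * g + Suc (length \<nu>) + k - 2"
  have "0 < ?m"
  proof (rule ccontr)
    assume "\<not> 0 < ?m"
    then have "g = 0" "length \<nu> = 0" "k = 1" using k by linarith+
    then show False using False d by simp
  qed
  then have "real (bounded_count a k ?m l \<mu>1 \<nu>) = (\<Sum>p=1..l. real (last_count a k ?m p \<mu>1 \<nu>))"
    using bounded_count_eq_sum[OF a k _ l] by simp
  then show ?thesis
    using refined_hurwitz_eq[OF a d k _ _ False] l by (simp add: sum_divide_distrib)
qed

theorem sum_relation_hurwitz:
  assumes a: "0 < a" shows "sum_relation a (monotone_hurwitz a) (refined_hurwitz a)"
  unfolding sum_relation_def
proof (intro allI impI, elim conjE)
  fix g \<mu> assume n: "\<mu> \<noteq> []" and pos: "all_pos \<mu>"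
  let ?R = "\<lambda>i l. refined_hurwitz a g l (\<mu> ! i) (drop_nth i \<mu>)"
  have nths: "(\<Sum>i<length \<mu>. \<Sum>l=1..a. refined_hurwitz a g l (\<mu> ! i) (nths \<mu> ({..<length \<mu>} - {i}))) =
      (\<Sum>i<length \<mu>. \<Sum>l=1..a. ?R i l)"
    by (intro sum.cong refl) (simp add: nths_remove_index)
  show "monotone_hurwitz a g \<mu> =
    (\<Sum>i<length \<mu>. \<Sum>l=1..a. refined_hurwitz a g l (\<mu> ! i) (nths \<mu> ({..<length \<mu>} - {i})))"
  proof (cases "a dvd sum_list \<mu>")
    case False
    have "?R i l = 0" if "i < length \<mu>" for i l
      using refined_hurwitz_not_dvd False sum_list_drop_nth[OF that] by metis
    then show ?thesis unfolding nths using monotone_hurwitz_not_dvd[OF a False] by simp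
  next
    case True
    then obtain k where d: "sum_list \<mu> = a * k" by (rule dvdE)
    have "0 < sum_list \<mu>" using n pos by (cases \<mu>) auto
    then have k: "0 < k" using d by (cases k) auto
    let ?m = "2 * g + length \<mu> + k - 2"
    have "(\<Sum>l=1..a. ?R i l) = real (bounded_count a k ?m a (\<mu> ! i) (drop_nth i \<mu>)) / (real a ^ k * fact k)"
      if i: "i < length \<mu>" for i
    proof -
      have "Suc (length (drop_nth i \<mu>)) = length \<mu>" using length_drop_nth[OF i] i by simp
      moreover have "\<mu> ! i + sum_list (drop_nth i \<mu>) = a * k" using sum_list_drop_nth[OF i] d by simp
      ultimately show ?thesis using sum_refined_hurwitz[OF a _ k, of "\<mu> ! i" "drop_nth i \<mu>" a g] a by simp
    qed
    then show ?thesis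
      unfolding nths monotone_hurwitz_eq[OF a d k n] conn_count_eq_sum[OF a k]
      by (simp add: sum_divide_distrib)
  qed
qed

theorem base_case_hurwitz: "0 < a \<Longrightarrow> base_case a (refined_hurwitz a)"
  by (simp add: base_case_def refined_hurwitz_base)

section \<open>The disconnected term and the recursion\<close>

text \<open>Only lengths of the form 2 g1 + e1 - 2 contribute, so the sum over lengths is a sum over
  genera. Here e1 and e2 stand for the number of cycles of the product plus that of the first
  permutation on each side, and 4 = 2 + 2 comes from the two Riemann-Hurwitz equations.\<close>

lemma convolution_by_genus:
  fixes f h :: "nat \<Rightarrow> real"
  assumes M: "m + 4 = 2 * g + e1 + e2" and e: "2 \<le> e1" "2 \<le> e2"
    and f: "\<And>j. f j \<noteq> 0 \<Longrightarrow> \<exists>g. j + 2 = 2 * g + e1" and h: "\<And>j. h j \<noteq> 0 \<Longrightarrow> \<exists>g. j + 2 = 2 * g + e2"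
  shows "(\<Sum>j\<le>m. f j * h (m - j)) = (\<Sum>(g1, g2)\<in>{(g1, g2). g1 + g2 = g}. f (2 * g1 + e1 - 2) * h (2 * g2 + e2 - 2))"
proof -
  let ?G = "{(g1, g2). g1 + g2 = g}" and ?\<phi> = "\<lambda>(g1 :: nat, g2 :: nat). 2 * g1 + e1 - 2"
  have inj: "inj_on ?\<phi> ?G" using e by (auto simp: inj_on_def)
  have sub: "?\<phi> ` ?G \<subseteq> {..m}" using M e by auto
  have "(\<Sum>j\<le>m. f j * h (m - j)) = (\<Sum>j\<in>?\<phi> ` ?G. f j * h (m - j))"
  proof (rule sum.mono_neutral_right[OF _ sub])
    show "\<forall>j\<in>{..m} - ?\<phi> ` ?G. f j * h (m - j) = 0"
    proof (rule ballI, rule ccontr)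
      fix j assume j: "j \<in> {..m} - ?\<phi> ` ?G" and "f j * h (m - j) \<noteq> 0"
      then obtain g1 g2 where g: "j + 2 = 2 * g1 + e1" "m - j + 2 = 2 * g2 + e2" using f h by fastforce
      then have "g1 + g2 = g" using M j by auto
      then have "j \<in> ?\<phi> ` ?G" using g(1) by (intro image_eqI[of _ _ "(g1, g2)"]) auto
      then show False using j by blast
    qed
  qed simp
  also have "\<dots> = (\<Sum>x\<in>?G. f (?\<phi> x) * h (m - ?\<phi> x))" using inj by (simp add: sum.reindex)
  also have "\<dots> = (\<Sum>(g1, g2)\<in>?G. f (2 * g1 + e1 - 2) * h (2 * g2 + e2 - 2))"
  proof (rule sum.cong[OF refl])
    fix x assume "x \<in> ?G"
    then obtain g1 g2 where x: "x = (g1, g2)" "g1 + g2 = g" by auto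
    have "m - (2 * g1 + e1 - 2) = 2 * g2 + e2 - 2" using M e x(2) by auto
    then show "f (?\<phi> x) * h (m - ?\<phi> x) = (case x of (g1, g2) \<Rightarrow> f (2 * g1 + e1 - 2) * h (2 * g2 + e2 - 2))"
      by (simp add: x(1))
  qed
  finally show ?thesis .
qed

text \<open>binom(k-1, k1) is k2/k times binom(k, k1), and the full binomial coefficient splits the
  normalisation for k blocks into those for k1 and k2.\<close>

lemma block_choice_weight:
  assumes "0 < a" "0 < k1" "0 < k2" "k = k1 + k2"
  shows "real (k - 1 choose k1) / (real a ^ k * fact k) =
    real (a * k2) / real (a * k) / (real a ^ k1 * fact k1) / (real a ^ k2 * fact k2)"
proof -
  have "real (k - 1 choose k1) = fact (k - 1) / (fact k1 * fact (k - 1 - k1))"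
    using assms by (intro binomial_fact) simp
  moreover have "k - 1 - k1 = k2 - 1" using assms by simp
  moreover have "fact k = real k * fact (k - 1)" "fact k2 = real k2 * fact (k2 - 1)"
    using assms by (simp_all add: fact_reduce)
  ultimately show ?thesis using assms by (simp add: power_add)
qed

text \<open>The size of X leaves a single possible number of blocks for its component, so the sum
  over i collapses to one term. If that size is not a multiple of a, both sides vanish.\<close>

lemma disconnected_term:
  assumes a: "0 < a" and d: "sum_list X + (\<alpha> + sum_list Y) = a * k" and pos: "all_pos X" "X \<noteq> []" "1 \<le> \<alpha>" "all_pos Y"
    and l: "1 \<le> l" "l \<le> a" and m: "m + 4 = 2 * g + length X + Suc (length Y) + k"
  shows "(\<Sum>i\<le>k - 1. real (k - 1 choose i) * (\<Sum>j\<le>m. real (conn_count a i j X) * real (bounded_count a (k - i) (m - j) l \<alpha> Y))) /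
      (real a ^ k * fact k) =
    (\<Sum>(g1, g2)\<in>{(g1, g2). g1 + g2 = g}. real (sum_list Y + \<alpha>) / real (a * k) *
      (monotone_hurwitz a g1 X * (\<Sum>p=1..l. refined_hurwitz a g2 p \<alpha> Y)))" (is "?L = ?R")
proof (cases "a dvd sum_list X")
  case False
  have "conn_count a i j X = 0" for i j
    using conn_count_genus(2)[OF a _ pos(2,1), of i j] False by (metis dvd_triv_left)
  then show ?thesis using monotone_hurwitz_not_dvd[OF a False] by simp
next
  case True
  then obtain k1 where k1: "sum_list X = a * k1" by (rule dvdE)
  define k2 where "k2 = k - k1"
  have "0 < sum_list X" using pos(1,2) by (cases X) auto
  then have k1p: "0 < k1" using k1 by (cases k1) auto
  have "a * k1 < a * k" using d k1 pos(3) by linarith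
  then have "k1 < k" by simp
  then have k2p: "0 < k2" and kk: "k = k1 + k2" by (simp_all add: k2_def)
  have d2: "\<alpha> + sum_list Y = a * k2" using d k1 kk by (simp add: algebra_simps)
  let ?f = "\<lambda>j. real (conn_count a k1 j X)" and ?h = "\<lambda>j. real (bounded_count a k2 j l \<alpha> Y)"
  let ?W = "\<lambda>k. real a ^ k * fact k"
  have "(\<Sum>i\<le>k - 1. real (k - 1 choose i) * (\<Sum>j\<le>m. real (conn_count a i j X) * real (bounded_count a (k - i) (m - j) l \<alpha> Y))) =
    (\<Sum>i\<in>{k1}. real (k - 1 choose i) * (\<Sum>j\<le>m. real (conn_count a i j X) * real (bounded_count a (k - i) (m - j) l \<alpha> Y)))"
  proof (rule sum.mono_neutral_right)
    show "\<forall>i\<in>{..k - 1} - {k1}. real (k - 1 choose i) * (\<Sum>j\<le>m. real (conn_count a i j X) * real (bounded_count a (k - i) (m - j) l \<alpha> Y)) = 0"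
    proof
      fix i assume i: "i \<in> {..k - 1} - {k1}"
      have "conn_count a i j X = 0" for j
        using conn_count_genus(2)[OF a _ pos(2,1), of i j] k1 a i by auto
      then show "real (k - 1 choose i) * (\<Sum>j\<le>m. real (conn_count a i j X) * real (bounded_count a (k - i) (m - j) l \<alpha> Y)) = 0"
        by simp
    qed
  qed (use kk k2p in auto)
  also have "\<dots> = real (k - 1 choose k1) * (\<Sum>j\<le>m. ?f j * ?h (m - j))" by (simp add: k2_def)
  also have "(\<Sum>j\<le>m. ?f j * ?h (m - j)) = (\<Sum>(g1, g2)\<in>{(g1, g2). g1 + g2 = g}.
      ?f (2 * g1 + (length X + k1) - 2) * ?h (2 * g2 + (Suc (length Y) + k2) - 2))"
  proof (rule convolution_by_genus)
    show "m + 4 = 2 * g + (length X + k1) + (Suc (length Y) + k2)" using m kk by simp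
    show "2 \<le> length X + k1" using k1p pos(2) by (cases X) auto
    show "\<exists>g. j + 2 = 2 * g + (length X + k1)" if "?f j \<noteq> 0" for j
      using conn_count_genus(1)[OF a _ pos(2,1), of k1 j] that by (simp add: add.assoc)
    show "\<exists>g. j + 2 = 2 * g + (Suc (length Y) + k2)" if "?h j \<noteq> 0" for j
      using bounded_count_genus[OF a _ pos(3,4), of k2 j l] that by (simp add: add.assoc)
  qed (use k2p in simp)
  finally have "?L = real (k - 1 choose k1) / ?W k * (\<Sum>(g1, g2)\<in>{(g1, g2). g1 + g2 = g}.
      ?f (2 * g1 + (length X + k1) - 2) * ?h (2 * g2 + (Suc (length Y) + k2) - 2))" by simp
  also have "\<dots> = (\<Sum>(g1, g2)\<in>{(g1, g2). g1 + g2 = g}. real (a * k2) / real (a * k) *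
      (?f (2 * g1 + length X + k1 - 2) / ?W k1 * (?h (2 * g2 + Suc (length Y) + k2 - 2) / ?W k2)))"
    unfolding block_choice_weight[OF a k1p k2p kk] sum_distrib_left by (intro sum.cong refl) (simp add: case_prod_beta add.assoc)
  also have "\<dots> = ?R"
    using monotone_hurwitz_eq[OF a k1 k1p pos(2)] sum_refined_hurwitz[OF a d2 k2p l] d2
    by (intro sum.cong refl) (simp add: case_prod_beta add.commute)
  finally show ?thesis .
qed

text \<open>The base point is followed by a - l points of its block, and the -1 inside the step
  function turns the strict inequality into \<ge> 0.\<close>

lemma heaviside_eq:
  assumes "1 \<le> l" "l \<le> a" "0 < k"
  shows "heaviside (int c + int l - int a - 1) = of_bool (a * k - (a * k - a + l) < c)"
proof -
  have "a * k - (a * k - a + l) = a - l" using assms by (cases k) auto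
  moreover have "a - l < c \<longleftrightarrow> int a < int c + int l" using assms(2) by linarith
  ultimately show ?thesis by (simp add: heaviside_def)
qed

theorem cut_and_join_hurwitz:
  assumes a: "0 < a" shows "cut_and_join a (monotone_hurwitz a) (refined_hurwitz a)"
  unfolding cut_and_join_def
proof (intro allI ballI impI, elim conjE)
  fix g \<mu>1 l :: nat and \<nu> :: "nat list"
  assume l: "l \<in> {1..a}" and \<mu>1: "1 \<le> \<mu>1" and \<nu>: "all_pos \<nu>" and nb: "\<not> (g = 0 \<and> \<nu> = [] \<and> \<mu>1 = a)"
  let ?R = "refined_hurwitz a" and ?H = "monotone_hurwitz a" and ?d = "\<mu>1 + sum_list \<nu>"
  let ?G = "{(g1, g2). g1 + g2 = g}"
  have l': "1 \<le> l" "l \<le> a" using l by auto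
  define T1 where "T1 = heaviside (int \<mu>1 + int l - int a - 1) *
            (\<Sum>p=1..l. \<Sum>i<length \<nu>. ?R g p (\<mu>1 + \<nu> ! i) (nths \<nu> ({..<length \<nu>} - {i})))"
  define T2 where "T2 = (\<Sum>(\<alpha>, \<beta>)\<in>splits \<mu>1. \<Sum>p=1..l. real \<beta> * (if g = 0 then 0 else ?R (g - 1) p \<alpha> (\<nu> @ [\<beta>])))"
  define T3 where "T3 = (\<Sum>(\<alpha>, \<beta>)\<in>splits \<mu>1. \<Sum>(g1, g2)\<in>?G. \<Sum>(I, J)\<in>index_splits (length \<nu>). \<Sum>p=1..l.
             real (sum_list (nths \<nu> J) + \<alpha>) / real ?d * real \<beta> * ?H g1 (nths \<nu> I @ [\<beta>]) * ?R g2 p \<alpha> (nths \<nu> J))"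
  have T1_eq: "T1 = heaviside (int \<mu>1 + int l - int a - 1) *
      (\<Sum>i<length \<nu>. \<Sum>p=1..l. ?R g p (\<mu>1 + \<nu> ! i) (drop_nth i \<nu>))"
  proof -
    have "(\<Sum>p=1..l. \<Sum>i<length \<nu>. ?R g p (\<mu>1 + \<nu> ! i) (nths \<nu> ({..<length \<nu>} - {i}))) =
      (\<Sum>p=1..l. \<Sum>i<length \<nu>. ?R g p (\<mu>1 + \<nu> ! i) (drop_nth i \<nu>))"
      by (intro sum.cong refl) (simp add: nths_remove_index)
    also have "\<dots> = (\<Sum>i<length \<nu>. \<Sum>p=1..l. ?R g p (\<mu>1 + \<nu> ! i) (drop_nth i \<nu>))" by (rule sum.swap)
    finally show ?thesis by (simp add: T1_def)
  qed
  have T2_eq: "T2 = (\<Sum>(\<alpha>, \<beta>)\<in>splits \<mu>1. real \<beta> * (if g = 0 then 0 else \<Sum>p=1..l. ?R (g - 1) p \<alpha> (\<nu> @ [\<beta>])))"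
    unfolding T2_def by (cases "g = 0") (simp_all add: case_prod_beta sum_distrib_left)
  have T3_eq: "T3 = (\<Sum>(\<alpha>, \<beta>)\<in>splits \<mu>1. real \<beta> * (\<Sum>(I, J)\<in>index_splits (length \<nu>). \<Sum>(g1, g2)\<in>?G.
      real (sum_list (nths \<nu> J) + \<alpha>) / real ?d * (?H g1 (nths \<nu> I @ [\<beta>]) * (\<Sum>p=1..l. ?R g2 p \<alpha> (nths \<nu> J)))))"
    unfolding T3_def
  proof (intro sum.cong refl, clarify)
    fix \<alpha> \<beta>
    have "(\<Sum>x\<in>?G. \<Sum>y\<in>index_splits (length \<nu>). \<Sum>p=1..l.
             real (sum_list (nths \<nu> (snd y)) + \<alpha>) / real ?d * real \<beta> * ?H (fst x) (nths \<nu> (fst y) @ [\<beta>]) * ?R (snd x) p \<alpha> (nths \<nu> (snd y))) =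
      (\<Sum>y\<in>index_splits (length \<nu>). \<Sum>x\<in>?G. \<Sum>p=1..l.
             real (sum_list (nths \<nu> (snd y)) + \<alpha>) / real ?d * real \<beta> * ?H (fst x) (nths \<nu> (fst y) @ [\<beta>]) * ?R (snd x) p \<alpha> (nths \<nu> (snd y)))"
      by (rule sum.swap)
    then show "(\<Sum>(g1, g2)\<in>?G. \<Sum>(I, J)\<in>index_splits (length \<nu>). \<Sum>p=1..l.
             real (sum_list (nths \<nu> J) + \<alpha>) / real ?d * real \<beta> * ?H g1 (nths \<nu> I @ [\<beta>]) * ?R g2 p \<alpha> (nths \<nu> J)) =
      real \<beta> * (\<Sum>(I, J)\<in>index_splits (length \<nu>). \<Sum>(g1, g2)\<in>?G.
      real (sum_list (nths \<nu> J) + \<alpha>) / real ?d * (?H g1 (nths \<nu> I @ [\<beta>]) * (\<Sum>p=1..l. ?R g2 p \<alpha> (nths \<nu> J))))"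
      by (simp add: case_prod_beta sum_distrib_left mult_ac)
  qed
  have IJ: "sum_list (nths \<nu> I) + sum_list (nths \<nu> J) = sum_list \<nu>" "length (nths \<nu> I) + length (nths \<nu> J) = length \<nu>"
    if "(I, J) \<in> index_splits (length \<nu>)" for I J
    using nths_split[of I J \<nu>] that by (auto simp: index_splits_def)
  have sp: "1 \<le> \<alpha>" "1 \<le> \<beta>" "\<alpha> + \<beta> = \<mu>1" if "(\<alpha>, \<beta>) \<in> splits \<mu>1" for \<alpha> \<beta>
    using that by (auto simp: splits_def)
  have "?R g l \<mu>1 \<nu> = T1 + T2 + T3"
  proof (cases "a dvd ?d")
    \<comment> \<open>Joins and cuts preserve the total size, and in the disconnected term at least
      one of the two sizes is not a multiple of a; so every term vanishes.\<close>
    case False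
    have "?R g p (\<mu>1 + \<nu> ! i) (drop_nth i \<nu>) = 0" if "i < length \<nu>" for i p
      using sum_list_drop_nth[OF that] False by (intro refined_hurwitz_not_dvd) (simp add: add.assoc)
    then have "T1 = 0" unfolding T1_eq by simp
    moreover have "?R (g - 1) p \<alpha> (\<nu> @ [\<beta>]) = 0" if "(\<alpha>, \<beta>) \<in> splits \<mu>1" for p \<alpha> \<beta>
      using sp(3)[OF that] False by (intro refined_hurwitz_not_dvd) (auto simp: ac_simps)
    then have "T2 = 0" unfolding T2_eq by (intro sum.neutral) auto
    moreover have "?H g1 (nths \<nu> I @ [\<beta>]) * (\<Sum>p=1..l. ?R g2 p \<alpha> (nths \<nu> J)) = 0"
      if "(\<alpha>, \<beta>) \<in> splits \<mu>1" "(I, J) \<in> index_splits (length \<nu>)" for \<alpha> \<beta> I J g1 g2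
    proof (cases "a dvd sum_list (nths \<nu> I @ [\<beta>])")
      case True
      have "?d = sum_list (nths \<nu> I @ [\<beta>]) + (\<alpha> + sum_list (nths \<nu> J))"
        using sp(3)[OF that(1)] IJ(1)[OF that(2)] by simp
      then have "\<not> a dvd \<alpha> + sum_list (nths \<nu> J)" using True False by (metis dvd_add)
      then show ?thesis by (simp add: refined_hurwitz_not_dvd)
    qed (simp add: monotone_hurwitz_not_dvd[OF a])
    then have "T3 = 0" unfolding T3_eq by (intro sum.neutral) (auto intro!: sum.neutral)
    ultimately show ?thesis using refined_hurwitz_not_dvd[OF False] by simp
  next
    case True
    then obtain k where d: "?d = a * k" by (rule dvdE)
    have k: "0 < k" using d \<mu>1 by (cases k) auto
    \<comment> \<open>One transposition fewer than on the left-hand side. Excluding the base case is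
      what prevents truncation here.\<close>
    define m where "m = 2 * g + length \<nu> + k - 2"
    have m2: "2 \<le> 2 * g + length \<nu> + k"
    proof (rule ccontr)
      assume "\<not> ?thesis"
      then have "g = 0" "length \<nu> = 0" "k = 1" using k by linarith+
      then show False using nb d by simp
    qed
    have Sm: "2 * g + Suc (length \<nu>) + k - 2 = Suc m" using m2 by (simp add: m_def)
    let ?W = "real a ^ k * fact k" and ?V = "{1..a * k}" and ?s = "standard_perm a (a * k)" and ?b = "a * k - a + l"
    have W: "?W > 0" using a by simp
    have b: "1 \<le> ?b" "?b \<le> a * k" using l' k by (cases k; simp)+
    have step: "last_count a k (Suc m) l \<mu>1 \<nu> =
      (if a * k - ?b < \<mu>1 then \<Sum>i<length \<nu>. bounded_count a k m l (\<mu>1 + \<nu> ! i) (drop_nth i \<nu>) else 0)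
      + (\<Sum>(\<alpha>, \<beta>)\<in>splits \<mu>1. \<beta> * bounded_count a k m l \<alpha> (\<nu> @ [\<beta>]))
      + (\<Sum>(\<alpha>, \<beta>)\<in>splits \<mu>1. \<beta> * (\<Sum>i\<le>k - 1. (k - 1 choose i) * (\<Sum>j\<le>m. \<Sum>(I, J)\<in>index_splits (length \<nu>).
          conn_count a i j (nths \<nu> I @ [\<beta>]) * bounded_count a (k - i) (m - j) l \<alpha> (nths \<nu> J))))"
      using card_last_facs_step[OF standard_perm_permutes b standard_perm_last_block[OF k l'(1)] \<mu>1, of \<nu> m] \<nu>
      unfolding last_count_def bounded_count_def sum_split_facs[OF a k l'] all_pos_def by simp
    have S1: "real (if a * k - ?b < \<mu>1 then \<Sum>i<length \<nu>. bounded_count a k m l (\<mu>1 + \<nu> ! i) (drop_nth i \<nu>) else 0) / ?W = T1"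
    proof -
      have "(\<Sum>p=1..l. ?R g p (\<mu>1 + \<nu> ! i) (drop_nth i \<nu>)) =
          real (bounded_count a k m l (\<mu>1 + \<nu> ! i) (drop_nth i \<nu>)) / ?W" if i: "i < length \<nu>" for i
      proof -
        have "Suc (length (drop_nth i \<nu>)) = length \<nu>" using length_drop_nth[OF i] i by simp
        moreover have "\<mu>1 + \<nu> ! i + sum_list (drop_nth i \<nu>) = a * k" using sum_list_drop_nth[OF i] d by simp
        ultimately show ?thesis using sum_refined_hurwitz[OF a _ k l', of "\<mu>1 + \<nu> ! i" "drop_nth i \<nu>" g]
          by (simp add: m_def)
      qed
      then show ?thesis unfolding T1_eq heaviside_eq[OF l' k] by (simp add: sum_divide_distrib)
    qed
    have S2: "real (\<Sum>(\<alpha>, \<beta>)\<in>splits \<mu>1. \<beta> * bounded_count a k m l \<alpha> (\<nu> @ [\<beta>])) / ?W = T2"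
    proof -
      have "real (bounded_count a k m l \<alpha> (\<nu> @ [\<beta>])) / ?W = (if g = 0 then 0 else \<Sum>p=1..l. ?R (g - 1) p \<alpha> (\<nu> @ [\<beta>]))"
        if s: "(\<alpha>, \<beta>) \<in> splits \<mu>1" for \<alpha> \<beta>
      proof (cases "g = 0")
        case True
        \<comment> \<open>A connected prefix with one more cycle would need genus -1.\<close>
        have "bounded_count a k m l \<alpha> (\<nu> @ [\<beta>]) = 0"
        proof (rule ccontr)
          assume nz: "bounded_count a k m l \<alpha> (\<nu> @ [\<beta>]) \<noteq> 0"
          have "all_pos (\<nu> @ [\<beta>])" using \<nu> sp(2)[OF s] by simp
          then obtain g' where "m + 2 = 2 * g' + Suc (length (\<nu> @ [\<beta>])) + k"
            using bounded_count_genus[OF a nz sp(1)[OF s]] by blast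
          then show False using m2 by (simp add: m_def True)
        qed
        then show ?thesis using True by simp
      next
        case False
        have "\<alpha> + sum_list (\<nu> @ [\<beta>]) = a * k" using sp(3)[OF s] d by simp
        moreover have "2 * (g - 1) + Suc (length (\<nu> @ [\<beta>])) + k - 2 = m" using False by (cases g) (auto simp: m_def)
        ultimately show ?thesis using sum_refined_hurwitz[OF a _ k l', of \<alpha> "\<nu> @ [\<beta>]" "g - 1"] False by simp
      qed
      then have "(\<Sum>x\<in>splits \<mu>1. real (snd x) * (real (bounded_count a k m l (fst x) (\<nu> @ [snd x])) / ?W)) =
        (\<Sum>x\<in>splits \<mu>1. real (snd x) * (if g = 0 then 0 else \<Sum>p=1..l. ?R (g - 1) p (fst x) (\<nu> @ [snd x])))"
        by (intro sum.cong refl) auto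
      then show ?thesis unfolding T2_eq by (simp add: case_prod_beta sum_divide_distrib)
    qed
    define F where "F \<alpha> \<beta> = (\<Sum>i\<le>k - 1. (k - 1 choose i) * (\<Sum>j\<le>m. \<Sum>(I, J)\<in>index_splits (length \<nu>).
          conn_count a i j (nths \<nu> I @ [\<beta>]) * bounded_count a (k - i) (m - j) l \<alpha> (nths \<nu> J)))" for \<alpha> \<beta>
    define K where "K \<alpha> \<beta> = (\<Sum>(I, J)\<in>index_splits (length \<nu>). \<Sum>(g1, g2)\<in>?G.
          real (sum_list (nths \<nu> J) + \<alpha>) / real ?d * (?H g1 (nths \<nu> I @ [\<beta>]) * (\<Sum>p=1..l. ?R g2 p \<alpha> (nths \<nu> J))))" for \<alpha> \<beta>
    have S3: "real (\<Sum>(\<alpha>, \<beta>)\<in>splits \<mu>1. \<beta> * F \<alpha> \<beta>) / ?W = T3"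
    proof -
      have FK: "real (F \<alpha> \<beta>) / ?W = K \<alpha> \<beta>" if s: "(\<alpha>, \<beta>) \<in> splits \<mu>1" for \<alpha> \<beta>
      proof -
        let ?c = "\<lambda>i j I. real (conn_count a i j (nths \<nu> I @ [\<beta>]))"
        let ?h = "\<lambda>i j J. real (bounded_count a (k - i) (m - j) l \<alpha> (nths \<nu> J))"
        have "real (F \<alpha> \<beta>) =
          (\<Sum>i\<le>k - 1. \<Sum>j\<le>m. \<Sum>x\<in>index_splits (length \<nu>). real (k - 1 choose i) * (?c i j (fst x) * ?h i j (snd x)))"
          by (simp add: F_def case_prod_beta sum_distrib_left)
        also have "\<dots> = (\<Sum>i\<le>k - 1. \<Sum>x\<in>index_splits (length \<nu>). \<Sum>j\<le>m. real (k - 1 choose i) * (?c i j (fst x) * ?h i j (snd x)))"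
          by (intro sum.cong refl sum.swap)
        also have "\<dots> = (\<Sum>x\<in>index_splits (length \<nu>). \<Sum>i\<le>k - 1. \<Sum>j\<le>m. real (k - 1 choose i) * (?c i j (fst x) * ?h i j (snd x)))"
          by (rule sum.swap)
        finally have "real (F \<alpha> \<beta>) / ?W =
          (\<Sum>x\<in>index_splits (length \<nu>). (\<Sum>i\<le>k - 1. real (k - 1 choose i) * (\<Sum>j\<le>m. ?c i j (fst x) * ?h i j (snd x))) / ?W)"
          by (simp add: sum_divide_distrib sum_distrib_left)
        also have "\<dots> = K \<alpha> \<beta>"
          unfolding K_def
        proof (rule sum.cong[OF refl])
          fix x assume x: "x \<in> index_splits (length \<nu>)"
          obtain I J where xe: "x = (I, J)" by force
          note ij = IJ[OF x[unfolded xe]]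
          have "sum_list (nths \<nu> I @ [\<beta>]) + (\<alpha> + sum_list (nths \<nu> J)) = a * k"
            using ij(1) sp(3)[OF s] d by simp
          moreover have "m + 4 = 2 * g + length (nths \<nu> I @ [\<beta>]) + Suc (length (nths \<nu> J)) + k"
            using ij(2) m2 by (simp add: m_def)
          ultimately show "(\<Sum>i\<le>k - 1. real (k - 1 choose i) * (\<Sum>j\<le>m. ?c i j (fst x) * ?h i j (snd x))) / ?W =
            (case x of (I, J) \<Rightarrow> \<Sum>(g1, g2)\<in>?G.
          real (sum_list (nths \<nu> J) + \<alpha>) / real ?d * (?H g1 (nths \<nu> I @ [\<beta>]) * (\<Sum>p=1..l. ?R g2 p \<alpha> (nths \<nu> J))))"
            unfolding xe d fst_conv snd_conv case_prod_conv
            using disconnected_term[OF a, of "nths \<nu> I @ [\<beta>]" \<alpha> "nths \<nu> J" k l m g] l' \<nu> sp(1,2)[OF s] all_pos_nths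
            by simp
        qed
        finally show ?thesis .
      qed
      have "real (\<Sum>(\<alpha>, \<beta>)\<in>splits \<mu>1. \<beta> * F \<alpha> \<beta>) / ?W =
        (\<Sum>x\<in>splits \<mu>1. real (snd x) * (real (F (fst x) (snd x)) / ?W))"
        by (simp add: case_prod_beta sum_divide_distrib)
      also have "\<dots> = (\<Sum>x\<in>splits \<mu>1. real (snd x) * K (fst x) (snd x))"
        using FK by (intro sum.cong refl) simp
      also have "\<dots> = T3" unfolding T3_eq K_def[symmetric] by (simp add: case_prod_beta)
      finally show ?thesis .
    qed
    have "?R g l \<mu>1 \<nu> = real (last_count a k (Suc m) l \<mu>1 \<nu>) / ?W"
      using refined_hurwitz_eq[OF a d k l' nb] unfolding Sm .
    then show ?thesis unfolding step F_def[symmetric] of_nat_add add_divide_distrib S1 S2 S3 .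
  qed
  then show "?R g l \<mu>1 \<nu> =
          heaviside (int \<mu>1 + int l - int a - 1) *
            (\<Sum>p=1..l. \<Sum>i<length \<nu>. ?R g p (\<mu>1 + \<nu> ! i) (nths \<nu> ({..<length \<nu>} - {i})))
        + (\<Sum>(\<alpha>, \<beta>) \<in> {(\<alpha>, \<beta>). 1 \<le> \<alpha> \<and> 1 \<le> \<beta> \<and> \<alpha> + \<beta> = \<mu>1}. \<Sum>p=1..l.
            real \<beta> * (if g = 0 then 0 else ?R (g - 1) p \<alpha> (\<nu> @ [\<beta>])))
        + (\<Sum>(\<alpha>, \<beta>) \<in> {(\<alpha>, \<beta>). 1 \<le> \<alpha> \<and> 1 \<le> \<beta> \<and> \<alpha> + \<beta> = \<mu>1}.
           \<Sum>(g1, g2) \<in> {(g1, g2). g1 + g2 = g}.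
           \<Sum>(I, J) \<in> {(I, J). I \<union> J = {..<length \<nu>} \<and> I \<inter> J = {}}.
           \<Sum>p=1..l.
             real (sum_list (nths \<nu> J) + \<alpha>) / real (\<mu>1 + sum_list \<nu>) * real \<beta> *
             ?H g1 (nths \<nu> I @ [\<beta>]) * ?R g2 p \<alpha> (nths \<nu> J))"
    unfolding T1_def T2_def T3_def splits_def index_splits_def .
qed

section \<open>Uniqueness\<close>

text \<open>The induction runs over the refined family alone; each value of H in the recursion is
  first expanded by the sum relation into refined values, which are smaller as well because \<alpha>
  is positive.\<close>

theorem recursion_unique:
  assumes rel: "sum_relation a H R" "base_case a R" "cut_and_join a H R"
    and rel': "sum_relation a H' R'" "base_case a R'" "cut_and_join a H' R'"
  shows "l \<in> {1..a} \<Longrightarrow> 1 \<le> \<mu>1 \<Longrightarrow> all_pos \<nu> \<Longrightarrow> R g l \<mu>1 \<nu> = R' g l \<mu>1 \<nu>"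
    "\<mu> \<noteq> [] \<Longrightarrow> all_pos \<mu> \<Longrightarrow> H g \<mu> = H' g \<mu>"
proof -
  \<comment> \<open>Genus has weight 2 so that lowering it outweighs the additional part \<beta>.
    The cut term loses a part, and in the product term positivity of \<alpha> and \<beta> lowers the
    total size of both factors.\<close>
  define size where "size g \<mu>1 \<nu> = 2 * g + length \<nu> + \<mu>1 + sum_list \<nu>" for g \<mu>1 and \<nu> :: "nat list"
  have drop: "length (drop_nth i \<mu>) = length \<mu> - 1" "\<mu> ! i + sum_list (drop_nth i \<mu>) = sum_list \<mu>"
    "1 \<le> \<mu> ! i" "all_pos (drop_nth i \<mu>)" if "i < length \<mu>" "all_pos \<mu>" for i \<mu>
    using that length_drop_nth sum_list_drop_nth all_pos_drop_nth by (auto simp: all_pos_def)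
  have H_from_R: "H g \<mu> = H' g \<mu>"
    if \<mu>: "\<mu> \<noteq> []" "all_pos \<mu>" and R: "\<And>l i. l \<in> {1..a} \<Longrightarrow> i < length \<mu> \<Longrightarrow>
      R g l (\<mu> ! i) (drop_nth i \<mu>) = R' g l (\<mu> ! i) (drop_nth i \<mu>)" for g \<mu>
  proof -
    have "H g \<mu> = (\<Sum>i<length \<mu>. \<Sum>l=1..a. R g l (\<mu> ! i) (nths \<mu> ({..<length \<mu>} - {i})))"
      using rel(1) \<mu> by (simp add: sum_relation_def)
    also have "\<dots> = (\<Sum>i<length \<mu>. \<Sum>l=1..a. R' g l (\<mu> ! i) (nths \<mu> ({..<length \<mu>} - {i})))"
      using R by (intro sum.cong refl) (simp add: nths_remove_index)
    also have "\<dots> = H' g \<mu>" using rel'(1) \<mu> by (simp add: sum_relation_def)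
    finally show ?thesis .
  qed
  have R: "R g l \<mu>1 \<nu> = R' g l \<mu>1 \<nu>" if "l \<in> {1..a}" "1 \<le> \<mu>1" "all_pos \<nu>" for g l \<mu>1 \<nu>
    using that
  proof (induction "size g \<mu>1 \<nu>" arbitrary: g l \<mu>1 \<nu> rule: less_induct)
    case less
    note l = less.prems(1) and \<mu>1 = less.prems(2) and \<nu> = less.prems(3)
    have IH: "R g' p \<mu>1' \<nu>' = R' g' p \<mu>1' \<nu>'"
      if "size g' \<mu>1' \<nu>' < size g \<mu>1 \<nu>" "p \<in> {1..l}" "1 \<le> \<mu>1'" "all_pos \<nu>'" for g' p \<mu>1' \<nu>'
      using less.hyps[OF that(1) _ that(3,4)] that(2) l by simp
    show ?case
    proof (cases "g = 0 \<and> \<nu> = [] \<and> \<mu>1 = a")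
      case True
      then show ?thesis using rel(2) rel'(2) l by (simp add: base_case_def)
    next
      case nb: False
      have 1: "R g p (\<mu>1 + \<nu> ! i) (nths \<nu> ({..<length \<nu>} - {i})) = R' g p (\<mu>1 + \<nu> ! i) (nths \<nu> ({..<length \<nu>} - {i}))"
        if "p \<in> {1..l}" "i < length \<nu>" for p i
        unfolding nths_remove_index[OF that(2)] using drop[OF that(2) \<nu>] that \<mu>1
        by (intro IH) (auto simp: size_def)
      have 2: "(if g = 0 then 0 else R (g - 1) p \<alpha> (\<nu> @ [\<beta>])) = (if g = 0 then 0 else R' (g - 1) p \<alpha> (\<nu> @ [\<beta>]))"
        if "p \<in> {1..l}" "1 \<le> \<alpha>" "1 \<le> \<beta>" "\<alpha> + \<beta> = \<mu>1" for p \<alpha> \<beta>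
        using that \<nu> by (cases "g = 0") (auto intro!: IH simp: size_def)
      have 3: "H g1 (nths \<nu> I @ [\<beta>]) = H' g1 (nths \<nu> I @ [\<beta>]) \<and> R g2 p \<alpha> (nths \<nu> J) = R' g2 p \<alpha> (nths \<nu> J)"
        if "p \<in> {1..l}" "1 \<le> \<alpha>" "1 \<le> \<beta>" "\<alpha> + \<beta> = \<mu>1" "g1 + g2 = g" "I \<union> J = {..<length \<nu>}" "I \<inter> J = {}" for p \<alpha> \<beta> g1 g2 I J
      proof
        note sp = nths_split[of I J \<nu>]
        have s: "sum_list (nths \<nu> I) + sum_list (nths \<nu> J) = sum_list \<nu>" "length (nths \<nu> I) + length (nths \<nu> J) = length \<nu>"
          using sp that(6,7) by auto
        let ?X = "nths \<nu> I @ [\<beta>]"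
        have pos: "all_pos ?X" "all_pos (nths \<nu> J)" using all_pos_nths[OF \<nu>] that(3) by auto
        show "H g1 ?X = H' g1 ?X"
        proof (rule H_from_R[OF _ pos(1)])
          fix q i assume q: "q \<in> {1..a}" and i: "i < length ?X"
          have "size g1 (?X ! i) (drop_nth i ?X) < size g \<mu>1 \<nu>"
            using drop(1,2)[OF i pos(1)] s that(2-5) unfolding size_def by simp
          then show "R g1 q (?X ! i) (drop_nth i ?X) = R' g1 q (?X ! i) (drop_nth i ?X)"
            using less.hyps q drop(3,4)[OF i pos(1)] by blast
        qed simp
        show "R g2 p \<alpha> (nths \<nu> J) = R' g2 p \<alpha> (nths \<nu> J)"
          using that s pos by (intro IH) (auto simp: size_def)
      qed
      have c: "\<mu>1 \<ge> 1 \<and> all_pos \<nu> \<and> \<not> (g = 0 \<and> \<nu> = [] \<and> \<mu>1 = a)" using \<mu>1 \<nu> nb by blast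
      note E = rel(3)[unfolded cut_and_join_def, rule_format, OF l c]
      note E' = rel'(3)[unfolded cut_and_join_def, rule_format, OF l c]
      show ?thesis
        unfolding E E'
        by (intro arg_cong2[where f = "(+)"] arg_cong2[where f = "(*)"] refl sum.cong; use 1 2 3 in \<open>auto intro!: sum.cong\<close>)
    qed
  qed
  show "l \<in> {1..a} \<Longrightarrow> 1 \<le> \<mu>1 \<Longrightarrow> all_pos \<nu> \<Longrightarrow> R g l \<mu>1 \<nu> = R' g l \<mu>1 \<nu>" by (rule R)
  show "\<mu> \<noteq> [] \<Longrightarrow> all_pos \<mu> \<Longrightarrow> H g \<mu> = H' g \<mu>"
    using R drop(3,4) by (intro H_from_R) auto
qed

theorem theorem2:
  fixes a :: nat
  assumes "a \<ge> 1"
  shows "sum_relation a (monotone_hurwitz a) (refined_hurwitz a) \<and>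
    base_case a (refined_hurwitz a) \<and>
    cut_and_join a (monotone_hurwitz a) (refined_hurwitz a) \<and>
    (\<forall>H R. sum_relation a H R \<and> base_case a R \<and> cut_and_join a H R \<longrightarrow>
       (\<forall>g \<mu>. \<mu> \<noteq> [] \<and> all_pos \<mu> \<longrightarrow> H g \<mu> = monotone_hurwitz a g \<mu>) \<and>
       (\<forall>g l \<mu>1 \<nu>. l \<in> {1..a} \<and> \<mu>1 \<ge> 1 \<and> all_pos \<nu> \<longrightarrow>
          R g l \<mu>1 \<nu> = refined_hurwitz a g l \<mu>1 \<nu>))"
proof -
  have a: "0 < a" using assms by simp
  note P = sum_relation_hurwitz[OF a] base_case_hurwitz[OF a] cut_and_join_hurwitz[OF a]
  show ?thesis using P recursion_unique[OF _ _ _ P] by blast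
qed

end
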